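(* Let $d\ge1$, $H>0$ and $g\in\mathcal{G}_1$. If there exists a non-deterministic $H$-selfsimilar additive process $\{X(t)\}$ on $\mathbb{R}^d$ such that $$\limsup_{t\to\infty}\frac{|X(t)|}{t^Hg(\log t)}=1\quad\text{a.s.},$$ then $g^{-1}(x)+\log x\notin OR$. The converse is also true provided that $g^{-1}(|x|)$ is submultiplicative on $\mathbb{R}^d$.
   Context: $|x|$ is the Euclidean norm; "increasing" is in the wide (non-strict) sense. An $\mathbb{R}^d$-valued process $\{X(t):t\ge0\}$ is an $H$-selfsimilar additive process ($H>0$) if: (1) $\{X(ct)\}\stackrel{d}{=}\{c^HX(t)\}$ (equality of finite-dimensional distributions) for every $c>0$; (2) it has independent increments (stationarity not assumed); (3) almost surely its paths are right-continuous on $[0,\infty)$ with left limits on $(0,\infty)$. It is non-deterministic if it is not of the form $X(t)=t^Hc$ with $c\in\mathbb{R}^d$. $\mathcal{G}_1$ is the set of positive increasing functions $g$ on $[0,\infty)$ with $\lim_{x\to\infty}g(x)=\infty$. For $g\in\mathcal{G}_1$, $g^{-1}(x):=\sup\{y:g(y)<x\}$ for $x\ge0$, with $\sup\emptyset=0$. For positive measurable functions, $f(x)\asymp h(x)$ means $0<\liminf_{x\to\infty}f(x)/h(x)\le\limsup_{x\to\infty}f(x)/h(x)<\infty$. A positive measurable function $h$ on $[0,\infty)$ belongs to the class $OR$ if $h(cx)\asymp h(x)$ for any $c>0$. A positive measurable function $h$ on $\mathbb{R}^d$ is submultiplicative if there is $c>0$ with $h(x+y)\le c\,h(x)h(y)$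 for all $x,y\in\mathbb{R}^d$. *)

theory Defs
  imports "HOL-Probability.Probability"
begin

section \<open>Selfsimilar additive processes\<close>

text \<open>
  A process is a map \<open>X\<close> from times to functions on the probability space \<open>M\<close>; only its
  values at times \<open>t \<ge> 0\<close> matter.
\<close>

definition fdd :: "'w measure \<Rightarrow> (real \<Rightarrow> 'w \<Rightarrow> real ^ 'n) \<Rightarrow> real set \<Rightarrow> (real \<Rightarrow> real ^ 'n) measure"
  where "fdd M X J = distr M (Pi\<^sub>M J (\<lambda>_. borel)) (\<lambda>\<omega>. \<lambda>t\<in>J. X t \<omega>)"

definition eq_fdd ::
  "'w measure \<Rightarrow> (real \<Rightarrow> 'w \<Rightarrow> real ^ 'n) \<Rightarrow> (real \<Rightarrow> 'w \<Rightarrow> real ^ 'n) \<Rightarrow> bool"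
  where "eq_fdd M X Y \<longleftrightarrow> (\<forall>J. finite J \<and> J \<subseteq> {0..} \<longrightarrow> fdd M X J = fdd M Y J)"

definition selfsimilar :: "'w measure \<Rightarrow> real \<Rightarrow> (real \<Rightarrow> 'w \<Rightarrow> real ^ 'n) \<Rightarrow> bool"
  where "selfsimilar M H X \<longleftrightarrow>
    (\<forall>c>0. eq_fdd M (\<lambda>t. X (c * t)) (\<lambda>t \<omega>. (c powr H) *\<^sub>R X t \<omega>))"

definition independent_increments :: "'w measure \<Rightarrow> (real \<Rightarrow> 'w \<Rightarrow> real ^ 'n) \<Rightarrow> bool"
  where "independent_increments M X \<longleftrightarrow>
    (\<forall>(k::nat) (t :: nat \<Rightarrow> real). 0 \<le> t 0 \<and> strict_mono_on {..k} t \<longrightarrow>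
       prob_space.indep_vars M (\<lambda>_. borel) (\<lambda>i \<omega>. X (t (Suc i)) \<omega> - X (t i) \<omega>) {..<k})"

definition cadlag :: "(real \<Rightarrow> real ^ 'n) \<Rightarrow> bool"
  where "cadlag x \<longleftrightarrow>
    (\<forall>t\<ge>0. (x \<longlongrightarrow> x t) (at_right t)) \<and> (\<forall>t>0. \<exists>l. (x \<longlongrightarrow> l) (at_left t))"

definition selfsimilar_additive :: "'w measure \<Rightarrow> real \<Rightarrow> (real \<Rightarrow> 'w \<Rightarrow> real ^ 'n) \<Rightarrow> bool"
  where "selfsimilar_additive M H X \<longleftrightarrow>
    prob_space M \<and> (\<forall>t\<ge>0. X t \<in> M \<rightarrow>\<^sub>M borel) \<and>
    selfsimilar M H X \<and> independent_increments M X \<and> (AE \<omega> in M. cadlag (\<lambda>t. X t \<omega>))"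

definition deterministic :: "'w measure \<Rightarrow> real \<Rightarrow> (real \<Rightarrow> 'w \<Rightarrow> real ^ 'n) \<Rightarrow> bool"
  where "deterministic M H X \<longleftrightarrow> (\<exists>c. AE \<omega> in M. \<forall>t\<ge>0. X t \<omega> = (t powr H) *\<^sub>R c)"


section \<open>Growth functions\<close>

definition G1 :: "(real \<Rightarrow> real) set"
  where "G1 = {g. (\<forall>x\<ge>0. 0 < g x) \<and> mono_on {0..} g \<and> filterlim g at_top at_top}"

text \<open>The case distinction is needed because the real \<open>Sup {}\<close> is not \<open>0\<close> by definition.\<close>

definition gen_inv :: "(real \<Rightarrow> real) \<Rightarrow> real \<Rightarrow> real"
  where "gen_inv g x = (if {y. 0 \<le> y \<and> g y < x} = {} then 0 else Sup {y. 0 \<le> y \<and> g y < x})"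

definition same_order :: "(real \<Rightarrow> real) \<Rightarrow> (real \<Rightarrow> real) \<Rightarrow> bool"
  where "same_order f h \<longleftrightarrow>
    0 < Liminf at_top (\<lambda>x. ereal (f x / h x)) \<and>
    Liminf at_top (\<lambda>x. ereal (f x / h x)) \<le> Limsup at_top (\<lambda>x. ereal (f x / h x)) \<and>
    Limsup at_top (\<lambda>x. ereal (f x / h x)) < \<infinity>"

text \<open>
  Positivity is required only near infinity. The class is applied to \<open>g\<inverse>(x) + log x\<close>,
  which may be negative (or, at \<open>0\<close>, undefined) for small \<open>x\<close>; demanding positivity
  everywhere would exclude that function from the class for a reason unrelated to its growth.
\<close>

definition class_OR :: "(real \<Rightarrow> real) set"
  where "class_OR = {h. h \<in> borel_measurable (restrict_space borel {0..}) \<and>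
    eventually (\<lambda>x. 0 < h x) at_top \<and> (\<forall>c>0. same_order (\<lambda>x. h (c * x)) h)}"

definition submultiplicative :: "(real ^ 'n \<Rightarrow> real) \<Rightarrow> bool"
  where "submultiplicative h \<longleftrightarrow> h \<in> borel_measurable borel \<and> (\<forall>x. 0 < h x) \<and>
    (\<exists>c>0. \<forall>x y. h (x + y) \<le> c * h x * h y)"

text \<open>
  For \<open>g \<in> G1\<close> the function \<open>g\<inverse>(|x|)\<close> vanishes for \<open>|x| \<le> g(0)\<close>, so it is never positive
  and never submultiplicative on the whole space (see the lemma below). The hypothesis is
  therefore read, as usual in moment theorems for infinitely divisible laws (where one uses
  \<open>|x| \<or> 1\<close> instead of \<open>|x|\<close>), up to the values of the function near the origin: for some
  \<open>b \<ge> 0\<close>, \<open>g\<inverse>(|x| \<or> b)\<close> is submultiplicative. The literal reading is \<open>b = 0\<close>.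
\<close>

definition radial_submultiplicative :: "'n::finite itself \<Rightarrow> (real \<Rightarrow> real) \<Rightarrow> bool"
  where "radial_submultiplicative _ k \<longleftrightarrow>
    (\<exists>b\<ge>0. submultiplicative (\<lambda>x :: real ^ 'n. k (max (norm x) b)))"

lemma not_submultiplicative_gen_inv:
  assumes "g \<in> G1"
  shows "\<not> submultiplicative (\<lambda>x :: real ^ 'n. gen_inv g (norm x))"
proof -
  have "{y. 0 \<le> y \<and> g y < 0} = {}"
    using assms by (force simp: G1_def)
  then have "gen_inv g (norm (0 :: real ^ 'n)) = 0"
    by (simp add: gen_inv_def)
  then show ?thesis
    unfolding submultiplicative_def by (metis less_irrefl)
qed

end

theory Submission
  imports Defs "HOL-Real_Asymp.Real_Asymp"
begin

text \<open>
  In logarithmic time, \<open>Y s = e\<^sup>-\<^sup>H\<^sup>s X (e\<^sup>s)\<close> satisfies \<open>|Y s| / g s = |X t| / (t\<^sup>H g (log t))\<close> for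
  \<open>t = e\<^sup>s\<close>, and the oscillations \<open>D n\<close> of \<open>X\<close> over \<open>[e\<^sup>n, e\<^sup>n\<^sup>+\<^sup>1]\<close>, divided by \<open>e\<^sup>H\<^sup>n\<close>, are independent and
  identically distributed. By the Borel-Cantelli lemmas \<open>D n > a g n\<close> happens infinitely often iff
  the mean of \<open>g\<inverse>(D/a)\<close> is infinite, while the mean of \<open>log D\<close> (over \<open>D \<ge> 1\<close>) is always finite, because the
  paths are right continuous at \<open>0\<close>. If \<open>g\<inverse> + log\<close> is in \<open>OR\<close>, finiteness does not depend on \<open>a\<close>, and
  summing a geometric series shows that the upper limit can only be \<open>0\<close> or infinite.

  Conversely, if \<open>g\<inverse> + log\<close> is not in \<open>OR\<close>, there are \<open>c > 1\<close> and a law \<open>\<pi>\<close> on \<open>(0, \<infinity>)\<close> with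
  finite mean of \<open>g\<inverse>(r) + log r\<close> but infinite mean of \<open>g\<inverse>(c r)\<close>. Take a Poisson
  process in logarithmic time with marks of law \<open>\<pi>\<close> and let \<open>X t\<close> be the sum of \<open>e\<^sup>H\<^sup>T r\<close> over its points
  \<open>(T, r)\<close> with \<open>e\<^sup>T \<le> t\<close>, in a fixed direction. Its Laplace functional gives the independence of the
  increments and selfsimilarity. Submultiplicativity controls the sum of a Poisson number of marks,
  so the upper limit is almost surely finite; it is at least \<open>1 / c\<close>; by Kolmogorov's 0-1 law it is
  constant; and rescaling makes it \<open>1\<close>.
\<close>

text \<open>Selfsimilarity and independence speak of finitely many times, an oscillation of a whole
  interval. So \<open>osc_sup\<close> is a supremum over dyadic grids in logarithmic time: laws pass
  to it by continuity from above, and right continuity recovers the remaining times. The logarithm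
  in \<open>gen_inv g x + ln x\<close> is there because its moment is free: block indices running to
  minus infinity approach time \<open>0\<close>, where the path settles, and all blocks have the
  same law. Under \<open>OR\<close> a finite moment at one level, together with this free one, gives
  a finite moment at every level, and a small enough level contradicts the limit \<open>1\<close>.

  In the converse, jumps along a single ray make the process a nonnegative increasing scalar: sums
  always exist in the extended reals, and Laplace transforms settle every question about joint laws.
  The failure of \<open>OR\<close> is used at two levels: the marks have a finite moment of
  \<open>gen_inv g (max r b)\<close> and an infinite one of \<open>gen_inv g (c * r)\<close>, which
  keeps the upper limit finite and at least \<open>1 / c\<close>.\<close>

abbreviation growth_limsup :: "real \<Rightarrow> (real \<Rightarrow> real) \<Rightarrow> (real \<Rightarrow> real) \<Rightarrow> ereal" where
  "growth_limsup H g f \<equiv> Limsup at_top (\<lambda>t. ereal (f t / (t powr H * g (ln t))))"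

section \<open>Generalised inverses and tail series\<close>

lemma G1_pos: "g \<in> G1 \<Longrightarrow> 0 \<le> x \<Longrightarrow> 0 < g x"
  by (simp add: G1_def)

lemma G1_mono: "g \<in> G1 \<Longrightarrow> 0 \<le> x \<Longrightarrow> x \<le> y \<Longrightarrow> g x \<le> g y"
  by (auto simp: G1_def mono_on_def)

lemma G1_at_top: "g \<in> G1 \<Longrightarrow> filterlim g at_top at_top"
  by (simp add: G1_def)

text \<open>Treating the exponential as a growth function makes the logarithmic moment a moment of
  \<open>gen_inv\<close>, so that the bounds for \<open>g\<close> below serve for it as
  well.\<close>

lemma G1_exp: "0 < H \<Longrightarrow> (\<lambda>x. exp (H * x)) \<in> G1"
  unfolding G1_def by (auto simp: mono_on_def intro!: filterlim_compose[OF exp_at_top]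
      filterlim_tendsto_pos_mult_at_top[OF tendsto_const _ filterlim_ident])

lemma gen_inv_bdd:
  assumes "g \<in> G1"
  shows "bdd_above {y. 0 \<le> y \<and> g y < x}"
proof -
  obtain N where N: "\<And>y. N \<le> y \<Longrightarrow> x \<le> g y"
    using G1_at_top[OF assms] unfolding filterlim_at_top eventually_at_top_linorder by blast
  show ?thesis
    using N by (intro bdd_aboveI[of _ N]) (metis (mono_tags, lifting) linear mem_Collect_eq not_le)
qed

text \<open>With \<open>gen_inv_lower\<close> this is a Galois connection up to the boundary:
  \<open>y < gen_inv g x\<close> implies \<open>g y < x\<close>, which implies
  \<open>y \<le> gen_inv g x\<close>. As \<open>g\<close> may jump, nothing is claimed at
  equality.\<close>

lemma gen_inv_upper: "g \<in> G1 \<Longrightarrow> 0 \<le> y \<Longrightarrow> g y < x \<Longrightarrow> y \<le> gen_inv g x"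
  using gen_inv_bdd[of g x] by (auto simp: gen_inv_def intro!: cSup_upper)

lemma gen_inv_nonneg: "g \<in> G1 \<Longrightarrow> 0 \<le> gen_inv g x"
proof (cases "{y. 0 \<le> y \<and> g y < x} = {}")
  case False
  assume "g \<in> G1"
  from False obtain y where "0 \<le> y" "g y < x" by auto
  with gen_inv_upper[OF \<open>g \<in> G1\<close> this] show ?thesis by simp
qed (simp add: gen_inv_def)

lemma gen_inv_lower:
  assumes "g \<in> G1" "0 \<le> y" "y < gen_inv g x"
  shows "g y < x"
proof -
  have "{y. 0 \<le> y \<and> g y < x} \<noteq> {}"
    using assms by (auto simp: gen_inv_def split: if_splits)
  then obtain z where "0 \<le> z" "g z < x" "y < z"
    using assms(3) by (auto simp: gen_inv_def elim!: less_cSupE split: if_splits)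
  then show ?thesis
    using G1_mono[OF assms(1), of y z] assms(2) by auto
qed

lemma gen_inv_mono:
  assumes "g \<in> G1" "x \<le> y"
  shows "gen_inv g x \<le> gen_inv g y"
proof (rule ccontr)
  assume *: "\<not> ?thesis"
  define z where "z = (gen_inv g x + gen_inv g y) / 2"
  have z: "gen_inv g y < z" "z < gen_inv g x" "0 \<le> z"
    using * gen_inv_nonneg[OF assms(1), of y] by (auto simp: z_def)
  have "g z < x" using gen_inv_lower[OF assms(1)] z by simp
  then have "z \<le> gen_inv g y" using gen_inv_upper[OF assms(1), of z y] assms z by simp
  with z show False by simp
qed

lemma gen_inv_measurable: "g \<in> G1 \<Longrightarrow> gen_inv g \<in> borel_measurable borel"
  using gen_inv_mono[of g] by (intro borel_measurable_mono monoI)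

lemma gen_inv_exp_ge:
  assumes "0 < H" "0 < x"
  shows "ln x / H \<le> gen_inv (\<lambda>x. exp (H * x)) x"
proof (rule field_le_epsilon)
  fix e :: real assume "0 < e"
  show "ln x / H \<le> gen_inv (\<lambda>x. exp (H * x)) x + e"
  proof (cases "ln x / H - e \<ge> 0")
    case True
    \<comment> \<open>At \<open>ln x / H\<close> itself the exponential equals \<open>x\<close>,
      while \<open>gen_inv\<close> asks for a strict inequality; hence the shift by
      \<open>e\<close>.\<close>
    have "exp (H * (ln x / H - e)) < x"
    proof -
      have "H * (ln x / H - e) < ln x"
        using assms \<open>0 < e\<close> by (simp add: right_diff_distrib)
      then show ?thesis using assms by (metis exp_less_cancel_iff exp_ln)
    qed
    from gen_inv_upper[OF G1_exp[OF assms(1)] True this] show ?thesis by simp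
  next
    case False
    then show ?thesis using gen_inv_nonneg[OF G1_exp[OF assms(1)], of x] by linarith
  qed
qed

text \<open>Summed over tail events, the next two bounds turn series of probabilities into moments of
  \<open>gen_inv g\<close>.\<close>

lemma suminf_indicator_le_gen_inv:
  assumes "g \<in> G1"
  shows "(\<Sum>n. indicator {..<x} (g (real n))) \<le> ennreal (gen_inv g x) + 1"
proof -
  \<comment> \<open>An interval \<open>[0, k]\<close> holds \<open>\<lfloor>k\<rfloor> + 1\<close>
    natural numbers, which is the origin of the added \<open>1\<close>.\<close>
  define p where "p = nat \<lfloor>gen_inv g x\<rfloor>"
  have k: "0 \<le> gen_inv g x" by (rule gen_inv_nonneg[OF assms])
  have "indicator {..<x} (g (real n)) \<le> (indicator {..p} n :: ennreal)" for n
  proof (cases "g (real n) < x")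
    case True
    then have "real n \<le> gen_inv g x" by (intro gen_inv_upper[OF assms]) auto
    then have "n \<le> p" unfolding p_def by (simp add: le_nat_floor)
    then show ?thesis by (simp add: indicator_def)
  qed auto
  then have "(\<Sum>n. indicator {..<x} (g (real n))) \<le> (\<Sum>n. indicator {..p} n :: ennreal)"
    by (intro suminf_le) auto
  also have "\<dots> = (\<Sum>n\<le>p. indicator {..p} n)"
    by (intro suminf_finite) auto
  also have "\<dots> = (\<Sum>n\<le>p. 1)"
    by (intro sum.cong) auto
  also have "\<dots> = ennreal (real p + 1)"
    by (simp add: ennreal_of_nat_eq_real_of_nat add.commute)
  also have "\<dots> \<le> ennreal (gen_inv g x + 1)"
    using k by (intro ennreal_leI) (simp add: p_def)
  also have "\<dots> = ennreal (gen_inv g x) + 1"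
    using k by (simp add: ennreal_plus)
  finally show ?thesis .
qed

lemma gen_inv_le_suminf_indicator_Suc:
  assumes "g \<in> G1"
  shows "ennreal (gen_inv g x) \<le> (\<Sum>n. indicator {..<x} (g (real (Suc n)))) + 1"
proof -
  \<comment> \<open>Only integers strictly below the inverse are sure to be counted, and the count
    starts at \<open>1\<close>; hence the ceiling minus one, truncated to \<open>0\<close> when the
    inverse vanishes.\<close>
  define p where "p = nat \<lceil>gen_inv g x\<rceil> - 1"
  have k: "0 \<le> gen_inv g x" by (rule gen_inv_nonneg[OF assms])
  have "gen_inv g x \<le> real p + 1" unfolding p_def using k by linarith
  then have "ennreal (gen_inv g x) \<le> ennreal (real p + 1)" by (rule ennreal_leI)
  also have "\<dots> = (\<Sum>n<p. 1) + 1"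
    by (simp add: ennreal_plus ennreal_of_nat_eq_real_of_nat)
  also have "(\<Sum>n<p. 1) \<le> (\<Sum>n<p. indicator {..<x} (g (real (Suc n))) :: ennreal)"
  proof (rule sum_mono)
    fix n assume "n \<in> {..<p}"
    then have "real (Suc n) < gen_inv g x" unfolding p_def by simp linarith
    then show "1 \<le> (indicator {..<x} (g (real (Suc n))) :: ennreal)"
      using gen_inv_lower[OF assms, of "real (Suc n)" x] by simp
  qed
  also have "\<dots> \<le> (\<Sum>n. indicator {..<x} (g (real (Suc n))))"
    by (intro sum_le_suminf) auto
  finally show ?thesis by (simp add: add_right_mono)
qed

lemma suminf_emeasure_tail:
  fixes D :: "'a \<Rightarrow> real" and u :: "nat \<Rightarrow> real"
  assumes [measurable]: "D \<in> borel_measurable M"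
  shows "(\<Sum>n. emeasure M {\<omega>\<in>space M. u n < D \<omega>}) = (\<integral>\<^sup>+\<omega>. (\<Sum>n. indicator {..<D \<omega>} (u n)) \<partial>M)"
proof -
  have "(\<integral>\<^sup>+\<omega>. (\<Sum>n. indicator {..<D \<omega>} (u n)) \<partial>M)
    = (\<integral>\<^sup>+\<omega>. (\<Sum>n. indicator {\<omega>\<in>space M. u n < D \<omega>} \<omega>) \<partial>M)"
    by (intro nn_integral_cong suminf_cong) (auto simp: indicator_def)
  also have "\<dots> = (\<Sum>n. \<integral>\<^sup>+\<omega>. indicator {\<omega>\<in>space M. u n < D \<omega>} \<omega> \<partial>M)"
    by (intro nn_integral_suminf) measurable
  also have "\<dots> = (\<Sum>n. emeasure M {\<omega>\<in>space M. u n < D \<omega>})"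
    by (intro suminf_cong nn_integral_indicator) measurable
  finally show ?thesis by simp
qed

section \<open>Moments of the generalised inverse and the Borel-Cantelli lemmas\<close>

context prob_space
begin

lemma suminf_tail_le_nn_integral_gen_inv:
  fixes D :: "'a \<Rightarrow> real"
  assumes [measurable]: "D \<in> borel_measurable M" and "g \<in> G1" "0 < c"
    and fin: "(\<integral>\<^sup>+\<omega>. ennreal (gen_inv g (D \<omega> / c)) \<partial>M) < \<infinity>"
  shows "(\<Sum>n. emeasure M {\<omega>\<in>space M. c * g (real n) < D \<omega>}) < \<infinity>"
proof -
  have "(\<Sum>n. emeasure M {\<omega>\<in>space M. c * g (real n) < D \<omega>})
     = (\<Sum>n. emeasure M {\<omega>\<in>space M. g (real n) < D \<omega> / c})"
    using \<open>0 < c\<close> by (simp add: field_simps)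
  also have "\<dots> = (\<integral>\<^sup>+\<omega>. (\<Sum>n. indicator {..<D \<omega> / c} (g (real n))) \<partial>M)"
    by (intro suminf_emeasure_tail) measurable
  also have "\<dots> \<le> (\<integral>\<^sup>+\<omega>. ennreal (gen_inv g (D \<omega> / c)) + 1 \<partial>M)"
    by (intro nn_integral_mono suminf_indicator_le_gen_inv assms)
  also have "\<dots> = (\<integral>\<^sup>+\<omega>. ennreal (gen_inv g (D \<omega> / c)) \<partial>M) + (\<integral>\<^sup>+\<omega>. 1 \<partial>M)"
  proof (rule nn_integral_add)
    note [measurable] = gen_inv_measurable[OF assms(2)]
    show "(\<lambda>\<omega>. ennreal (gen_inv g (D \<omega> / c))) \<in> borel_measurable M"
      by measurable
  qed simp
  also have "\<dots> < \<infinity>"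
    using fin by (simp add: emeasure_space_1)
  finally show ?thesis .
qed

text \<open>The series starts at \<open>g 1\<close> because over a block \<open>[n, n + 1)\<close>
  the growth function is bounded by its value at the right end; the missing first term costs at most
  \<open>1\<close>.\<close>

lemma nn_integral_gen_inv_le_suminf_tail:
  fixes D :: "'a \<Rightarrow> real"
  assumes [measurable]: "D \<in> borel_measurable M" and "g \<in> G1" "0 < c"
  shows "(\<integral>\<^sup>+\<omega>. ennreal (gen_inv g (D \<omega> / c)) \<partial>M)
    \<le> (\<Sum>n. emeasure M {\<omega>\<in>space M. c * g (real (Suc n)) < D \<omega>}) + 1"
proof -
  have "(\<integral>\<^sup>+\<omega>. ennreal (gen_inv g (D \<omega> / c)) \<partial>M)
    \<le> (\<integral>\<^sup>+\<omega>. (\<Sum>n. indicator {..<D \<omega> / c} (g (real (Suc n)))) + 1 \<partial>M)"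
    by (intro nn_integral_mono gen_inv_le_suminf_indicator_Suc assms)
  also have "\<dots> = (\<integral>\<^sup>+\<omega>. (\<Sum>n. indicator {..<D \<omega> / c} (g (real (Suc n)))) \<partial>M) + 1"
    by (subst nn_integral_add) (auto simp: emeasure_space_1 indicator_def)
  also have "(\<integral>\<^sup>+\<omega>. (\<Sum>n. indicator {..<D \<omega> / c} (g (real (Suc n)))) \<partial>M)
    = (\<Sum>n. emeasure M {\<omega>\<in>space M. g (real (Suc n)) < D \<omega> / c})"
    by (intro suminf_emeasure_tail[symmetric]) measurable
  also have "\<dots> = (\<Sum>n. emeasure M {\<omega>\<in>space M. c * g (real (Suc n)) < D \<omega>})"
    using \<open>0 < c\<close> by (simp add: field_simps)
  finally show ?thesis .
qed

lemma borel_cantelli_suminf: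
  assumes E [measurable]: "\<And>n. E n \<in> events" and "(\<Sum>n. emeasure M (E n)) < \<infinity>"
  shows "AE \<omega> in M. \<exists>a::nat. \<forall>n\<ge>a. \<omega> \<notin> E n"
proof -
  have "summable (\<lambda>n. prob (E n))"
    using assms(2) by (intro summable_suminf_not_top) (auto simp: emeasure_eq_measure)
  then have "AE \<omega> in M. eventually (\<lambda>n. \<omega> \<in> space M - E n) sequentially"
    by (intro borel_cantelli_AE1) (auto simp: emeasure_eq_measure)
  then show ?thesis
    by eventually_elim (auto simp: eventually_sequentially)
qed

text \<open>Independence is assumed only as a product formula over intervals of indices, the form in
  which it is available for the oscillations. By \<open>1 - p \<le> exp (- p)\<close>, avoiding all
  events from \<open>a\<close> on has probability at most \<open>exp (- K)\<close> for every
  \<open>K\<close>.\<close>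

lemma borel_cantelli_AE2:
  assumes E [measurable]: "\<And>n. E n \<in> events"
    and prod: "\<And>a b. prob {\<omega>\<in>space M. \<forall>n\<in>{a..<b}. \<omega> \<notin> E n} = (\<Prod>n\<in>{a..<b}. 1 - prob (E n))"
    and div: "\<not> summable (\<lambda>n. prob (E n))"
  shows "AE \<omega> in M. \<forall>a::nat. \<exists>n\<ge>a. \<omega> \<in> E n"
proof (subst AE_all_countable, rule allI)
  fix a :: nat
  define Z where "Z = {\<omega>\<in>space M. \<forall>n\<ge>a. \<omega> \<notin> E n}"
  have [measurable]: "Z \<in> events" unfolding Z_def by measurable
  have bound: "prob Z \<le> exp (- K)" for K
  proof -
    have "\<exists>b. K \<le> (\<Sum>n\<in>{a..<b}. prob (E n))"
    proof (rule ccontr)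
      assume "\<not> ?thesis"
      then have *: "(\<Sum>n\<in>{a..<b}. prob (E n)) \<le> K" for b by (meson linear)
      have "(\<Sum>n<b. prob (E n)) \<le> (\<Sum>n<a. prob (E n)) + K" for b
      proof (cases "a \<le> b")
        case True
        then have "(\<Sum>n<b. prob (E n)) = (\<Sum>n<a. prob (E n)) + (\<Sum>n\<in>{a..<b}. prob (E n))"
          by (metis lessThan_atLeast0 le0 sum.atLeastLessThan_concat)
        then show ?thesis using *[of b] by simp
      next
        case False
        then have "(\<Sum>n<b. prob (E n)) \<le> (\<Sum>n<a. prob (E n))"
          by (intro sum_mono2) auto
        then show ?thesis using *[of a] by simp
      qed
      then have "summable (\<lambda>n. prob (E n))"
        by (intro summableI_nonneg_bounded) auto
      with div show False by simp
    qed
    then obtain b where b: "K \<le> (\<Sum>n\<in>{a..<b}. prob (E n))" by blast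
    have "prob Z \<le> prob {\<omega>\<in>space M. \<forall>n\<in>{a..<b}. \<omega> \<notin> E n}"
      by (intro finite_measure_mono) (auto simp: Z_def)
    also have "\<dots> \<le> (\<Prod>n\<in>{a..<b}. exp (- prob (E n)))"
      unfolding prod using exp_ge_add_one_self[of "- prob (E _)"]
      by (intro prod_mono) (auto simp: prob_le_1)
    also have "\<dots> = exp (- (\<Sum>n\<in>{a..<b}. prob (E n)))"
      by (simp add: exp_sum flip: sum_negf)
    also have "\<dots> \<le> exp (- K)" using b by simp
    finally show ?thesis .
  qed
  have "prob Z \<le> 0"
  proof (rule field_le_epsilon)
    fix e :: real assume "0 < e"
    then show "prob Z \<le> 0 + e" using bound[of "- ln e"] by simp
  qed
  then have "prob Z = 0" by (simp add: measure_le_0_iff)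
  then have "AE \<omega> in M. \<omega> \<notin> Z"
    using AE_iff_measurable[of Z M "\<lambda>\<omega>. \<omega> \<notin> Z"] by (auto simp: emeasure_eq_measure Z_def)
  then show "AE \<omega> in M. \<exists>n\<ge>a. \<omega> \<in> E n"
    by (auto simp: Z_def)
qed

end

section \<open>Excluding \<open>OR\<close>\<close>

text \<open>\<open>OR\<close> compares the two arguments at large \<open>x\<close> only;
  \<open>K\<close> covers the small ones by monotonicity. The logarithm on the right becomes the
  generalised inverse of \<open>exp (H * x)\<close>, whose moment is available separately.\<close>

lemma class_OR_gen_inv_bound:
  assumes "g \<in> G1" and OR: "(\<lambda>x. gen_inv g x + ln x) \<in> class_OR"
    and "0 < H" "0 < c" "0 < e"
  obtains K C where "0 \<le> K" "0 \<le> C"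
    "\<And>x. gen_inv g (x / e) \<le> K + C * gen_inv g (x / c) + C * gen_inv (\<lambda>x. exp (H * x)) x"
proof -
  define h where "h x = gen_inv g x + ln x" for x
  define k where "k = gen_inv (\<lambda>x. exp (H * x))"
  have k0: "0 \<le> k x" for x unfolding k_def by (rule gen_inv_nonneg[OF G1_exp[OF \<open>0 < H\<close>]])
  have g0: "0 \<le> gen_inv g x" for x by (rule gen_inv_nonneg[OF assms(1)])
  have pos: "eventually (\<lambda>x. 0 < h x) at_top"
    using OR by (auto simp: class_OR_def h_def)
  \<comment> \<open>The ratio \<open>c / e\<close> is forced by
    \<open>x / e = c / e * (x / c)\<close>.\<close>
  have "same_order (\<lambda>x. h (c / e * x)) h"
    using OR \<open>0 < c\<close> \<open>0 < e\<close> unfolding class_OR_def h_def mem_Collect_eq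
    by (metis divide_pos_pos)
  then have "Limsup at_top (\<lambda>x. ereal (h (c / e * x) / h x)) < \<infinity>"
    by (simp add: same_order_def)
  then obtain B where B: "Limsup at_top (\<lambda>x. ereal (h (c / e * x) / h x)) < ereal B"
    by (metis ereal_dense2)
  define C where "C = max B 0"
  have "eventually (\<lambda>x. h (c / e * x) / h x < B) at_top"
    using Limsup_lessD[OF B] by simp
  with pos have "eventually (\<lambda>x. h (c / e * x) \<le> C * h x) at_top"
  proof eventually_elim
    case (elim x)
    then have "h (c / e * x) < B * h x" by (simp add: field_simps)
    also have "\<dots> \<le> C * h x" using elim by (intro mult_right_mono) (auto simp: C_def)
    finally show ?case by simp
  qed
  then obtain x0 where x0: "\<And>x. x0 \<le> x \<Longrightarrow> h (c / e * x) \<le> C * h x"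
    unfolding eventually_at_top_linorder by blast
  \<comment> \<open>Beyond \<open>c * x0\<close> the comparison applies at \<open>x / c\<close>, and
    beyond \<open>e\<close> the logarithm of \<open>x / e\<close> is nonnegative.\<close>
  define x1 where "x1 = Max {c * x0, e, 1}"
  define K where "K = gen_inv g (x1 / e) + C * \<bar>ln c\<bar>"
  have "gen_inv g (x / e) \<le> K + C * gen_inv g (x / c) + (C * H) * k x" for x
  proof (cases "x1 \<le> x")
    case True
    then have x: "x0 \<le> x / c" "1 \<le> x / e" "1 \<le> x"
      using \<open>0 < c\<close> \<open>0 < e\<close> by (auto simp: x1_def field_simps)
    have "gen_inv g (x / e) \<le> h (x / e)"
      unfolding h_def using x by simp
    also have "\<dots> = h (c / e * (x / c))" using \<open>0 < c\<close> by simp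
    also have "\<dots> \<le> C * h (x / c)" by (rule x0[OF x(1)])
    also have "\<dots> = C * gen_inv g (x / c) + C * (ln x - ln c)"
      using x \<open>0 < c\<close> by (simp add: h_def ln_div algebra_simps)
    also have "\<dots> \<le> C * gen_inv g (x / c) + C * (H * k x + \<bar>ln c\<bar>)"
      using gen_inv_exp_ge[OF \<open>0 < H\<close>, of x] x \<open>0 < H\<close>
      by (intro add_left_mono mult_left_mono) (auto simp: field_simps k_def C_def)
    finally show ?thesis using g0[of "x1/e"] by (simp add: K_def algebra_simps)
  next
    case False
    have "gen_inv g (x / e) \<le> gen_inv g (x1 / e)"
      using False \<open>0 < e\<close> by (intro gen_inv_mono assms divide_right_mono) auto
    moreover have "0 \<le> C * \<bar>ln c\<bar>" "0 \<le> C * gen_inv g (x / c)" "0 \<le> C * H * k x"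
      using g0 k0 \<open>0 < H\<close> by (auto simp: C_def)
    ultimately show ?thesis unfolding K_def by linarith
  qed
  moreover have "K + C * gen_inv g (x / c) + (C * H) * k x
    \<le> K + max C (C * H) * gen_inv g (x / c) + max C (C * H) * k x" for x
    using g0 k0 by (intro add_mono mult_right_mono) auto
  ultimately have "gen_inv g (x / e) \<le> K + max C (C * H) * gen_inv g (x / c) + max C (C * H) * k x" for x
    by (meson order_trans)
  moreover have "0 \<le> K" "0 \<le> max C (C * H)"
    using g0 by (auto simp: K_def C_def)
  ultimately show ?thesis using that unfolding k_def by blast
qed

text \<open>The series at level \<open>c\<close> is turned into a moment, moved to level
  \<open>e\<close> by \<open>OR\<close> at the price of the logarithmic moment, and turned back.
  This is where the level becomes arbitrary.\<close>

lemma (in prob_space) class_OR_suminf_tail: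
  fixes D :: "'a \<Rightarrow> real"
  assumes [measurable]: "D \<in> borel_measurable M"
    and "g \<in> G1" and OR: "(\<lambda>x. gen_inv g x + ln x) \<in> class_OR"
    and "0 < H" "0 < c" "0 < e"
    and fin1: "(\<Sum>n. emeasure M {\<omega>\<in>space M. c * g (real (Suc n)) < D \<omega>}) < \<infinity>"
    and fin2: "(\<Sum>n. emeasure M {\<omega>\<in>space M. exp (H * real n) < D \<omega>}) < \<infinity>"
  shows "(\<Sum>n. emeasure M {\<omega>\<in>space M. e * g (real n) < D \<omega>}) < \<infinity>"
proof (rule suminf_tail_le_nn_integral_gen_inv)
  let ?k = "gen_inv (\<lambda>x. exp (H * x))"
  have exp: "(\<lambda>x. exp (H * x)) \<in> G1" by (rule G1_exp[OF \<open>0 < H\<close>])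
  note [measurable] = gen_inv_measurable[OF assms(2)] gen_inv_measurable[OF exp]
  obtain K C where KC: "0 \<le> K" "0 \<le> C"
    and le: "\<And>x. gen_inv g (x / e) \<le> K + C * gen_inv g (x / c) + C * ?k x"
    by (rule class_OR_gen_inv_bound[OF assms(2) OR \<open>0 < H\<close> \<open>0 < c\<close> \<open>0 < e\<close>]) blast
  have "(\<integral>\<^sup>+\<omega>. ennreal (gen_inv g (D \<omega> / e)) \<partial>M)
     \<le> (\<integral>\<^sup>+\<omega>. ennreal K + ennreal C * ennreal (gen_inv g (D \<omega> / c)) + ennreal C * ennreal (?k (D \<omega>)) \<partial>M)"
  proof (rule nn_integral_mono)
    fix \<omega>
    have "ennreal (gen_inv g (D \<omega> / e)) \<le> ennreal (K + C * gen_inv g (D \<omega> / c) + C * ?k (D \<omega>))"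
      by (intro ennreal_leI le)
    also have "\<dots> = ennreal K + ennreal C * ennreal (gen_inv g (D \<omega> / c)) + ennreal C * ennreal (?k (D \<omega>))"
      using KC gen_inv_nonneg[OF assms(2)] gen_inv_nonneg[OF exp]
      by (simp add: ennreal_plus ennreal_mult)
    finally show "ennreal (gen_inv g (D \<omega> / e)) \<le> \<dots>" .
  qed
  also have "\<dots> = ennreal K + ennreal C * (\<integral>\<^sup>+\<omega>. ennreal (gen_inv g (D \<omega> / c)) \<partial>M)
     + ennreal C * (\<integral>\<^sup>+\<omega>. ennreal (?k (D \<omega>)) \<partial>M)"
    by (simp add: nn_integral_add nn_integral_cmult emeasure_space_1)
  also have "\<dots> < \<infinity>"
  proof -
    have "(\<integral>\<^sup>+\<omega>. ennreal (gen_inv g (D \<omega> / c)) \<partial>M) < \<infinity>"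
      using nn_integral_gen_inv_le_suminf_tail[OF assms(1,2) \<open>0 < c\<close>] fin1
      by (auto simp: less_top[symmetric] top_unique)
    moreover have "(\<integral>\<^sup>+\<omega>. ennreal (?k (D \<omega>)) \<partial>M) < \<infinity>"
    proof -
      have "(\<integral>\<^sup>+\<omega>. ennreal (?k (D \<omega> / 1)) \<partial>M)
        \<le> (\<Sum>n. emeasure M {\<omega>\<in>space M. 1 * exp (H * real (Suc n)) < D \<omega>}) + 1"
        by (rule nn_integral_gen_inv_le_suminf_tail[OF assms(1) exp]) simp
      also have "\<dots> \<le> (\<Sum>n. emeasure M {\<omega>\<in>space M. exp (H * real n) < D \<omega>}) + 1"
      proof (intro add_right_mono suminf_le emeasure_mono)
        fix n
        have le: "exp (H * real n) \<le> exp (H * real (Suc n))" using \<open>0 < H\<close> by simp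
        then show "{\<omega>\<in>space M. 1 * exp (H * real (Suc n)) < D \<omega>} \<subseteq> {\<omega>\<in>space M. exp (H * real n) < D \<omega>}"
          by (auto simp del: of_nat_Suc intro: order.strict_trans1[OF le])
      qed auto
      finally show ?thesis using fin2 by (auto simp: less_top[symmetric] top_unique)
    qed
    ultimately show ?thesis by (simp add: ennreal_mult_less_top less_top[symmetric] ennreal_mult_eq_top_iff)
  qed
  finally show "(\<integral>\<^sup>+\<omega>. ennreal (gen_inv g (D \<omega> / e)) \<partial>M) < \<infinity>" .
qed (use assms in auto)

text \<open>\<open>A = e / (exp H - 1)\<close> solves \<open>A + e = A * exp H\<close>, so the bound
  reproduces itself from one block to the next: past blocks form a geometric series dominated by the
  last one. With small \<open>e\<close> this shrinks the upper limit, with \<open>e = 1\<close> it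
  shows finiteness.\<close>

lemma geometric_growth:
  fixes y :: "nat \<Rightarrow> real"
  assumes g: "g \<in> G1" and "0 < H" "0 \<le> e"
    and step: "\<And>n. a \<le> n \<Longrightarrow> y (Suc n) \<le> y n + e * (exp (H * n) * g n)"
  obtains K where "0 \<le> K" "\<And>n. a \<le> n \<Longrightarrow> y n \<le> K + e / (exp H - 1) * (exp (H * n) * g n)"
proof
  define A where "A = e / (exp H - 1)"
  have H1: "1 < exp H" using \<open>0 < H\<close> by simp
  then have A: "0 \<le> A" "A + e = A * exp H"
    using \<open>0 \<le> e\<close> by (auto simp: A_def field_simps)
  show "0 \<le> max 0 (y a)" by simp
  have "y n \<le> max 0 (y a) + A * (exp (H * n) * g n)" if "a \<le> n" for n
    using that
  proof (induction n rule: dec_induct)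
    case base
    have "0 \<le> A * (exp (H * a) * g a)"
      using A G1_pos[OF g, of "real a"] by (intro mult_nonneg_nonneg) auto
    then show ?case by simp
  next
    case (step n)
    have "y (Suc n) \<le> max 0 (y a) + (A + e) * (exp (H * n) * g n)"
      using assms(4)[of n] step by (simp add: algebra_simps)
    also have "(A + e) * (exp (H * n) * g n) = A * (exp (H * Suc n) * g n)"
      unfolding A by (simp add: algebra_simps exp_add)
    also have "\<dots> \<le> A * (exp (H * Suc n) * g (Suc n))"
      using A G1_mono[OF g, of "real n" "real (Suc n)"] by (intro mult_left_mono) auto
    finally show ?case by simp
  qed
  then show "\<And>n. a \<le> n \<Longrightarrow> y n \<le> max 0 (y a) + e / (exp H - 1) * (exp (H * n) * g n)"
    unfolding A_def by simp
qed

section \<open>Oscillations of a selfsimilar additive process over exponential blocks\<close>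

locale ss_additive =
  fixes M :: "'w measure" and H :: real and X :: "real \<Rightarrow> 'w \<Rightarrow> real ^ 'n"
  assumes ss: "selfsimilar_additive M H X" and H_pos: "0 < H"
begin

sublocale prob_space M
  using ss by (simp add: selfsimilar_additive_def)

lemma X_measurable [measurable]: "0 \<le> t \<Longrightarrow> X t \<in> M \<rightarrow>\<^sub>M borel"
  using ss by (simp add: selfsimilar_additive_def)

lemma increments_indep:
  "0 \<le> t 0 \<Longrightarrow> strict_mono_on {..k} t \<Longrightarrow>
    indep_vars (\<lambda>_. borel) (\<lambda>i \<omega>. X (t (Suc i)) \<omega> - X (t i) \<omega>) {..<k}" for k :: nat and t :: "nat \<Rightarrow> real"
  using ss unfolding selfsimilar_additive_def independent_increments_def by blast

text \<open>Block indices are integers: large positive ones see the growth at infinity, large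
  negative ones the behaviour at time \<open>0\<close>. Division by \<open>exp (H * n)\<close> makes
  the laws independent of \<open>n\<close>.\<close>

definition osc :: "int \<Rightarrow> nat \<Rightarrow> nat \<Rightarrow> 'w \<Rightarrow> real" where
  "osc n j i \<omega> = norm (X (exp (real_of_int n + real i / 2 ^ j)) \<omega> - X (exp (real_of_int n)) \<omega>) / exp (H * n)"

text \<open>Extended values keep the supremum defined on every path; its almost sure finiteness is a
  consequence of \<open>suminf_osc_exp_finite\<close>.\<close>

definition osc_sup :: "int \<Rightarrow> 'w \<Rightarrow> ennreal" where
  "osc_sup n \<omega> = (SUP j. SUP i\<in>{..2 ^ j}. ennreal (osc n j i \<omega>))"

lemma osc_measurable [measurable]: "osc n j i \<in> borel_measurable M"
  unfolding osc_def by measurable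

lemma osc_sup_measurable [measurable]: "osc_sup n \<in> borel_measurable M"
  unfolding osc_sup_def by measurable

lemma osc_sup_le_iff: "0 \<le> x \<Longrightarrow> osc_sup n \<omega> \<le> ennreal x \<longleftrightarrow> (\<forall>j. \<forall>i\<le>2 ^ j. osc n j i \<omega> \<le> x)"
  unfolding osc_sup_def by (auto simp: SUP_le_iff)

lemma osc_Suc: "osc n (Suc j) (2 * i) \<omega> = osc n j i \<omega>"
  by (simp add: osc_def)

text \<open>Scaling time by \<open>exp n\<close> carries the grid of block \<open>0\<close> onto
  that of block \<open>n\<close>. The event depends on the finite set of times \<open>J\<close>
  alone, so equality of finite-dimensional laws is enough.\<close>

lemma prob_osc_stationary:
  "prob {\<omega>\<in>space M. \<forall>i\<le>2 ^ j. osc n j i \<omega> \<le> x} = prob {\<omega>\<in>space M. \<forall>i\<le>2 ^ j. osc 0 j i \<omega> \<le> x}"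
proof -
  define J where "J = (\<lambda>i. exp (real i / 2 ^ j)) ` {..2 ^ j}"
  define S where "S = {y \<in> space (Pi\<^sub>M J (\<lambda>_. borel :: (real ^ 'n) measure)).
     \<forall>i\<le>2 ^ j. norm (y (exp (real i / 2 ^ j)) - y 1) \<le> x * exp (H * n)}"
  have 1: "exp (real i / 2 ^ j) \<in> J" if "i \<le> 2 ^ j" for i
    using that by (auto simp: J_def)
  have 2: "1 \<in> J" using 1[of 0] by simp
  have [measurable]: "S \<in> sets (Pi\<^sub>M J (\<lambda>_. borel))"
  proof -
    have "S = {y \<in> space (Pi\<^sub>M J (\<lambda>_. borel :: (real ^ 'n) measure)).
     \<forall>i\<in>{..2 ^ j}. norm (y (exp (real i / 2 ^ j)) - y 1) \<le> x * exp (H * n)}"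
      by (auto simp: S_def)
    also have "\<dots> \<in> sets (Pi\<^sub>M J (\<lambda>_. borel))"
    proof (rule sets.sets_Collect_finite_All)
      fix i assume "i \<in> {..2 ^ j :: nat}"
      then have [measurable]: "(\<lambda>y. y (exp (real i / 2 ^ j))) \<in> Pi\<^sub>M J (\<lambda>_. borel :: (real ^ 'n) measure) \<rightarrow>\<^sub>M borel"
         "(\<lambda>y. y 1) \<in> Pi\<^sub>M J (\<lambda>_. borel :: (real ^ 'n) measure) \<rightarrow>\<^sub>M borel"
        using 1[of i] 2 by (auto intro!: measurable_component_singleton)
      show "{y \<in> space (Pi\<^sub>M J (\<lambda>_. borel :: (real ^ 'n) measure)).
        norm (y (exp (real i / 2 ^ j)) - y 1) \<le> x * exp (H * n)} \<in> sets (Pi\<^sub>M J (\<lambda>_. borel))"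
        by measurable
    qed simp
    finally show ?thesis .
  qed
  have J: "finite J" "J \<subseteq> {0..}" by (auto simp: J_def)
  have eq: "fdd M (\<lambda>t. X (exp n * t)) J = fdd M (\<lambda>t \<omega>. (exp n powr H) *\<^sub>R X t \<omega>) J"
    using ss J by (auto simp: selfsimilar_additive_def selfsimilar_def eq_fdd_def)
  have m1: "(\<lambda>\<omega>. \<lambda>t\<in>J. X (exp n * t) \<omega>) \<in> M \<rightarrow>\<^sub>M Pi\<^sub>M J (\<lambda>_. borel)"
    using J by (intro measurable_restrict X_measurable) auto
  have m2: "(\<lambda>\<omega>. \<lambda>t\<in>J. (exp n powr H) *\<^sub>R X t \<omega>) \<in> M \<rightarrow>\<^sub>M Pi\<^sub>M J (\<lambda>_. borel)"
    using J by (intro measurable_restrict borel_measurable_scaleR X_measurable) auto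
  have "measure (fdd M (\<lambda>t. X (exp n * t)) J) S = prob {\<omega>\<in>space M. \<forall>i\<le>2 ^ j. osc n j i \<omega> \<le> x}"
  proof -
    have "norm (X (exp n * exp (real i / 2 ^ j)) \<omega> - X (exp n) \<omega>) \<le> x * exp (H * n) \<longleftrightarrow> osc n j i \<omega> \<le> x"
      for i \<omega> by (simp add: osc_def pos_divide_le_eq exp_add)
    with 1 2 have "(\<lambda>\<omega>. \<lambda>t\<in>J. X (exp n * t) \<omega>) -` S \<inter> space M = {\<omega>\<in>space M. \<forall>i\<le>2 ^ j. osc n j i \<omega> \<le> x}"
      by (auto simp: S_def space_PiM)
    then show ?thesis
      unfolding fdd_def by (subst measure_distr[OF m1]) simp_all
  qed
  moreover have "measure (fdd M (\<lambda>t \<omega>. (exp n powr H) *\<^sub>R X t \<omega>) J) S = prob {\<omega>\<in>space M. \<forall>i\<le>2 ^ j. osc 0 j i \<omega> \<le> x}"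
  proof -
    have "exp (real_of_int n) powr H = exp (H * n)" by (simp add: powr_def)
    then have "norm ((exp n powr H) *\<^sub>R X (exp (real i / 2 ^ j)) \<omega> - (exp n powr H) *\<^sub>R X 1 \<omega>) \<le> x * exp (H * n)
      \<longleftrightarrow> osc 0 j i \<omega> \<le> x" for i \<omega>
      by (simp add: osc_def scaleR_diff_right[symmetric] mult.commute)
    with 1 2 have "(\<lambda>\<omega>. \<lambda>t\<in>J. (exp n powr H) *\<^sub>R X t \<omega>) -` S \<inter> space M = {\<omega>\<in>space M. \<forall>i\<le>2 ^ j. osc 0 j i \<omega> \<le> x}"
      by (auto simp: S_def space_PiM)
    then show ?thesis
      unfolding fdd_def by (subst measure_distr[OF m2]) simp_all
  qed
  ultimately show ?thesis using eq by simp
qed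

text \<open>Consecutive blocks are cut out of one increasing sequence of times. Each grid difference
  is a partial sum of increments from its own block, and increments over disjoint index sets are
  jointly independent.\<close>

lemma prob_osc_indep:
  "prob {\<omega>\<in>space M. \<forall>m\<in>{a..<b}. \<forall>i\<le>2 ^ j. osc m j i \<omega> \<le> x m}
    = (\<Prod>m\<in>{a..<b}. prob {\<omega>\<in>space M. \<forall>i\<le>2 ^ j. osc m j i \<omega> \<le> x m})"
proof (cases "a < b")
  case True
  \<comment> \<open>One grid of mesh \<open>2 ^ - j\<close> in logarithmic time runs through all
    blocks from \<open>a\<close> to \<open>b\<close>; block \<open>m\<close> starts at index
    \<open>p m\<close>.\<close>
  define t where "t i = exp (real_of_int a + real i / 2 ^ j)" for i :: nat
  define p where "p m = nat (m - a) * 2 ^ j" for m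
  define k where "k = p b"
  define B where "B m = {p m ..< p m + 2 ^ j}" for m
  define \<Delta> where "\<Delta> i \<omega> = X (t (Suc i)) \<omega> - X (t i) \<omega>" for i \<omega>
  have "strict_mono_on {..k} t"
    by (auto simp: strict_mono_on_def t_def divide_strict_right_mono)
  then have ind: "indep_vars (\<lambda>_. borel) \<Delta> {..<k}"
    unfolding \<Delta>_def by (intro increments_indep) (assumption | simp add: t_def)+
  have pm: "p m + 2 ^ j \<le> p m'" if "m < m'" "a \<le> m" for m m'
  proof -
    have "p m + 2 ^ j = (nat (m - a) + 1) * 2 ^ j" by (simp add: p_def)
    also have "\<dots> \<le> p m'" unfolding p_def using that by (intro mult_right_mono) auto
    finally show ?thesis .
  qed
  have sub: "B m \<subseteq> {..<k}" if "m \<in> {a..<b}" for m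
    using that pm[of m b] by (auto simp: B_def k_def)
  have disj: "disjoint_family_on B {a..<b}"
    unfolding disjoint_family_on_def
  proof (intro ballI impI)
    fix m m' assume "m \<in> {a..<b}" "m' \<in> {a..<b}" "m \<noteq> m'"
    then show "B m \<inter> B m' = {}"
      using pm[of m m'] pm[of m' m] by (cases "m < m'") (auto simp: B_def)
  qed
  have ind2: "indep_vars (\<lambda>m. Pi\<^sub>M (B m) (\<lambda>_. borel)) (\<lambda>m \<omega>. restrict (\<lambda>i. \<Delta> i \<omega>) (B m)) {a..<b}"
    by (rule indep_vars_restrict[OF ind sub disj])
  define S where "S m = {y \<in> space (Pi\<^sub>M (B m) (\<lambda>_. borel :: (real ^ 'n) measure)).
     \<forall>i\<in>{..2 ^ j}. norm (\<Sum>l<i. y (p m + l)) \<le> x m * exp (H * m)}" for m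
  have S: "S m \<in> sets (Pi\<^sub>M (B m) (\<lambda>_. borel))" for m
    unfolding S_def
  proof (rule sets.sets_Collect_finite_All)
    fix i assume i: "i \<in> {..2 ^ j :: nat}"
    have [measurable]: "(\<lambda>y. \<Sum>l<i. y (p m + l)) \<in> Pi\<^sub>M (B m) (\<lambda>_. borel :: (real ^ 'n) measure) \<rightarrow>\<^sub>M borel"
      using i by (intro borel_measurable_sum measurable_component_singleton) (auto simp: B_def)
    show "{y \<in> space (Pi\<^sub>M (B m) (\<lambda>_. borel :: (real ^ 'n) measure)).
        norm (\<Sum>l<i. y (p m + l)) \<le> x m * exp (H * m)} \<in> sets (Pi\<^sub>M (B m) (\<lambda>_. borel))"
      by measurable
  qed simp
  have eq: "(\<lambda>\<omega>. restrict (\<lambda>i. \<Delta> i \<omega>) (B m)) -` S m \<inter> space M = {\<omega>\<in>space M. \<forall>i\<le>2 ^ j. osc m j i \<omega> \<le> x m}"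
    if "m \<in> {a..<b}" for m
  proof -
    have tp: "t (p m + i) = exp (m + i / 2 ^ j)" for i
      using that by (simp add: t_def p_def field_simps)
    have "norm (\<Sum>l<i. restrict (\<lambda>i. \<Delta> i \<omega>) (B m) (p m + l)) = osc m j i \<omega> * exp (H * m)"
      if "i \<le> 2 ^ j" for i \<omega>
    proof -
      have "(\<Sum>l<i. restrict (\<lambda>i. \<Delta> i \<omega>) (B m) (p m + l)) = (\<Sum>l<i. X (t (p m + Suc l)) \<omega> - X (t (p m + l)) \<omega>)"
        using \<open>i \<le> 2 ^ j\<close> by (intro sum.cong) (auto simp: B_def \<Delta>_def)
      also have "\<dots> = X (t (p m + i)) \<omega> - X (t (p m + 0)) \<omega>"
        by (rule sum_lessThan_telescope)
      finally show ?thesis using tp[of i] tp[of 0] by (simp add: osc_def)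
    qed
    then show ?thesis
      by (auto simp: S_def space_PiM)
  qed
  have "prob (\<Inter>m\<in>{a..<b}. (\<lambda>\<omega>. restrict (\<lambda>i. \<Delta> i \<omega>) (B m)) -` S m \<inter> space M)
    = (\<Prod>m\<in>{a..<b}. prob ((\<lambda>\<omega>. restrict (\<lambda>i. \<Delta> i \<omega>) (B m)) -` S m \<inter> space M))"
    using True by (intro indep_varsD[OF ind2]) (auto intro: S)
  also have "(\<Inter>m\<in>{a..<b}. (\<lambda>\<omega>. restrict (\<lambda>i. \<Delta> i \<omega>) (B m)) -` S m \<inter> space M)
     = (\<Inter>m\<in>{a..<b}. {\<omega>\<in>space M. \<forall>i\<le>2 ^ j. osc m j i \<omega> \<le> x m})"
    by (intro INF_cong refl eq)
  also have "\<dots> = {\<omega>\<in>space M. \<forall>m\<in>{a..<b}. \<forall>i\<le>2 ^ j. osc m j i \<omega> \<le> x m}"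
    using True by auto
  also have "(\<Prod>m\<in>{a..<b}. prob ((\<lambda>\<omega>. restrict (\<lambda>i. \<Delta> i \<omega>) (B m)) -` S m \<inter> space M))
     = (\<Prod>m\<in>{a..<b}. prob {\<omega>\<in>space M. \<forall>i\<le>2 ^ j. osc m j i \<omega> \<le> x m})"
    by (intro prod.cong refl arg_cong[where f=prob] eq)
  finally show ?thesis .
qed (simp add: prob_space)

text \<open>Each grid refines the preceding one (\<open>osc_Suc\<close>), so the events decrease in
  \<open>j\<close> and their intersection is the event for the supremum.\<close>

lemma prob_osc_lim:
  fixes x :: "int \<Rightarrow> real"
  assumes F: "finite F" and x: "\<And>m. m \<in> F \<Longrightarrow> 0 \<le> x m"
  shows "(\<lambda>j. prob {\<omega>\<in>space M. \<forall>m\<in>F. \<forall>i\<le>2 ^ j. osc m j i \<omega> \<le> x m})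
    \<longlonglongrightarrow> prob {\<omega>\<in>space M. \<forall>m\<in>F. osc_sup m \<omega> \<le> ennreal (x m)}"
proof -
  let ?A = "\<lambda>j. {\<omega>\<in>space M. \<forall>m\<in>F. \<forall>i\<in>{..2 ^ j}. osc m j i \<omega> \<le> x m}"
  have "(\<lambda>j. prob (?A j)) \<longlonglongrightarrow> prob (\<Inter>j. ?A j)"
  proof (rule finite_Lim_measure_decseq)
    show "range ?A \<subseteq> events"
      using F by auto
    show "decseq ?A"
    proof (rule decseq_SucI, safe)
      fix j \<omega> m i
      assume *: "\<forall>m\<in>F. \<forall>i\<in>{..2 ^ Suc j}. osc m (Suc j) i \<omega> \<le> x m" and "m \<in> F" "i \<le> (2::nat) ^ j"
      then have "osc m (Suc j) (2 * i) \<omega> \<le> x m" by auto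
      then show "osc m j i \<omega> \<le> x m" by (simp only: osc_Suc)
    qed
  qed
  also have "(\<Inter>j. ?A j) = {\<omega>\<in>space M. \<forall>m\<in>F. osc_sup m \<omega> \<le> ennreal (x m)}"
    using x by (auto simp: osc_sup_le_iff)
  finally show ?thesis by (simp add: Ball_def)
qed

lemma prob_osc_sup_stationary:
  assumes "0 \<le> x"
  shows "prob {\<omega>\<in>space M. osc_sup n \<omega> \<le> ennreal x} = prob {\<omega>\<in>space M. osc_sup 0 \<omega> \<le> ennreal x}"
  using prob_osc_lim[of "{n}" "\<lambda>_. x"] prob_osc_lim[of "{0}" "\<lambda>_. x"] prob_osc_stationary[of _ n x] assms
  by (auto intro: LIMSEQ_unique)

lemma prob_osc_sup_indep:
  assumes "\<And>m. 0 \<le> x m"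
  shows "prob {\<omega>\<in>space M. \<forall>m\<in>{a..<b}. osc_sup m \<omega> \<le> ennreal (x m)}
    = (\<Prod>m\<in>{a..<b}. prob {\<omega>\<in>space M. osc_sup m \<omega> \<le> ennreal (x m)})"
proof -
  have "(\<lambda>j. \<Prod>m\<in>{a..<b}. prob {\<omega>\<in>space M. \<forall>i\<le>2 ^ j. osc m j i \<omega> \<le> x m})
    \<longlonglongrightarrow> (\<Prod>m\<in>{a..<b}. prob {\<omega>\<in>space M. osc_sup m \<omega> \<le> ennreal (x m)})"
    using prob_osc_lim[of "{_}" x] assms by (intro tendsto_prod) simp
  moreover have "(\<lambda>j. \<Prod>m\<in>{a..<b}. prob {\<omega>\<in>space M. \<forall>i\<le>2 ^ j. osc m j i \<omega> \<le> x m})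
    \<longlonglongrightarrow> prob {\<omega>\<in>space M. \<forall>m\<in>{a..<b}. osc_sup m \<omega> \<le> ennreal (x m)}"
    using prob_osc_lim[of "{a..<b}" x] assms unfolding prob_osc_indep by simp
  ultimately show ?thesis by (intro LIMSEQ_unique)
qed

text \<open>\<open>f\<close> enumerates blocks towards infinity or towards time \<open>0\<close>.
  Intervals must go to intervals, since the product formula is known for consecutive blocks. A
  divergent series would put infinitely many oscillations above their thresholds.\<close>

lemma suminf_osc_tail_finite:
  fixes f :: "nat \<Rightarrow> int" and x :: "nat \<Rightarrow> real"
  assumes "inj f" and f: "\<And>a b. \<exists>p q. f ` {a..<b} = {p..<q}"
    and x: "\<And>n. 0 \<le> x n"
    and ev: "AE \<omega> in M. \<exists>a. \<forall>n\<ge>a. osc_sup (f n) \<omega> \<le> ennreal (x n)"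
  shows "(\<Sum>n. emeasure M {\<omega>\<in>space M. ennreal (x n) < osc_sup 0 \<omega>}) < \<infinity>"
proof -
  define E where "E n = {\<omega>\<in>space M. ennreal (x n) < osc_sup (f n) \<omega>}" for n
  have [measurable]: "E n \<in> events" for n unfolding E_def by measurable
  have pE: "prob (E n) = prob {\<omega>\<in>space M. ennreal (x n) < osc_sup 0 \<omega>}" for n
  proof -
    have "prob {\<omega>\<in>space M. ennreal (x n) < osc_sup m \<omega>} = 1 - prob {\<omega>\<in>space M. osc_sup m \<omega> \<le> ennreal (x n)}" for m
      by (subst prob_neg[symmetric]) (auto simp: not_le)
    then show ?thesis using prob_osc_sup_stationary[OF x[of n], of "f n"] by (simp add: E_def)
  qed
  have "summable (\<lambda>n. prob (E n))"
  proof (rule ccontr)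
    assume "\<not> ?thesis"
    then have "AE \<omega> in M. \<forall>a. \<exists>n\<ge>a. \<omega> \<in> E n"
    proof (rule borel_cantelli_AE2[rotated 2])
      fix a b
      \<comment> \<open>Thresholds are indexed by steps but the product formula by blocks;
        \<open>inv f\<close> translates.\<close>
      define y where "y m = x (inv f m)" for m
      have y: "y (f n) = x n" for n using \<open>inj f\<close> by (simp add: y_def)
      obtain p q where pq: "f ` {a..<b} = {p..<q}" using f by blast
      have "prob {\<omega>\<in>space M. \<forall>n\<in>{a..<b}. \<omega> \<notin> E n} = prob {\<omega>\<in>space M. \<forall>m\<in>f ` {a..<b}. osc_sup m \<omega> \<le> ennreal (y m)}"
        by (intro arg_cong[where f=prob]) (auto simp: E_def y)
      also have "\<dots> = (\<Prod>m\<in>f ` {a..<b}. prob {\<omega>\<in>space M. osc_sup m \<omega> \<le> ennreal (y m)})"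
        unfolding pq by (rule prob_osc_sup_indep) (simp add: y_def x)
      also have "\<dots> = (\<Prod>n\<in>{a..<b}. prob {\<omega>\<in>space M. osc_sup (f n) \<omega> \<le> ennreal (x n)})"
        using \<open>inj f\<close> by (subst prod.reindex) (auto simp: y intro: inj_on_subset)
      also have "\<dots> = (\<Prod>n\<in>{a..<b}. 1 - prob (E n))"
        unfolding E_def by (subst prob_neg[symmetric]) (auto simp: not_less)
      finally show "prob {\<omega>\<in>space M. \<forall>n\<in>{a..<b}. \<omega> \<notin> E n} = \<dots>" .
    qed auto
    with ev have "AE \<omega> in M. False"
    proof eventually_elim
      case (elim \<omega>)
      then obtain a where a: "\<And>n. n \<ge> a \<Longrightarrow> osc_sup (f n) \<omega> \<le> ennreal (x n)" by blast
      with elim(2) obtain n where "n \<ge> a" "\<omega> \<in> E n" by blast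
      with a[of n] show False by (simp add: E_def not_less[symmetric])
    qed
    then show False by (simp add: AE_False)
  qed
  then have "(\<Sum>n. ennreal (prob (E n))) < \<infinity>"
    by (subst suminf_ennreal2) auto
  then show ?thesis unfolding pE by (simp add: emeasure_eq_measure)
qed

lemma AE_cadlag: "AE \<omega> in M. cadlag (\<lambda>t. X t \<omega>)"
  using ss by (simp add: selfsimilar_additive_def)

text \<open>Right continuity at \<open>0\<close> alone forces the logarithmic moment of the oscillations.\<close>

lemma suminf_osc_exp_finite: "(\<Sum>n. emeasure M {\<omega>\<in>space M. ennreal (exp (H * real n)) < osc_sup 0 \<omega>}) < \<infinity>"
proof (rule suminf_osc_tail_finite[where f = "\<lambda>n. - int n"])
  show "\<exists>p q. (\<lambda>n. - int n) ` {a..<b} = {p..<q}" for a b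
  proof -
    have "(\<lambda>n. - int n) ` {a..<b} = {1 - int b..<1 - int a}"
    proof safe
      fix m assume "m \<in> {1 - int b..<1 - int a}"
      then show "m \<in> (\<lambda>n. - int n) ` {a..<b}"
        by (intro image_eqI[of _ _ "nat (- m)"]) auto
    qed auto
    then show ?thesis by blast
  qed
  show "AE \<omega> in M. \<exists>a. \<forall>n\<ge>a. osc_sup (- int n) \<omega> \<le> ennreal (exp (H * real n))"
    using AE_cadlag
  proof eventually_elim
    case (elim \<omega>)
    then have "((\<lambda>t. X t \<omega>) \<longlongrightarrow> X 0 \<omega>) (at_right 0)"
      by (simp add: cadlag_def)
    then have "\<forall>\<^sub>F t in at_right 0. dist (X t \<omega>) (X 0 \<omega>) < 1 / 2"
      by (rule tendstoD) simp
    then obtain d where d: "0 < d" "\<And>t. 0 < t \<Longrightarrow> t < d \<Longrightarrow> dist (X t \<omega>) (X 0 \<omega>) < 1 / 2"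
      unfolding eventually_at_right_field by auto
    obtain a :: nat where a: "1 - ln d < real a"
      using reals_Archimedean2 by blast
    have "osc (- int n) j i \<omega> \<le> exp (H * real n)" if "n \<ge> a" "i \<le> 2 ^ j" for n j i
    proof -
      have i: "real i / 2 ^ j \<le> 1"
        using of_nat_mono[OF that(2), where 'a = real] by simp
      have "real a \<le> real n" using that by simp
      then have "1 - real n < ln d" using a by linarith
      then have "exp (1 - real n) < d" using d(1) by (metis exp_less_cancel_iff exp_ln)
      then have *: "exp (s - real n) < d" if "s \<le> 1" for s
        using that by (meson diff_right_mono exp_le_cancel_iff order.strict_trans1)
      have "dist (X (exp (real i / 2 ^ j - real n)) \<omega>) (X (exp (0 - real n)) \<omega>) \<le> 1 / 2 + 1 / 2"
        using d(2)[of "exp (real i / 2 ^ j - real n)"] d(2)[of "exp (0 - real n)"] i *[of "real i / 2 ^ j"] *[of 0]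
        by (intro order_trans[OF dist_triangle2] add_mono less_imp_le) (auto simp: dist_commute)
      then have "norm (X (exp (real i / 2 ^ j - real n)) \<omega> - X (exp (- real n)) \<omega>) \<le> 1"
        by (simp add: dist_norm)
      then show ?thesis by (simp add: osc_def exp_minus field_simps)
    qed
    then show ?case by (intro exI[of _ a]) (auto simp: osc_sup_le_iff)
  qed
qed (auto simp: inj_def)

text \<open>In \<open>4 * exp H\<close> one factor \<open>2\<close> is room above the limit
  \<open>1\<close>, another comes from bounding a difference by two norms, and \<open>exp H\<close>
  is the growth of \<open>t powr H\<close> across a block.\<close>

lemma suminf_osc_growth_finite:
  assumes g: "g \<in> G1"
    and lim: "AE \<omega> in M. growth_limsup H g (\<lambda>t. norm (X t \<omega>)) = 1"
  shows "(\<Sum>n. emeasure M {\<omega>\<in>space M. ennreal (4 * exp H * g (real (Suc n))) < osc_sup 0 \<omega>}) < \<infinity>"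
proof (rule suminf_osc_tail_finite[where f = int])
  show "\<exists>p q. int ` {a..<b} = {p..<q}" for a b
    by (metis image_int_atLeastLessThan)
  show "0 \<le> 4 * exp H * g (real (Suc n))" for n
    using G1_pos[OF g, of "real (Suc n)"] by simp
  show "AE \<omega> in M. \<exists>a. \<forall>n\<ge>a. osc_sup (int n) \<omega> \<le> ennreal (4 * exp H * g (real (Suc n)))"
    using lim
  proof eventually_elim
    case (elim \<omega>)
    have "\<forall>\<^sub>F t in at_top. ereal (norm (X t \<omega>) / (t powr H * g (ln t))) < 2"
      by (rule Limsup_lessD) (simp add: elim)
    then have "\<forall>\<^sub>F t in at_top. norm (X t \<omega>) / (t powr H * g (ln t)) < 2"
      by simp
    moreover have "\<forall>\<^sub>F t in at_top. (1::real) \<le> t"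
      by (rule eventually_ge_at_top)
    ultimately have "\<forall>\<^sub>F t in at_top. norm (X t \<omega>) \<le> 2 * (t powr H * g (ln t))"
    proof eventually_elim
      case (elim t)
      then have "0 < t powr H * g (ln t)" using G1_pos[OF g, of "ln t"] by simp
      with elim show ?case by (simp add: field_simps)
    qed
    then obtain T where T: "\<And>t. T \<le> t \<Longrightarrow> norm (X t \<omega>) \<le> 2 * (t powr H * g (ln t))"
      unfolding eventually_at_top_linorder by blast
    have bnd: "norm (X (exp (real n + s)) \<omega>) \<le> 2 * (exp H * exp (H * n)) * g (real (Suc n))"
      if "0 \<le> s" "s \<le> 1" "T \<le> real n" for n s
    proof -
      have "T \<le> exp (real n + s)"
        using exp_ge_add_one_self[of "real n + s"] that by linarith
      from T[OF this] have "norm (X (exp (real n + s)) \<omega>) \<le> 2 * (exp (H * (real n + s)) * g (real n + s))"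
        by (simp add: powr_def)
      also have "\<dots> \<le> 2 * (exp (H * (real n + 1)) * g (real (Suc n)))"
        using that H_pos G1_mono[OF g, of "real n + s" "real (Suc n)"] G1_pos[OF g, of "real n + s"]
        by (intro mult_left_mono mult_mono) auto
      finally show ?thesis by (simp add: exp_add algebra_simps)
    qed
    obtain a :: nat where a: "T \<le> real a" using real_arch_simple by blast
    have "osc (int n) j i \<omega> \<le> 4 * exp H * g (real (Suc n))" if "n \<ge> a" "i \<le> 2 ^ j" for n j i
    proof -
      have i: "real i / 2 ^ j \<le> 1"
        using of_nat_mono[OF that(2), where 'a = real] by simp
      have "norm (X (exp (real n + real i / 2 ^ j)) \<omega> - X (exp (real n + 0)) \<omega>)
        \<le> 2 * (exp H * exp (H * n)) * g (real (Suc n)) + 2 * (exp H * exp (H * n)) * g (real (Suc n))"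
        using that a i by (intro order_trans[OF norm_triangle_ineq4] add_mono bnd) auto
      then show ?thesis by (simp add: osc_def field_simps)
    qed
    moreover have "0 \<le> 4 * exp H * g (real (Suc n))" for n
      using G1_pos[OF g, of "real (Suc n)"] by simp
    ultimately show ?case by (intro exI[of _ a]) (auto simp: osc_sup_le_iff)
  qed
qed auto

text \<open>The left inequality is strict because right continuity is exploited from the right only;
  this is also why \<open>s < 1\<close> is assumed.\<close>

lemma dyadic_between:
  fixes s d :: real
  assumes "0 \<le> s" "s < 1" "0 < d"
  obtains i j :: nat where "i \<le> 2 ^ j" "s < real i / 2 ^ j" "real i / 2 ^ j < s + d"
proof -
  obtain j where j: "(1 / 2) ^ j < d"
    using real_arch_pow_inv[of d "1/2"] assms by auto
  define i where "i = nat \<lfloor>s * 2 ^ j\<rfloor> + 1"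
  have 0: "0 \<le> s * 2 ^ j" "s * 2 ^ j < 2 ^ j" using assms by auto
  then have i: "real i = real_of_int \<lfloor>s * 2 ^ j\<rfloor> + 1" by (simp add: i_def)
  have "\<lfloor>s * 2 ^ j\<rfloor> < 2 ^ j" using 0 by (simp add: floor_less_iff)
  then have 1: "i \<le> 2 ^ j" unfolding i_def using 0 by (simp add: nat_less_iff Suc_le_eq)
  have 2: "s < real i / 2 ^ j" unfolding i by (simp add: less_divide_eq)
  have "real i \<le> s * 2 ^ j + 1" unfolding i by linarith
  then have "real i / 2 ^ j \<le> (s * 2 ^ j + 1) / 2 ^ j" by (rule divide_right_mono) simp
  also have "\<dots> = s + (1 / 2) ^ j" by (simp add: add_divide_distrib power_one_over)
  finally have "real i / 2 ^ j \<le> s + (1 / 2) ^ j" .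
  with j have 3: "real i / 2 ^ j < s + d" by simp
  from that 1 2 3 show ?thesis .
qed

text \<open>A violation at \<open>s < 1\<close> would persist at all slightly later times by right
  continuity, hence at some dyadic time. The end point \<open>s = 1\<close> lies on every
  grid.\<close>

lemma osc_bound_all:
  assumes cad: "cadlag (\<lambda>t. X t \<omega>)" and "0 \<le> x" and le: "osc_sup n \<omega> \<le> ennreal x" and s: "0 \<le> s" "s \<le> 1"
  shows "norm (X (exp (real_of_int n + s)) \<omega> - X (exp n) \<omega>) \<le> x * exp (H * n)"
proof (rule ccontr)
  have dy: "norm (X (exp (real_of_int n + real i / 2 ^ j)) \<omega> - X (exp n) \<omega>) \<le> x * exp (H * n)" if "i \<le> 2 ^ j" for i j
    using le that \<open>0 \<le> x\<close> by (auto simp: osc_sup_le_iff osc_def pos_divide_le_eq)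
  assume "\<not> ?thesis"
  then have *: "x * exp (H * n) < norm (X (exp (real_of_int n + s)) \<omega> - X (exp n) \<omega>)" by simp
  then have "s \<noteq> 1" using dy[of 1 0] by auto
  with s have "s < 1" by simp
  have "((\<lambda>t. X t \<omega>) \<longlongrightarrow> X (exp (real_of_int n + s)) \<omega>) (at_right (exp (real_of_int n + s)))"
    using cad by (simp add: cadlag_def)
  then have "((\<lambda>t. norm (X t \<omega> - X (exp n) \<omega>)) \<longlongrightarrow> norm (X (exp (real_of_int n + s)) \<omega> - X (exp n) \<omega>)) (at_right (exp (real_of_int n + s)))"
    by (intro tendsto_intros)
  from order_tendstoD(1)[OF this *]
  obtain b where b: "exp (real_of_int n + s) < b"
    "\<And>t. exp (real_of_int n + s) < t \<Longrightarrow> t < b \<Longrightarrow> x * exp (H * n) < norm (X t \<omega> - X (exp n) \<omega>)"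
    unfolding eventually_at_right_field by auto
  have b0: "0 < b" using b(1) by (meson exp_gt_zero less_trans)
  with b(1) have "real_of_int n + s < ln b" by (metis exp_less_cancel_iff exp_ln)
  then obtain i j where ij: "i \<le> 2 ^ j" "s < real i / 2 ^ j" "real i / 2 ^ j < s + (ln b - (real_of_int n + s))"
    using dyadic_between[OF s(1) \<open>s < 1\<close>, of "ln b - (real_of_int n + s)"] by auto
  then have "real_of_int n + real i / 2 ^ j < ln b" by linarith
  then have "exp (real_of_int n + real i / 2 ^ j) < b" using b0 by (metis exp_less_cancel_iff exp_ln)
  with b(2)[of "exp (real_of_int n + real i / 2 ^ j)"] ij dy[of i j] show False by simp
qed

theorem not_class_OR:
  assumes g: "g \<in> G1"
    and lim: "AE \<omega> in M. growth_limsup H g (\<lambda>t. norm (X t \<omega>)) = 1"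
  shows "(\<lambda>x. gen_inv g x + ln x) \<notin> class_OR"
proof
  assume OR: "(\<lambda>x. gen_inv g x + ln x) \<in> class_OR"
  have H1: "1 < exp H" using H_pos by simp
  \<comment> \<open>The two summands of \<open>e / (exp H - 1) + e = 1 / 4\<close> are the shares of
    the past blocks and of the current block; their sum leaves ample room below
    \<open>1\<close>.\<close>
  define e where "e = (exp H - 1) / (4 * exp H)"
  have e: "0 < e" "e / (exp H - 1) + e = 1 / 4"
    using H1 by (auto simp: e_def field_simps)
  have "AE \<omega> in M. osc_sup 0 \<omega> < \<infinity>"
  proof -
    have "AE \<omega> in M. \<exists>a. \<forall>n\<ge>a. \<omega> \<notin> {\<omega>\<in>space M. ennreal (exp (H * real n)) < osc_sup 0 \<omega>}"
      by (rule borel_cantelli_suminf[OF _ suminf_osc_exp_finite]) measurable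
    with AE_space show ?thesis
    proof eventually_elim
      case (elim \<omega>)
      then obtain n where "\<forall>m\<ge>n. \<omega> \<notin> {\<omega>\<in>space M. ennreal (exp (H * real m)) < osc_sup 0 \<omega>}"
        by (elim exE)
      then have "\<not> ennreal (exp (H * real n)) < osc_sup 0 \<omega>"
        using elim(1) by blast
      then show ?case using order.strict_trans1[OF _ ennreal_less_top] by (simp add: not_less)
    qed
  qed
  \<comment> \<open>\<open>enn2real\<close> sends infinity to \<open>0\<close>, so the tails of the
    real and the extended variable agree only thanks to almost sure finiteness.\<close>
  have tail: "emeasure M {\<omega>\<in>space M. y < enn2real (osc_sup 0 \<omega>)} = emeasure M {\<omega>\<in>space M. ennreal y < osc_sup 0 \<omega>}"
    if "0 \<le> y" for y
  proof (rule emeasure_eq_AE)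
    from \<open>AE \<omega> in M. osc_sup 0 \<omega> < \<infinity>\<close>
    show "AE \<omega> in M. \<omega> \<in> {\<omega>\<in>space M. y < enn2real (osc_sup 0 \<omega>)} \<longleftrightarrow> \<omega> \<in> {\<omega>\<in>space M. ennreal y < osc_sup 0 \<omega>}"
    proof eventually_elim
      case (elim \<omega>)
      then show ?case using that by (cases "osc_sup 0 \<omega>") (auto simp: ennreal_less_iff)
    qed
  qed measurable
  have g0: "0 \<le> g (real n)" for n using G1_pos[OF g, of "real n"] by simp
  have "(\<Sum>n. emeasure M {\<omega>\<in>space M. e * g (real n) < enn2real (osc_sup 0 \<omega>)}) < \<infinity>"
    using suminf_osc_growth_finite[OF g lim] suminf_osc_exp_finite H_pos e(1) g0
    by (intro class_OR_suminf_tail[OF _ g OR, where c = "4 * exp H" and H = H]) (auto simp: tail mult.assoc simp del: of_nat_Suc)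
  then have fin: "(\<Sum>n. emeasure M {\<omega>\<in>space M. ennreal (e * g (real n)) < osc_sup 0 \<omega>}) < \<infinity>"
    using e(1) g0 by (simp add: tail)
  have stat: "emeasure M {\<omega>\<in>space M. ennreal y < osc_sup n \<omega>} = emeasure M {\<omega>\<in>space M. ennreal y < osc_sup 0 \<omega>}"
    if "0 \<le> y" for n y
  proof -
    have "prob {\<omega>\<in>space M. ennreal y < osc_sup m \<omega>} = 1 - prob {\<omega>\<in>space M. osc_sup m \<omega> \<le> ennreal y}" for m
      by (subst prob_neg[symmetric]) (auto simp: not_le)
    then show ?thesis using prob_osc_sup_stationary[OF that, of n] by (simp add: emeasure_eq_measure)
  qed
  have "AE \<omega> in M. \<exists>a. \<forall>n\<ge>a. \<omega> \<notin> {\<omega>\<in>space M. ennreal (e * g (real n)) < osc_sup (int n) \<omega>}"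
  proof (rule borel_cantelli_suminf)
    have "emeasure M {\<omega>\<in>space M. ennreal (e * g (real n)) < osc_sup (int n) \<omega>}
      = emeasure M {\<omega>\<in>space M. ennreal (e * g (real n)) < osc_sup 0 \<omega>}" for n
      using e(1) g0 by (intro stat) simp
    with fin show "(\<Sum>n. emeasure M {\<omega>\<in>space M. ennreal (e * g (real n)) < osc_sup (int n) \<omega>}) < \<infinity>"
      by simp
  qed measurable
  with AE_cadlag lim AE_space have "AE \<omega> in M. False"
  proof eventually_elim
    case (elim \<omega>)
    from elim(3) obtain a where a: "\<And>n. a \<le> n \<Longrightarrow> osc_sup (int n) \<omega> \<le> ennreal (e * g (real n))"
      using elim(4) by (auto simp: not_less)
    define y where "y n = norm (X (exp (real n)) \<omega>)" for n
    have near: "norm (X (exp (real n + s)) \<omega>) \<le> y n + e * (exp (H * n) * g n)" if "a \<le> n" "0 \<le> s" "s \<le> 1" for n s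
    proof -
      have "norm (X (exp (real n + s)) \<omega> - X (exp (real n)) \<omega>) \<le> e * g n * exp (H * n)"
        using osc_bound_all[OF elim(1) _ a[OF that(1)] that(2,3)] e(1) g0 by simp
      moreover have "norm (X (exp (real n + s)) \<omega>) \<le> norm (X (exp (real n + s)) \<omega> - X (exp (real n)) \<omega>) + y n"
        unfolding y_def by (metis add.commute norm_triangle_sub)
      ultimately show ?thesis by (simp add: mult_ac)
    qed
    obtain K where K: "0 \<le> K" "\<And>n. a \<le> n \<Longrightarrow> y n \<le> K + e / (exp H - 1) * (exp (H * n) * g n)"
    proof (rule geometric_growth[OF g H_pos, of e a y])
      show "y (Suc n) \<le> y n + e * (exp (H * n) * g n)" if "a \<le> n" for n
        using near[OF that, of 1] by (simp add: y_def add.commute)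
    qed (use e in auto)
    have bound: "norm (X t \<omega>) \<le> K + 1 / 4 * (t powr H * g (ln t))" if t: "exp (real a) \<le> t" for t
    proof -
      have t0: "0 < t" using t by (meson exp_gt_zero less_le_trans)
      have lt: "real a \<le> ln t" using t t0 by (simp add: ln_ge_iff)
      define n where "n = nat \<lfloor>ln t\<rfloor>"
      have n: "real n \<le> ln t" "ln t \<le> real n + 1" "a \<le> n"
        using lt by (auto simp: n_def le_nat_floor)
      have "norm (X t \<omega>) = norm (X (exp (real n + (ln t - real n))) \<omega>)" using t0 by simp
      also have "\<dots> \<le> y n + e * (exp (H * n) * g n)" using n by (intro near) auto
      also have "\<dots> \<le> K + e / (exp H - 1) * (exp (H * n) * g n) + e * (exp (H * n) * g n)"
        using K(2)[OF n(3)] by simp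
      also have "\<dots> = K + (e / (exp H - 1) + e) * (exp (H * n) * g n)" by (simp add: algebra_simps)
      also have "\<dots> = K + 1 / 4 * (exp (H * n) * g n)" unfolding e(2) ..
      also have "exp (H * n) * g n \<le> exp (H * ln t) * g (ln t)"
        using n H_pos G1_mono[OF g, of n "ln t"] g0 by (intro mult_mono) auto
      also have "exp (H * ln t) = t powr H" using t0 by (simp add: powr_def)
      finally show ?thesis by simp
    qed
    \<comment> \<open>The additive constant \<open>K\<close> is eventually at most a quarter of the
      normalisation. Together with the \<open>1 / 4\<close> above this gives an upper limit of at
      most \<open>1 / 2\<close>.\<close>
    have "filterlim (\<lambda>t::real. t powr H * g 0) at_top at_top"
      using G1_pos[OF g, of 0] H_pos by real_asymp
    then have "\<forall>\<^sub>F t in at_top. 4 * K \<le> t powr H * g 0"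
      by (simp add: filterlim_at_top)
    moreover have "\<forall>\<^sub>F t in at_top. exp (real a) \<le> t" "\<forall>\<^sub>F t in at_top. (1::real) \<le> t"
      by (rule eventually_ge_at_top)+
    ultimately have "\<forall>\<^sub>F t in at_top. ereal (norm (X t \<omega>) / (t powr H * g (ln t))) \<le> ereal (1 / 2)"
    proof eventually_elim
      case (elim t)
      have "t powr H * g 0 \<le> t powr H * g (ln t)"
        using elim G1_mono[OF g, of 0 "ln t"] by (intro mult_left_mono) auto
      with elim bound[of t] have "norm (X t \<omega>) \<le> 1 / 2 * (t powr H * g (ln t))" by linarith
      moreover have "0 < t powr H * g (ln t)" using elim G1_pos[OF g, of "ln t"] by simp
      ultimately show ?case by (simp add: pos_divide_le_eq)
    qed
    then have "growth_limsup H g (\<lambda>t. norm (X t \<omega>)) \<le> ereal (1 / 2)"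
      by (rule Limsup_bounded)
    with elim(2) show False by simp
  qed
  then show False by (simp add: AE_False)
qed

end

section \<open>Uniqueness of multivariate Laplace transforms\<close>

text \<open>Moments on the unit interval are bounded by \<open>1\<close>, so the exponential series
  of the characteristic function can be integrated term by term.\<close>

lemma real_distribution_eqI_moments:
  fixes M N :: "real measure"
  assumes "real_distribution M" "real_distribution N"
    and M01: "AE x in M. x \<in> {0..1}" and N01: "AE x in N. x \<in> {0..1}"
    and moments: "\<And>n. (\<integral>x. x ^ n \<partial>M) = (\<integral>x. x ^ n \<partial>N)"
  shows "M = N"
proof -
  have char: "char M t = (\<Sum>n. (\<i> * complex_of_real t) ^ n /\<^sub>R fact n * complex_of_real (\<integral>x. x ^ n \<partial>M))"
    if M: "real_distribution M" and 01: "AE x in M. x \<in> {0..1}" for M t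
  proof -
    interpret real_distribution M by fact
    define f where "f n x = (\<i> * complex_of_real t) ^ n /\<^sub>R fact n * complex_of_real (x ^ n)" for n and x :: real
    have int: "integrable M (\<lambda>x. x ^ n)" for n :: nat
    proof (rule integrable_const_bound[of _ 1])
      show "AE x in M. norm (x ^ n) \<le> 1"
        using 01 by eventually_elim (auto simp: power_le_one)
    qed simp
    have [measurable]: "f n \<in> borel_measurable borel" for n
      unfolding f_def by measurable
    have fint: "integrable M (f n)" for n
      unfolding f_def by (intro integrable_mult_right integrable_of_real int)
    have norm_f: "norm (f n x) \<le> \<bar>t\<bar> ^ n / fact n" if "x \<in> {0..1}" for n x
    proof -
      have "norm (f n x) = \<bar>t\<bar> ^ n / fact n * \<bar>x\<bar> ^ n"
        by (simp add: f_def norm_mult norm_power power_abs divide_inverse mult_ac)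
      also have "\<dots> \<le> \<bar>t\<bar> ^ n / fact n * 1"
        using that by (intro mult_left_mono) (auto simp: power_le_one)
      finally show ?thesis by simp
    qed
    have sum: "summable (\<lambda>n. \<bar>t\<bar> ^ n / fact n)"
      using summable_exp[of "\<bar>t\<bar>"] by (simp add: field_simps)
    have "char M t = (\<integral>x. (\<Sum>n. f n x) \<partial>M)"
      unfolding char_def
    proof (intro Bochner_Integration.integral_cong refl)
      fix x
      have "iexp (t * x) = (\<Sum>n. (\<i> * complex_of_real (t * x)) ^ n /\<^sub>R fact n)"
        by (simp add: exp_def)
      also have "\<dots> = (\<Sum>n. f n x)"
        by (simp add: f_def power_mult_distrib mult_ac)
      finally show "iexp (t * x) = (\<Sum>n. f n x)" .
    qed
    also have "\<dots> = (\<Sum>n. \<integral>x. f n x \<partial>M)"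
    proof (rule integral_suminf[OF fint])
      show "AE x in M. summable (\<lambda>n. norm (f n x))"
        using 01 by eventually_elim (rule summable_comparison_test'[OF sum, of 0], simp add: norm_f)
      show "summable (\<lambda>n. \<integral>x. norm (f n x) \<partial>M)"
      proof (rule summable_comparison_test'[OF sum, of 0])
        fix n
        have "(\<integral>x. norm (f n x) \<partial>M) \<le> (\<integral>x. \<bar>t\<bar> ^ n / fact n \<partial>M)"
          using 01 by (intro integral_mono_AE integrable_norm fint) (auto simp: norm_f)
        then show "norm (\<integral>x. norm (f n x) \<partial>M) \<le> \<bar>t\<bar> ^ n / fact n"
          using prob_space by simp
      qed
    qed
    also have "\<dots> = (\<Sum>n. (\<i> * complex_of_real t) ^ n /\<^sub>R fact n * complex_of_real (\<integral>x. x ^ n \<partial>M))"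
      by (intro suminf_cong) (simp add: f_def integral_complex_of_real del: of_real_power)
    finally show ?thesis .
  qed
  show ?thesis
    using char[OF assms(1) M01] char[OF assms(2) N01] moments
    by (intro Levy_uniqueness assms ext) simp
qed

text \<open>The normalised weight serves as a density, and \<open>exp (- Y)\<close> takes values in
  the unit interval. Laplace transforms at integers thus become moments.\<close>

lemma weighted_exp_law:
  fixes V Y :: "'a \<Rightarrow> real"
  assumes [measurable]: "V \<in> borel_measurable P" "Y \<in> borel_measurable P"
    and V: "\<And>\<omega>. 0 \<le> V \<omega>" "integrable P V" and Y: "\<And>\<omega>. 0 \<le> Y \<omega>"
    and c: "c = (\<integral>\<omega>. V \<omega> \<partial>P)" "0 < c"
  shows "\<exists>\<mu>. real_distribution \<mu> \<and> (AE x in \<mu>. x \<in> {0..1}) \<and>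
    (\<forall>f::real \<Rightarrow> real. f \<in> borel_measurable borel \<longrightarrow> (\<integral>x. f x \<partial>\<mu>) = (\<integral>\<omega>. V \<omega> * f (exp (- Y \<omega>)) \<partial>P) / c)"
proof (intro exI conjI allI impI)
  let ?D = "density P (\<lambda>\<omega>. ennreal (V \<omega> / c))"
  let ?\<mu> = "distr ?D (borel :: real measure) (\<lambda>\<omega>. exp (- Y \<omega>))"
  have "emeasure ?D (space P) = (\<integral>\<^sup>+\<omega>. ennreal (V \<omega> / c) \<partial>P)"
    by (subst emeasure_density) (auto intro!: nn_integral_cong)
  also have "\<dots> = ennreal (\<integral>\<omega>. V \<omega> / c \<partial>P)"
    using V c by (intro nn_integral_eq_integral) auto
  also have "\<dots> = 1" using c by simp
  finally have "prob_space ?D"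
    by (intro prob_spaceI) simp
  then have "prob_space ?\<mu>"
    by (intro prob_space.prob_space_distr) auto
  then show "real_distribution ?\<mu>"
    by (intro real_distribution.intro real_distribution_axioms.intro) auto
  show "AE x in ?\<mu>. x \<in> {0..1}"
    using Y by (subst AE_distr_iff) auto
  show "(\<integral>x. f x \<partial>?\<mu>) = (\<integral>\<omega>. V \<omega> * f (exp (- Y \<omega>)) \<partial>P) / c"
    if [measurable]: "f \<in> borel_measurable borel" for f :: "real \<Rightarrow> real"
    using V(1) c(2) by (subst integral_distr) (auto simp: integral_density)
qed

text \<open>Integer arguments suffice because \<open>exp (- n * X)\<close> is the
  \<open>n\<close>-th power of a variable in the unit interval. The weight will carry all other
  coordinates while one of them is being treated.\<close>

lemma weighted_laplace_unique:
  fixes W X :: "'a \<Rightarrow> real" and W' X' :: "'b \<Rightarrow> real"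
  assumes "finite_measure M" "finite_measure N"
    and [measurable]: "W \<in> borel_measurable M" "X \<in> borel_measurable M"
      "W' \<in> borel_measurable N" "X' \<in> borel_measurable N" "S \<in> sets borel"
    and W: "\<And>\<omega>. 0 \<le> W \<omega>" "\<And>\<omega>. W \<omega> \<le> 1" and W': "\<And>\<omega>. 0 \<le> W' \<omega>" "\<And>\<omega>. W' \<omega> \<le> 1"
    and X: "\<And>\<omega>. 0 \<le> X \<omega>" and X': "\<And>\<omega>. 0 \<le> X' \<omega>"
    and eq: "\<And>n::nat. (\<integral>\<omega>. W \<omega> * exp (- (n * X \<omega>)) \<partial>M) = (\<integral>\<omega>. W' \<omega> * exp (- (n * X' \<omega>)) \<partial>N)"
  shows "(\<integral>\<omega>. W \<omega> * indicator S (X \<omega>) \<partial>M) = (\<integral>\<omega>. W' \<omega> * indicator S (X' \<omega>) \<partial>N)"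
proof -
  interpret M: finite_measure M by fact
  interpret N: finite_measure N by fact
  define c where "c = (\<integral>\<omega>. W \<omega> \<partial>M)"
  have c': "c = (\<integral>\<omega>. W' \<omega> \<partial>N)" using eq[of 0] by (simp add: c_def)
  have intW: "integrable M W" "integrable N W'"
    using W W' by (auto intro!: M.integrable_const_bound[of _ 1] N.integrable_const_bound[of _ 1])
  have c0: "0 \<le> c" unfolding c_def using W by simp
  show ?thesis
  proof (cases "c = 0")
    case True
    \<comment> \<open>Without mass there is no law to normalise, but then both weights vanish almost
      everywhere.\<close>
    have "AE \<omega> in M. W \<omega> = 0" "AE \<omega> in N. W' \<omega> = 0"
      using integral_nonneg_eq_0_iff_AE[OF intW(1)] integral_nonneg_eq_0_iff_AE[OF intW(2)] W W' True c'
      by (auto simp: c_def)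
    then have "(\<integral>\<omega>. W \<omega> * indicator S (X \<omega>) \<partial>M) = 0" "(\<integral>\<omega>. W' \<omega> * indicator S (X' \<omega>) \<partial>N) = 0"
      by (auto intro!: integral_eq_zero_AE)
    then show ?thesis by simp
  next
    case False
    with c0 have c: "0 < c" by simp
    obtain \<mu> where \<mu>: "real_distribution \<mu>" "AE x in \<mu>. x \<in> {0..1}"
      "\<And>f. f \<in> borel_measurable borel \<Longrightarrow> (\<integral>x. f x \<partial>\<mu>) = (\<integral>\<omega>. W \<omega> * f (exp (- X \<omega>)) \<partial>M) / c"
      using weighted_exp_law[OF \<open>W \<in> borel_measurable M\<close> \<open>X \<in> borel_measurable M\<close> W(1) intW(1) X c_def c] by blast
    obtain \<nu> where \<nu>: "real_distribution \<nu>" "AE x in \<nu>. x \<in> {0..1}"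
      "\<And>f. f \<in> borel_measurable borel \<Longrightarrow> (\<integral>x. f x \<partial>\<nu>) = (\<integral>\<omega>. W' \<omega> * f (exp (- X' \<omega>)) \<partial>N) / c"
      using weighted_exp_law[OF \<open>W' \<in> borel_measurable N\<close> \<open>X' \<in> borel_measurable N\<close> W'(1) intW(2) X' c' c] by blast
    have eq\<mu>: "\<mu> = \<nu>"
    proof (rule real_distribution_eqI_moments[OF \<mu>(1) \<nu>(1) \<mu>(2) \<nu>(2)])
      fix n :: nat
      have "exp (- y) ^ n = exp (- (n * y))" for y :: real
        by (simp flip: exp_of_nat_mult)
      then show "(\<integral>x. x ^ n \<partial>\<mu>) = (\<integral>x. x ^ n \<partial>\<nu>)"
        using eq[of n] by (simp add: \<mu>(3) \<nu>(3))
    qed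
    \<comment> \<open>\<open>- ln\<close> undoes \<open>exp (- X)\<close>, so the indicator of
      \<open>S\<close> is a test function for the two equal laws.\<close>
    have "(\<integral>x. indicator S (- ln x) \<partial>\<mu>) = (\<integral>\<omega>. W \<omega> * indicator S (X \<omega>) \<partial>M) / c"
      by (subst \<mu>(3)) auto
    moreover have "(\<integral>x. indicator S (- ln x) \<partial>\<nu>) = (\<integral>\<omega>. W' \<omega> * indicator S (X' \<omega>) \<partial>N) / c"
      by (subst \<nu>(3)) auto
    ultimately show ?thesis using eq\<mu> c by simp
  qed
qed

text \<open>Coordinates are moved one at a time from the exponential to the indicators, with the
  untouched factors as weight \<open>V\<close>. The induction must leave \<theta> free, because the
  moving coordinate is tested with every integer coefficient.\<close>

lemma laplace_unique_indicator:
  fixes A :: "'i \<Rightarrow> 'a \<Rightarrow> real" and B :: "'i \<Rightarrow> 'b \<Rightarrow> real"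
  assumes "finite_measure M" "finite_measure N" "finite J"
    and meas: "\<And>j. j \<in> J \<Longrightarrow> A j \<in> borel_measurable M" "\<And>j. j \<in> J \<Longrightarrow> B j \<in> borel_measurable N"
    and nonneg: "\<And>j \<omega>. 0 \<le> A j \<omega>" "\<And>j \<omega>. 0 \<le> B j \<omega>"
    and eq: "\<And>\<theta>. (\<And>j. 0 \<le> \<theta> j) \<Longrightarrow>
      (\<integral>\<omega>. exp (- (\<Sum>j\<in>J. \<theta> j * A j \<omega>)) \<partial>M) = (\<integral>\<omega>. exp (- (\<Sum>j\<in>J. \<theta> j * B j \<omega>)) \<partial>N)"
    and S: "\<And>j. j \<in> J \<Longrightarrow> S j \<in> sets borel"
  shows "(\<integral>\<omega>. (\<Prod>j\<in>J. indicator (S j) (A j \<omega>)) \<partial>M) = (\<integral>\<omega>. (\<Prod>j\<in>J. indicator (S j) (B j \<omega>)) \<partial>N :: real)"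
proof -
  define W where "W K \<theta> Y = (\<Prod>j\<in>K. indicator (S j) (Y j)) * exp (- (\<Sum>j\<in>J - K. \<theta> j * Y j))"
    for K and \<theta> Y :: "'i \<Rightarrow> real"
  have "(\<integral>\<omega>. W K \<theta> (\<lambda>j. A j \<omega>) \<partial>M) = (\<integral>\<omega>. W K \<theta> (\<lambda>j. B j \<omega>) \<partial>N)"
    if "K \<subseteq> J" "\<And>j. 0 \<le> \<theta> j" for K \<theta>
    using finite_subset[OF that(1) \<open>finite J\<close>] that
  proof (induction K arbitrary: \<theta> rule: finite_induct)
    case empty
    then show ?case using eq[of \<theta>] by (simp add: W_def)
  next
    case (insert l K)
    define V where "V Y = (\<Prod>j\<in>K. indicator (S j) (Y j)) * exp (- (\<Sum>j\<in>J - insert l K. \<theta> j * Y j))"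
      for Y :: "'i \<Rightarrow> real"
    have V01: "0 \<le> V Y" "V Y \<le> 1" if "\<And>j. 0 \<le> Y j" for Y
    proof -
      show "0 \<le> V Y" unfolding V_def by (intro mult_nonneg_nonneg prod_nonneg) auto
      have "(\<Prod>j\<in>K. indicator (S j) (Y j)) * exp (- (\<Sum>j\<in>J - insert l K. \<theta> j * Y j)) \<le> 1 * (1::real)"
        using that insert.prems by (intro mult_mono prod_le_1 prod_nonneg) (auto simp: indicator_def intro!: sum_nonneg)
      then show "V Y \<le> 1" by (simp add: V_def)
    qed
    have IA: "j \<in> J \<Longrightarrow> (\<lambda>\<omega>. indicator (S j) (A j \<omega>) :: real) \<in> borel_measurable M" for j
      by (rule measurable_compose[OF meas(1) borel_measurable_indicator[OF S]])
    have IB: "j \<in> J \<Longrightarrow> (\<lambda>\<omega>. indicator (S j) (B j \<omega>) :: real) \<in> borel_measurable N" for j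
      by (rule measurable_compose[OF meas(2) borel_measurable_indicator[OF S]])
    have VA [measurable]: "(\<lambda>\<omega>. V (\<lambda>j. A j \<omega>)) \<in> borel_measurable M"
    proof -
      have "(\<lambda>\<omega>. \<Prod>j\<in>K. indicator (S j) (A j \<omega>) :: real) \<in> borel_measurable M"
        using insert.prems by (intro borel_measurable_prod IA) auto
      moreover have "(\<lambda>\<omega>. \<Sum>j\<in>J - insert l K. \<theta> j * A j \<omega>) \<in> borel_measurable M"
        by (intro borel_measurable_sum borel_measurable_times borel_measurable_const meas(1)) auto
      ultimately show ?thesis unfolding V_def
        by (rule borel_measurable_times[OF _ measurable_compose[OF borel_measurable_uminus borel_measurable_exp]])
    qed
    have VB [measurable]: "(\<lambda>\<omega>. V (\<lambda>j. B j \<omega>)) \<in> borel_measurable N"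
    proof -
      have "(\<lambda>\<omega>. \<Prod>j\<in>K. indicator (S j) (B j \<omega>) :: real) \<in> borel_measurable N"
        using insert.prems by (intro borel_measurable_prod IB) auto
      moreover have "(\<lambda>\<omega>. \<Sum>j\<in>J - insert l K. \<theta> j * B j \<omega>) \<in> borel_measurable N"
        by (intro borel_measurable_sum borel_measurable_times borel_measurable_const meas(2)) auto
      ultimately show ?thesis unfolding V_def
        by (rule borel_measurable_times[OF _ measurable_compose[OF borel_measurable_uminus borel_measurable_exp]])
    qed
    have Vexp: "V Y * exp (- (real n * Y l)) = W K (\<theta>(l := real n)) Y" for Y n
    proof -
      have *: "J - K - {l} = J - insert l K" by auto
      have "(\<Sum>j\<in>J - K. (\<theta>(l := real n)) j * Y j)
        = real n * Y l + (\<Sum>j\<in>J - insert l K. (\<theta>(l := real n)) j * Y j)"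
        using sum.remove[of "J - K" l "\<lambda>j. (\<theta>(l := real n)) j * Y j"] \<open>finite J\<close> insert.hyps insert.prems
        unfolding * by simp
      also have "(\<Sum>j\<in>J - insert l K. (\<theta>(l := real n)) j * Y j) = (\<Sum>j\<in>J - insert l K. \<theta> j * Y j)"
        by (intro sum.cong) auto
      finally show ?thesis by (simp add: V_def W_def exp_add[symmetric] mult.assoc)
    qed
    have Vind: "V Y * indicator (S l) (Y l) = W (insert l K) \<theta> Y" for Y
      using insert.hyps by (simp add: V_def W_def)
    have "(\<integral>\<omega>. V (\<lambda>j. A j \<omega>) * indicator (S l) (A l \<omega>) \<partial>M) = (\<integral>\<omega>. V (\<lambda>j. B j \<omega>) * indicator (S l) (B l \<omega>) \<partial>N)"
    proof (rule weighted_laplace_unique[OF \<open>finite_measure M\<close> \<open>finite_measure N\<close> VA _ VB])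
      fix n :: nat
      show "(\<integral>\<omega>. V (\<lambda>j. A j \<omega>) * exp (- (real n * A l \<omega>)) \<partial>M) = (\<integral>\<omega>. V (\<lambda>j. B j \<omega>) * exp (- (real n * B l \<omega>)) \<partial>N)"
      proof -
        have "V (\<lambda>j. A j \<omega>) * exp (- (real n * A l \<omega>)) = W K (\<theta>(l := real n)) (\<lambda>j. A j \<omega>)" for \<omega>
          by (rule Vexp)
        moreover have "V (\<lambda>j. B j \<omega>) * exp (- (real n * B l \<omega>)) = W K (\<theta>(l := real n)) (\<lambda>j. B j \<omega>)" for \<omega>
          by (rule Vexp)
        moreover have "(\<integral>\<omega>. W K (\<theta>(l := real n)) (\<lambda>j. A j \<omega>) \<partial>M) = (\<integral>\<omega>. W K (\<theta>(l := real n)) (\<lambda>j. B j \<omega>) \<partial>N)"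
          using insert.prems by (intro insert.IH) auto
        ultimately show ?thesis by (simp only:)
      qed
    qed (use nonneg V01 meas S insert.prems in auto)
    moreover have "V (\<lambda>j. A j \<omega>) * indicator (S l) (A l \<omega>) = W (insert l K) \<theta> (\<lambda>j. A j \<omega>)" for \<omega>
      by (rule Vind)
    moreover have "V (\<lambda>j. B j \<omega>) * indicator (S l) (B l \<omega>) = W (insert l K) \<theta> (\<lambda>j. B j \<omega>)" for \<omega>
      by (rule Vind)
    ultimately show ?case by simp
  qed
  from this[of J "\<lambda>_. 0"] show ?thesis by (simp add: W_def)
qed

lemma (in prob_space) prob_eq_integral_prod_indicator:
  assumes "finite J" "\<And>j. j \<in> J \<Longrightarrow> A j \<in> borel_measurable M" "\<And>j. j \<in> J \<Longrightarrow> S j \<in> sets borel"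
  shows "prob {\<omega>\<in>space M. \<forall>j\<in>J. A j \<omega> \<in> S j} = (\<integral>\<omega>. (\<Prod>j\<in>J. indicator (S j) (A j \<omega>)) \<partial>M)"
proof -
  have "(\<integral>\<omega>. (\<Prod>j\<in>J. indicator (S j) (A j \<omega>)) \<partial>M) = (\<integral>\<omega>. indicator {\<omega>\<in>space M. \<forall>j\<in>J. A j \<omega> \<in> S j} \<omega> \<partial>M :: real)"
  proof (rule Bochner_Integration.integral_cong[OF refl])
    fix \<omega> assume "\<omega> \<in> space M"
    then show "(\<Prod>j\<in>J. indicator (S j) (A j \<omega>)) = (indicator {\<omega>\<in>space M. \<forall>j\<in>J. A j \<omega> \<in> S j} \<omega> :: real)"
    proof (cases "\<forall>j\<in>J. A j \<omega> \<in> S j")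
      case False
      then obtain j where "j \<in> J" "A j \<omega> \<notin> S j" by blast
      then have "\<exists>j\<in>J. indicator (S j) (A j \<omega>) = (0::real)" by (intro bexI[of _ j]) auto
      from prod_zero[OF \<open>finite J\<close> this] False show ?thesis by simp
    qed auto
  qed
  also have "\<dots> = prob {\<omega>\<in>space M. \<forall>j\<in>J. A j \<omega> \<in> S j}"
    by (simp add: Int_absorb2 subset_eq)
  finally show ?thesis by simp
qed

lemma laplace_unique:
  fixes A :: "'i \<Rightarrow> 'a \<Rightarrow> real" and B :: "'i \<Rightarrow> 'b \<Rightarrow> real"
  assumes M: "prob_space M" and N: "prob_space N" and "finite J"
    and meas: "\<And>j. j \<in> J \<Longrightarrow> A j \<in> borel_measurable M" "\<And>j. j \<in> J \<Longrightarrow> B j \<in> borel_measurable N"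
    and nonneg: "\<And>j \<omega>. 0 \<le> A j \<omega>" "\<And>j \<omega>. 0 \<le> B j \<omega>"
    and eq: "\<And>\<theta>. (\<And>j. 0 \<le> \<theta> j) \<Longrightarrow>
      (\<integral>\<omega>. exp (- (\<Sum>j\<in>J. \<theta> j * A j \<omega>)) \<partial>M) = (\<integral>\<omega>. exp (- (\<Sum>j\<in>J. \<theta> j * B j \<omega>)) \<partial>N)"
  shows "distr M (Pi\<^sub>M J (\<lambda>_. borel)) (\<lambda>\<omega>. \<lambda>j\<in>J. A j \<omega>) = distr N (Pi\<^sub>M J (\<lambda>_. borel)) (\<lambda>\<omega>. \<lambda>j\<in>J. B j \<omega>)"
proof (rule measure_eqI_PiM_finite[OF \<open>finite J\<close>])
  interpret M: prob_space M by fact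
  interpret N: prob_space N by fact
  have [measurable]: "(\<lambda>\<omega>. \<lambda>j\<in>J. A j \<omega>) \<in> M \<rightarrow>\<^sub>M Pi\<^sub>M J (\<lambda>_. borel)" "(\<lambda>\<omega>. \<lambda>j\<in>J. B j \<omega>) \<in> N \<rightarrow>\<^sub>M Pi\<^sub>M J (\<lambda>_. borel)"
    by (intro measurable_restrict meas; assumption)+
  let ?P = "distr M (Pi\<^sub>M J (\<lambda>_. borel)) (\<lambda>\<omega>. \<lambda>j\<in>J. A j \<omega>)"
  let ?Q = "distr N (Pi\<^sub>M J (\<lambda>_. borel)) (\<lambda>\<omega>. \<lambda>j\<in>J. B j \<omega>)"
  show "?P (Pi\<^sub>E J S) = ?Q (Pi\<^sub>E J S)" if S: "\<And>i. i \<in> J \<Longrightarrow> S i \<in> sets borel" for S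
  proof -
    have "Pi\<^sub>E J S \<in> sets (Pi\<^sub>M J (\<lambda>_. borel))" using S \<open>finite J\<close> by (intro sets_PiM_I_finite) auto
    then have "?P (Pi\<^sub>E J S) = M.prob {\<omega>\<in>space M. \<forall>j\<in>J. A j \<omega> \<in> S j}"
      "?Q (Pi\<^sub>E J S) = N.prob {\<omega>\<in>space N. \<forall>j\<in>J. B j \<omega> \<in> S j}"
      by (auto simp: emeasure_distr M.emeasure_eq_measure N.emeasure_eq_measure PiE_iff
          intro!: arg_cong[where f="measure _"])
    moreover have "M.prob {\<omega>\<in>space M. \<forall>j\<in>J. A j \<omega> \<in> S j} = N.prob {\<omega>\<in>space N. \<forall>j\<in>J. B j \<omega> \<in> S j}"
      using laplace_unique_indicator[OF M.finite_measure_axioms N.finite_measure_axioms \<open>finite J\<close> meas nonneg eq S]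
      by (simp add: M.prob_eq_integral_prod_indicator N.prob_eq_integral_prod_indicator \<open>finite J\<close> meas S)
    ultimately show ?thesis by simp
  qed
  show "range (\<lambda>_::nat. \<Pi>\<^sub>E j\<in>J. UNIV) \<subseteq> prod_algebra J (\<lambda>_. borel :: real measure)"
    using \<open>finite J\<close> by (auto intro!: prod_algebraI_finite)
  show "?P ((\<lambda>_::nat. \<Pi>\<^sub>E j\<in>J. UNIV) i) \<noteq> \<infinity>" for i
    using M.prob_space_distr[of "\<lambda>\<omega>. \<lambda>j\<in>J. A j \<omega>" "Pi\<^sub>M J (\<lambda>_. borel)"]
    by (simp add: prob_space_def finite_measure.emeasure_finite)
qed (auto simp: space_PiM)

text \<open>The family is compared with its independent copy on a product space. There the transform
  factors by Fubini, so uniqueness of transforms yields the product formula for rectangles.\<close>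

lemma (in prob_space) indep_vars_laplaceI:
  fixes A :: "'i \<Rightarrow> 'a \<Rightarrow> real"
  assumes "finite J" and meas: "\<And>j. j \<in> J \<Longrightarrow> A j \<in> borel_measurable M"
    and nonneg: "\<And>j \<omega>. 0 \<le> A j \<omega>"
    and eq: "\<And>\<theta>. (\<And>j. 0 \<le> \<theta> j) \<Longrightarrow>
      (\<integral>\<omega>. exp (- (\<Sum>j\<in>J. \<theta> j * A j \<omega>)) \<partial>M) = (\<Prod>j\<in>J. \<integral>\<omega>. exp (- (\<theta> j * A j \<omega>)) \<partial>M)"
  shows "indep_vars (\<lambda>_. borel) A J"
proof -
  interpret P: product_sigma_finite "\<lambda>_::'i. M" by standard
  let ?N = "Pi\<^sub>M J (\<lambda>_. M)"
  have N: "prob_space ?N" by (intro prob_space_PiM) unfold_locales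
  have rect: "prob {\<omega>\<in>space M. \<forall>j\<in>J. A j \<omega> \<in> S j} = (\<Prod>j\<in>J. prob {\<omega>\<in>space M. A j \<omega> \<in> S j})"
    if S: "\<And>j. j \<in> J \<Longrightarrow> S j \<in> sets borel" for S
  proof -
    have "(\<integral>\<omega>. (\<Prod>j\<in>J. indicator (S j) (A j \<omega>)) \<partial>M) = (\<integral>\<omega>. (\<Prod>j\<in>J. indicator (S j) (A j (\<omega> j))) \<partial>?N :: real)"
    proof (rule laplace_unique_indicator[where B = "\<lambda>j \<omega>. A j (\<omega> j)"])
      show "finite_measure ?N" using N by (simp add: prob_space_def)
      show "(\<lambda>\<omega>. A j (\<omega> j)) \<in> borel_measurable ?N" if "j \<in> J" for j
        using meas[OF that] that by (rule_tac measurable_compose[OF measurable_component_singleton])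
      fix \<theta> :: "'i \<Rightarrow> real" assume \<theta>: "\<And>j. 0 \<le> \<theta> j"
      have "(\<integral>\<omega>. exp (- (\<Sum>j\<in>J. \<theta> j * A j (\<omega> j))) \<partial>?N) = (\<integral>\<omega>. (\<Prod>j\<in>J. exp (- (\<theta> j * A j (\<omega> j)))) \<partial>?N)"
        by (simp add: exp_sum[OF \<open>finite J\<close>] flip: sum_negf)
      also have "\<dots> = (\<Prod>j\<in>J. \<integral>\<omega>. exp (- (\<theta> j * A j \<omega>)) \<partial>M)"
        using meas \<theta> nonneg by (intro P.product_integral_prod[OF \<open>finite J\<close>] integrable_const_bound[of _ 1]) auto
      finally show "(\<integral>\<omega>. exp (- (\<Sum>j\<in>J. \<theta> j * A j \<omega>)) \<partial>M) = (\<integral>\<omega>. exp (- (\<Sum>j\<in>J. \<theta> j * A j (\<omega> j))) \<partial>?N)"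
        using eq[OF \<theta>] by simp
    qed (use assms S finite_measure_axioms in auto)
    also have "\<dots> = (\<Prod>j\<in>J. \<integral>\<omega>. indicator (S j) (A j \<omega>) \<partial>M)"
      using meas S by (intro P.product_integral_prod[OF \<open>finite J\<close>] integrable_const_bound[of _ 1])
        (auto intro!: measurable_compose[OF _ borel_measurable_indicator] simp: indicator_def)
    also have "\<dots> = (\<Prod>j\<in>J. prob {\<omega>\<in>space M. A j \<omega> \<in> S j})"
    proof (rule prod.cong[OF refl])
      fix j assume "j \<in> J"
      then show "(\<integral>\<omega>. indicator (S j) (A j \<omega>) \<partial>M) = prob {\<omega>\<in>space M. A j \<omega> \<in> S j}"
        using prob_eq_integral_prod_indicator[of "{j}" A S] meas S by simp
    qed
    finally show ?thesis
      using prob_eq_integral_prod_indicator[OF \<open>finite J\<close> meas S] by simp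
  qed
  show ?thesis
    unfolding indep_vars_def2 indep_sets_def
  proof (intro conjI ballI allI impI subsetI)
    fix j E assume "j \<in> J" "E \<in> {A j -` S \<inter> space M |S. S \<in> sets borel}"
    then show "E \<in> events" using meas by (auto intro: measurable_sets)
  next
    fix K E assume K: "K \<subseteq> J" "K \<noteq> {}" "finite K"
      and E: "E \<in> (\<Pi> i\<in>K. {A i -` S \<inter> space M |S. S \<in> sets borel})"
    then have "\<forall>i\<in>K. \<exists>S. S \<in> sets borel \<and> E i = A i -` S \<inter> space M" by (fastforce simp: Pi_iff)
    then obtain S where S: "\<And>i. i \<in> K \<Longrightarrow> S i \<in> sets borel" "\<And>i. i \<in> K \<Longrightarrow> E i = A i -` S i \<inter> space M"
      by metis
    \<comment> \<open>Trivial conditions outside \<open>K\<close> extend the sub-family to the full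
      rectangle over \<open>J\<close>.\<close>
    define S' where "S' j = (if j \<in> K then S j else UNIV)" for j
    have "prob (\<Inter>j\<in>K. E j) = prob {\<omega>\<in>space M. \<forall>j\<in>J. A j \<omega> \<in> S' j}"
      using K S(2) by (intro arg_cong[where f=prob]) (auto simp: S'_def)
    also have "\<dots> = (\<Prod>j\<in>J. prob {\<omega>\<in>space M. A j \<omega> \<in> S' j})"
      by (rule rect) (use S(1) in \<open>auto simp: S'_def\<close>)
    also have "\<dots> = (\<Prod>j\<in>K. prob {\<omega>\<in>space M. A j \<omega> \<in> S' j})"
      using K \<open>finite J\<close> by (intro prod.mono_neutral_right) (auto simp: S'_def prob_space)
    also have "\<dots> = (\<Prod>j\<in>K. prob (E j))"
      using S(2) by (intro prod.cong refl arg_cong[where f=prob]) (auto simp: S'_def)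
    finally show "prob (\<Inter>j\<in>K. E j) = (\<Prod>j\<in>K. prob (E j))" .
  qed (use meas in auto)
qed

section \<open>Marked Poisson processes\<close>

text \<open>Sums over all integers are limits of symmetric finite sums, to which the independence of
  finitely many blocks applies.\<close>

lemma nn_integral_count_space_int:
  fixes f :: "int \<Rightarrow> ennreal"
  shows "(\<integral>\<^sup>+m. f m \<partial>count_space UNIV) = (SUP n. \<Sum>m\<in>{- int n..int n}. f m)"
    and "(\<lambda>n. \<Sum>m\<in>{- int n..int n}. f m) \<longlonglongrightarrow> (\<integral>\<^sup>+m. f m \<partial>count_space UNIV)"
proof -
  have inc: "incseq (\<lambda>n m. f m * indicator {- int n..int n} m)"
    by (auto simp: incseq_def le_fun_def indicator_def)
  have fin: "(\<integral>\<^sup>+m. f m * indicator {- int n..int n} m \<partial>count_space UNIV) = (\<Sum>m\<in>{- int n..int n}. f m)" for n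
    by (subst nn_integral_count_space'[of "{- int n..int n}"]) auto
  have f: "f m = (SUP n. f m * indicator {- int n..int n} m)" for m
  proof (rule antisym)
    show "f m \<le> (SUP n. f m * indicator {- int n..int n} m)"
      by (rule SUP_upper2[of "nat \<bar>m\<bar>"]) (auto simp: indicator_def)
  qed (auto intro!: SUP_least simp: indicator_def)
  have "(\<integral>\<^sup>+m. f m \<partial>count_space UNIV) = (\<integral>\<^sup>+m. (SUP n. f m * indicator {- int n..int n} m) \<partial>count_space UNIV)"
    using f by simp
  also have "\<dots> = (SUP n. \<integral>\<^sup>+m. f m * indicator {- int n..int n} m \<partial>count_space UNIV)"
    by (rule nn_integral_monotone_convergence_SUP[OF inc]) simp
  finally show 1: "(\<integral>\<^sup>+m. f m \<partial>count_space UNIV) = (SUP n. \<Sum>m\<in>{- int n..int n}. f m)"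
    by (simp only: fin)
  show "(\<lambda>n. \<Sum>m\<in>{- int n..int n}. f m) \<longlonglongrightarrow> (\<integral>\<^sup>+m. f m \<partial>count_space UNIV)"
    unfolding 1 by (intro LIMSEQ_SUP incseq_SucI sum_mono2) auto
qed

text \<open>The continuous extension of \<open>exp (- a)\<close> by \<open>0\<close> at infinity:
  the Laplace functional can then be stated before any sum is known to converge.\<close>

definition eexp :: "ennreal \<Rightarrow> real" where
  "eexp a = (if a = \<top> then 0 else exp (- enn2real a))"

lemma eexp_bounds: "0 \<le> eexp a" "eexp a \<le> 1"
  by (auto simp: eexp_def)

lemma eexp_ennreal: "0 \<le> x \<Longrightarrow> eexp (ennreal x) = exp (- x)"
  by (simp add: eexp_def)

lemma eexp_measurable [measurable]: "eexp \<in> borel_measurable borel"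
  unfolding eexp_def by measurable

lemma eexp_add: "eexp (a + b) = eexp a * eexp b"
  by (cases a; cases b) (auto simp: eexp_def exp_add[symmetric] simp flip: ennreal_plus)

lemma eexp_sum: "finite I \<Longrightarrow> eexp (\<Sum>i\<in>I. f i) = (\<Prod>i\<in>I. eexp (f i))"
  by (induction I rule: finite_induct) (auto simp: eexp_add, simp add: eexp_def)

lemma tendsto_eexp:
  assumes "(u \<longlongrightarrow> a) F"
  shows "((\<lambda>n. eexp (u n)) \<longlongrightarrow> eexp a) F"
proof (cases a)
  case (real x)
  have "((\<lambda>n. enn2real (u n)) \<longlongrightarrow> x) F"
    using assms real(1) unfolding real(2) by (rule tendsto_enn2real)
  then have "((\<lambda>n. exp (- enn2real (u n))) \<longlongrightarrow> exp (- x)) F"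
    by (intro tendsto_exp tendsto_minus)
  moreover have "\<forall>\<^sub>F n in F. u n < \<top>"
    using assms real by (intro order_tendstoD(2)) auto
  then have "\<forall>\<^sub>F n in F. exp (- enn2real (u n)) = eexp (u n)"
    by eventually_elim (auto simp: eexp_def)
  ultimately show ?thesis
    using real by (auto simp: eexp_ennreal intro: Lim_transform_eventually)
next
  case top
  show ?thesis
  proof (rule tendstoI)
    fix e :: real assume "0 < e"
    define K where "K = max 0 (- ln e)"
    have "\<forall>\<^sub>F n in F. ennreal K < u n"
      using assms top by (intro order_tendstoD(1)) auto
    then show "\<forall>\<^sub>F n in F. dist (eexp (u n)) (eexp a) < e"
    proof eventually_elim
      case (elim n)
      have "eexp (u n) < e"
      proof (cases "u n")
        case (real x)
        have "0 \<le> K" by (simp add: K_def)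
        then have "K < x" using elim real by (simp add: ennreal_less_iff)
        then have "- x < ln e" by (simp add: K_def)
        then have "exp (- x) < e" using \<open>0 < e\<close> by (metis exp_less_cancel_iff exp_ln)
        then show ?thesis using real by (simp add: eexp_ennreal)
      qed (use \<open>0 < e\<close> in \<open>simp add: eexp_def\<close>)
      then show ?case using top eexp_bounds(1)[of "u n"] by (simp add: eexp_def)
    qed
  qed
qed

lemma frac_measurable [measurable]: "(frac :: real \<Rightarrow> real) \<in> borel_measurable borel"
  unfolding frac_def by measurable

type_synonym block = "nat \<times> (nat \<Rightarrow> real \<times> real)"
type_synonym sample = "int \<Rightarrow> block"

text \<open>A marked Poisson process of unit intensity on the real line: over each interval
  \<open>[m, m + 1)\<close> a Poisson number of points, uniformly distributed and carrying marks of law \<open>\<pi>\<close>.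
  A sample of one such interval is a number of points together with an infinite supply of pairs
  (position, mark), only the first ones of which are used. Positions enter through \<^const>\<open>frac\<close>,
  which makes them lie in \<open>[0, 1)\<close> surely and not just almost surely.\<close>

locale marked_poisson =
  fixes \<pi> :: "real measure"
  assumes prob_space_mark: "prob_space \<pi>" and sets_mark [measurable_cong]: "sets \<pi> = sets borel"
begin

definition unif :: "real measure" where
  "unif = uniform_measure lborel {0..<1}"

definition pnt :: "(real \<times> real) measure" where
  "pnt = unif \<Otimes>\<^sub>M \<pi>"

definition pnts :: "(nat \<Rightarrow> real \<times> real) measure" where
  "pnts = Pi\<^sub>M UNIV (\<lambda>_. pnt)"

definition blk :: "block measure" where
  "blk = measure_pmf (poisson_pmf 1) \<Otimes>\<^sub>M pnts"

definition \<Omega> :: "sample measure" where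
  "\<Omega> = Pi\<^sub>M UNIV (\<lambda>_. blk)"

text \<open>The absolute value lets a mark law on the whole line be used without an almost sure sign
  condition.\<close>

definition bsum :: "(real \<Rightarrow> real \<Rightarrow> real) \<Rightarrow> int \<Rightarrow> block \<Rightarrow> real" where
  "bsum F m b = (\<Sum>i<fst b. F (real_of_int m + frac (fst (snd b i))) \<bar>snd (snd b i)\<bar>)"

definition psum :: "(real \<Rightarrow> real \<Rightarrow> real) \<Rightarrow> sample \<Rightarrow> ennreal" where
  "psum F \<omega> = (\<integral>\<^sup>+m. ennreal (bsum F m (\<omega> m)) \<partial>count_space UNIV)"

text \<open>The exponent in Campbell's formula for the intensity Lebesgue measure times
  \<pi>.\<close>

definition lap_exponent :: "(real \<Rightarrow> real \<Rightarrow> real) \<Rightarrow> ennreal" where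
  "lap_exponent F = (\<integral>\<^sup>+T. \<integral>\<^sup>+r. ennreal (1 - exp (- F T \<bar>r\<bar>)) \<partial>\<pi> \<partial>lborel)"

section \<open>The sample space of the marked Poisson process\<close>

lemma sets_unif [measurable_cong]: "sets unif = sets borel"
  by (simp add: unif_def)

lemma sets_pnt [measurable_cong]: "sets pnt = sets (borel \<Otimes>\<^sub>M borel)"
  unfolding pnt_def by (intro sets_pair_measure_cong sets_unif sets_mark)

lemma sets_pnts [measurable_cong]: "sets pnts = sets (Pi\<^sub>M UNIV (\<lambda>_. borel \<Otimes>\<^sub>M borel))"
  unfolding pnts_def by (intro sets_PiM_cong sets_pnt refl)

lemma sets_blk [measurable_cong]: "sets blk = sets (count_space UNIV \<Otimes>\<^sub>M Pi\<^sub>M UNIV (\<lambda>_. borel \<Otimes>\<^sub>M borel))"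
  unfolding blk_def by (intro sets_pair_measure_cong sets_pnts) simp

lemma prob_space_unif: "prob_space unif"
  unfolding unif_def by (rule prob_space_uniform_measure) auto

sublocale unif: prob_space unif by (rule prob_space_unif)
sublocale mark: prob_space \<pi> by (rule prob_space_mark)
sublocale um: pair_prob_space unif \<pi> ..

lemma prob_space_pnt: "prob_space pnt"
  unfolding pnt_def by (rule um.prob_space_axioms)

sublocale pnt: prob_space pnt by (rule prob_space_pnt)
sublocale pnts: product_prob_space "\<lambda>_::nat. pnt" UNIV ..

lemma prob_space_pnts: "prob_space pnts"
  unfolding pnts_def by (rule pnts.prob_space_axioms)

sublocale pnts': prob_space pnts by (rule prob_space_pnts)
sublocale pp: pair_prob_space "measure_pmf (poisson_pmf 1)" pnts ..

lemma prob_space_blk: "prob_space blk"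
  unfolding blk_def by (rule pp.prob_space_axioms)

sublocale blk: prob_space blk by (rule prob_space_blk)
sublocale blks: product_prob_space "\<lambda>_::int. blk" UNIV ..

lemma prob_space_\<Omega>: "prob_space \<Omega>"
  unfolding \<Omega>_def by (rule blks.prob_space_axioms)

sublocale \<Omega>: prob_space \<Omega> by (rule prob_space_\<Omega>)

lemma component_measurable [measurable]: "(\<lambda>\<omega>. \<omega> m) \<in> \<Omega> \<rightarrow>\<^sub>M blk"
  unfolding \<Omega>_def by (rule measurable_component_singleton) simp

lemma space_\<Omega> [simp]: "space \<Omega> = UNIV" "space blk = UNIV" "space pnts = UNIV"
  by (auto simp: \<Omega>_def space_PiM blk_def space_pair_measure pnts_def sets_eq_imp_space_eq[OF sets_pnt]
      sets_eq_imp_space_eq[OF sets_blk] sets_eq_imp_space_eq[OF sets_pnts])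

lemma count_measurable [measurable]: "fst \<in> blk \<rightarrow>\<^sub>M count_space UNIV"
  by measurable

lemma point_measurable [measurable]: "(\<lambda>b. snd b i) \<in> blk \<rightarrow>\<^sub>M borel \<Otimes>\<^sub>M borel"
  by measurable

lemma sum_lessThan_measurable:
  fixes h :: "nat \<Rightarrow> 'b \<Rightarrow> 'c :: {second_countable_topology, topological_comm_monoid_add}"
  assumes "N \<in> M \<rightarrow>\<^sub>M count_space UNIV" "\<And>i. h i \<in> borel_measurable M"
  shows "(\<lambda>x. \<Sum>i<N x. h i x) \<in> borel_measurable M"
  by (rule measurable_compose_countable[OF _ assms(1)]) (use assms(2) in measurable)

lemma bsum_measurable:
  assumes [measurable]: "case_prod F \<in> borel_measurable (borel \<Otimes>\<^sub>M borel)"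
  shows "bsum F m \<in> borel_measurable blk"
  unfolding bsum_def by (intro sum_lessThan_measurable) measurable

lemma psum_measurable:
  assumes F: "case_prod F \<in> borel_measurable (borel \<Otimes>\<^sub>M borel)"
  shows "psum F \<in> borel_measurable \<Omega>"
  unfolding psum_def nn_integral_count_space_int(1)
  using bsum_measurable[OF F] by measurable

text \<open>Given \<open>n\<close> points the product has mean \<open>A ^ n\<close>, and
  \<open>exp (A - 1)\<close> is the generating function of the Poisson law. Factors below
  \<open>1\<close> give Laplace transforms, factors above \<open>1\<close> give moment
  bounds.\<close>

lemma nn_integral_blk_prod:
  assumes [measurable]: "h \<in> borel_measurable (borel \<Otimes>\<^sub>M borel)" and A: "(\<integral>\<^sup>+x. h x \<partial>pnt) = ennreal A" "0 \<le> A"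
  shows "(\<integral>\<^sup>+b. (\<Prod>i<fst b. h (snd b i)) \<partial>blk) = ennreal (exp (A - 1))"
proof -
  have prod_meas [measurable]: "(\<lambda>b. \<Prod>i<fst b. h (snd b i)) \<in> borel_measurable blk"
    by (rule measurable_compose_countable[OF _ count_measurable]) measurable
  have inner: "(\<integral>\<^sup>+p. (\<Prod>i<n. h (p i)) \<partial>pnts) = ennreal (A ^ n)" for n
  proof -
    have "(\<integral>\<^sup>+p. (\<Prod>i<n. h (p i)) \<partial>pnts) = (\<integral>\<^sup>+p. (\<Prod>i<n. h (restrict p {..<n} i)) \<partial>pnts)"
      by (intro nn_integral_cong prod.cong) auto
    also have "\<dots> = (\<integral>\<^sup>+p. (\<Prod>i<n. h (p i)) \<partial>distr pnts (Pi\<^sub>M {..<n} (\<lambda>_. pnt)) (\<lambda>p. restrict p {..<n}))"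
      unfolding pnts_def by (subst nn_integral_distr) (auto intro!: measurable_restrict)
    also have "\<dots> = (\<integral>\<^sup>+p. (\<Prod>i<n. h (p i)) \<partial>Pi\<^sub>M {..<n} (\<lambda>_. pnt))"
      unfolding pnts_def by (subst pnts.distr_PiM_restrict_finite) auto
    also have "\<dots> = (\<Prod>i<n. \<integral>\<^sup>+x. h x \<partial>pnt)"
      by (intro pnts.product_nn_integral_prod) auto
    also have "\<dots> = ennreal (A ^ n)"
      using A by (simp add: ennreal_power)
    finally show ?thesis .
  qed
  have "(\<integral>\<^sup>+b. (\<Prod>i<fst b. h (snd b i)) \<partial>blk)
     = (\<integral>\<^sup>+n. \<integral>\<^sup>+p. (\<Prod>i<n. h (p i)) \<partial>pnts \<partial>measure_pmf (poisson_pmf 1))"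
    using prod_meas unfolding blk_def by (subst pnts'.nn_integral_fst[symmetric]) auto
  also have "\<dots> = (\<integral>\<^sup>+n. ennreal (pmf (poisson_pmf 1) n) * ennreal (A ^ n) \<partial>count_space UNIV)"
    by (simp only: inner nn_integral_measure_pmf)
  also have "\<dots> = (\<Sum>n. ennreal (A ^ n / fact n * exp (- 1)))"
    using A by (simp add: nn_integral_count_space_nat ennreal_mult[symmetric] mult_ac)
  also have "\<dots> = ennreal (exp (A - 1))"
  proof (rule sums_unique[symmetric])
    have "(\<lambda>n. A ^ n / fact n * exp (- 1)) sums (exp A * exp (- 1))"
      using exp_converges[of A] by (intro sums_mult2) (simp add: field_simps)
    then show "(\<lambda>n. ennreal (A ^ n / fact n * exp (- 1))) sums ennreal (exp (A - 1))"
      using A by (subst sums_ennreal) (auto simp: exp_diff exp_minus field_simps)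
  qed
  finally show ?thesis .
qed

lemma nn_integral_blk_prod_finite:
  assumes "h \<in> borel_measurable (borel \<Otimes>\<^sub>M borel)" and "(\<integral>\<^sup>+x. h x \<partial>pnt) < \<infinity>"
  shows "(\<integral>\<^sup>+b. (\<Prod>i<fst b. h (snd b i)) \<partial>blk) < \<infinity>"
proof -
  obtain A where "(\<integral>\<^sup>+x. h x \<partial>pnt) = ennreal A" "0 \<le> A"
    using assms(2) by (cases "\<integral>\<^sup>+x. h x \<partial>pnt") auto
  from nn_integral_blk_prod[OF assms(1) this] show ?thesis by simp
qed

text \<open>With factors \<open>h = exp (- F)\<close> the exponent \<open>A - 1\<close> is minus the
  integral of \<open>1 - h\<close>, because \<open>pnt\<close> has total mass
  \<open>1\<close>.\<close>

lemma laplace_blk: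
  assumes [measurable]: "case_prod F \<in> borel_measurable (borel \<Otimes>\<^sub>M borel)" and F0: "\<And>T r. 0 \<le> F T r"
  shows "(\<integral>b. exp (- bsum F m b) \<partial>blk) = eexp (\<integral>\<^sup>+x. ennreal (1 - exp (- F (real_of_int m + frac (fst x)) \<bar>snd x\<bar>)) \<partial>pnt)"
proof -
  define h where "h x = exp (- F (real_of_int m + frac (fst x)) \<bar>snd x\<bar>)" for x :: "real \<times> real"
  have [measurable]: "h \<in> borel_measurable (borel \<Otimes>\<^sub>M borel)" unfolding h_def by measurable
  have h01: "0 \<le> h x" "h x \<le> 1" for x using F0 by (auto simp: h_def)
  have int: "integrable pnt h"
    using h01 by (intro pnt.integrable_const_bound[of _ 1]) auto
  define A where "A = (\<integral>x. h x \<partial>pnt)"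
  have A: "(\<integral>\<^sup>+x. ennreal (h x) \<partial>pnt) = ennreal A" "0 \<le> A"
    using h01 int by (auto simp: A_def nn_integral_eq_integral)
  have 1: "(\<integral>\<^sup>+x. ennreal (1 - h x) \<partial>pnt) = ennreal (1 - A)"
    using h01 int by (subst nn_integral_eq_integral) (auto simp: A_def pnt.prob_space)
  have A1: "A \<le> 1"
    unfolding A_def using integral_mono[OF int, of "\<lambda>_. 1"] h01 by (simp add: pnt.prob_space)
  have "exp (- bsum F m b) = (\<Prod>i<fst b. h (snd b i))" for b
    by (simp add: bsum_def h_def exp_sum flip: sum_negf)
  then have "(\<integral>b. exp (- bsum F m b) \<partial>blk) = (\<integral>b. (\<Prod>i<fst b. h (snd b i)) \<partial>blk)" by simp
  also have "\<dots> = enn2real (\<integral>\<^sup>+b. ennreal (\<Prod>i<fst b. h (snd b i)) \<partial>blk)"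
  proof (rule integral_eq_nn_integral)
    show "(\<lambda>b. \<Prod>i<fst b. h (snd b i)) \<in> borel_measurable blk"
      by (rule measurable_compose_countable[OF _ count_measurable]) measurable
    show "AE b in blk. 0 \<le> (\<Prod>i<fst b. h (snd b i))"
      by (intro AE_I2 prod_nonneg h01)
  qed
  also have "(\<lambda>b. ennreal (\<Prod>i<fst b. h (snd b i))) = (\<lambda>b::block. \<Prod>i<fst b. ennreal (h (snd b i)))"
    using h01 by (auto simp: prod_ennreal)
  also have "enn2real (\<integral>\<^sup>+b. (\<Prod>i<fst b. ennreal (h (snd b i))) \<partial>blk) = exp (A - 1)"
    using nn_integral_blk_prod[of "\<lambda>x. ennreal (h x)", OF _ A] by simp
  finally show ?thesis
    using 1 A1 by (simp add: h_def eexp_ennreal)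
qed

text \<open>The intervals \<open>[m, m + 1)\<close> tile the line, so uniform positions in all
  blocks add up to Lebesgue measure.\<close>

lemma suminf_lap_exponent:
  assumes [measurable]: "case_prod F \<in> borel_measurable (borel \<Otimes>\<^sub>M borel)"
  shows "(\<integral>\<^sup>+m. (\<integral>\<^sup>+x. ennreal (1 - exp (- F (real_of_int m + frac (fst x)) \<bar>snd x\<bar>)) \<partial>pnt) \<partial>count_space UNIV) = lap_exponent F"
proof -
  define G where "G T = (\<integral>\<^sup>+r. ennreal (1 - exp (- F T \<bar>r\<bar>)) \<partial>\<pi>)" for T
  have [measurable]: "G \<in> borel_measurable borel"
    unfolding G_def by measurable
  have 1: "(\<integral>\<^sup>+x. ennreal (1 - exp (- F (real_of_int m + frac (fst x)) \<bar>snd x\<bar>)) \<partial>pnt)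
     = (\<integral>\<^sup>+T. G T * indicator {real_of_int m..<real_of_int m + 1} T \<partial>lborel)" for m
  proof -
    have "(\<integral>\<^sup>+x. ennreal (1 - exp (- F (real_of_int m + frac (fst x)) \<bar>snd x\<bar>)) \<partial>pnt)
      = (\<integral>\<^sup>+u. G (real_of_int m + frac u) \<partial>unif)"
      unfolding pnt_def G_def by (subst mark.nn_integral_fst[symmetric]) auto
    also have "\<dots> = (\<integral>\<^sup>+u. G (real_of_int m + frac u) * indicator {0..<1} u \<partial>lborel)"
      unfolding unif_def by (subst nn_integral_uniform_measure) (auto simp: divide_ennreal_def)
    also have "\<dots> = (\<integral>\<^sup>+T. G T * indicator {real_of_int m..<real_of_int m + 1} T \<partial>lborel)"
      by (subst (2) nn_integral_real_affine[of _ 1 "real_of_int m"])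
        (auto intro!: nn_integral_cong simp: indicator_def frac_eq)
    finally show ?thesis .
  qed
  have "(\<integral>\<^sup>+m. (\<integral>\<^sup>+T. G T * indicator {real_of_int m..<real_of_int m + 1} T \<partial>lborel) \<partial>count_space UNIV)
    = (\<integral>\<^sup>+T. (\<integral>\<^sup>+m. G T * indicator {real_of_int m..<real_of_int m + 1} T \<partial>count_space UNIV) \<partial>lborel)"
    by (rule nn_integral_count_space_nn_integral[symmetric]) auto
  also have "\<dots> = (\<integral>\<^sup>+T. G T \<partial>lborel)"
  proof (rule nn_integral_cong)
    fix T :: real
    have "(\<integral>\<^sup>+m. G T * indicator {real_of_int m..<real_of_int m + 1} T \<partial>count_space UNIV)
      = (\<Sum>m\<in>{\<lfloor>T\<rfloor>}. G T * indicator {real_of_int m..<real_of_int m + 1} T)"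
      by (rule nn_integral_count_space') (auto simp: indicator_def, metis floor_unique)
    then show "(\<integral>\<^sup>+m. G T * indicator {real_of_int m..<real_of_int m + 1} T \<partial>count_space UNIV) = G T"
      by simp
  qed
  finally show ?thesis by (simp add: 1 lap_exponent_def G_def)
qed

text \<open>For finitely many blocks this is a product over independent components. Both sides pass
  to the limit because \<open>eexp\<close> is bounded by \<open>1\<close> and continuous even at
  infinity.\<close>

theorem laplace_functional:
  assumes F: "case_prod F \<in> borel_measurable (borel \<Otimes>\<^sub>M borel)" and F0: "\<And>T r. 0 \<le> F T r"
  shows "(\<integral>\<omega>. eexp (psum F \<omega>) \<partial>\<Omega>) = eexp (lap_exponent F)"
proof -
  note [measurable] = bsum_measurable[OF F] psum_measurable[OF F]
  have b0: "0 \<le> bsum F m b" for m b unfolding bsum_def by (intro sum_nonneg) (simp add: F0)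
  define P where "P n \<omega> = (\<Sum>m\<in>{- int n..int n}. ennreal (bsum F m (\<omega> m)))" for n and \<omega> :: "sample"
  have [measurable]: "P n \<in> borel_measurable \<Omega>" for n unfolding P_def by measurable
  define \<psi> where "\<psi> m = (\<integral>\<^sup>+x. ennreal (1 - exp (- F (real_of_int m + frac (fst x)) \<bar>snd x\<bar>)) \<partial>pnt)" for m
  have "(\<lambda>n. \<integral>\<omega>. eexp (P n \<omega>) \<partial>\<Omega>) \<longlonglongrightarrow> (\<integral>\<omega>. eexp (psum F \<omega>) \<partial>\<Omega>)"
  proof (rule integral_dominated_convergence[where w = "\<lambda>_. 1"])
    show "AE \<omega> in \<Omega>. (\<lambda>n. eexp (P n \<omega>)) \<longlonglongrightarrow> eexp (psum F \<omega>)"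
      unfolding P_def psum_def by (intro AE_I2 tendsto_eexp nn_integral_count_space_int(2))
  qed (auto simp: eexp_bounds)
  moreover have "(\<integral>\<omega>. eexp (P n \<omega>) \<partial>\<Omega>) = eexp (\<Sum>m\<in>{- int n..int n}. \<psi> m)" for n
  proof -
    let ?J = "{- int n..int n}"
    have "(\<integral>\<omega>. eexp (P n \<omega>) \<partial>\<Omega>) = (\<integral>\<omega>. (\<Prod>m\<in>?J. exp (- bsum F m (restrict \<omega> ?J m))) \<partial>\<Omega>)"
      unfolding P_def by (intro Bochner_Integration.integral_cong refl)
        (simp add: eexp_sum eexp_ennreal b0 del: sum_ennreal)
    also have "\<dots> = (\<integral>\<omega>. (\<Prod>m\<in>?J. exp (- bsum F m (\<omega> m))) \<partial>distr \<Omega> (Pi\<^sub>M ?J (\<lambda>_. blk)) (\<lambda>\<omega>. restrict \<omega> ?J))"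
      unfolding \<Omega>_def by (subst integral_distr) (auto intro!: measurable_restrict)
    also have "\<dots> = (\<integral>\<omega>. (\<Prod>m\<in>?J. exp (- bsum F m (\<omega> m))) \<partial>Pi\<^sub>M ?J (\<lambda>_. blk))"
      unfolding \<Omega>_def by (subst blks.distr_PiM_restrict_finite) auto
    also have "\<dots> = (\<Prod>m\<in>?J. \<integral>b. exp (- bsum F m b) \<partial>blk)"
      using b0 by (intro blks.product_integral_prod blk.integrable_const_bound[of _ 1]) auto
    also have "\<dots> = eexp (\<Sum>m\<in>?J. \<psi> m)"
      by (simp add: eexp_sum laplace_blk[OF F F0] \<psi>_def)
    finally show ?thesis .
  qed
  ultimately have "(\<lambda>n. eexp (\<Sum>m\<in>{- int n..int n}. \<psi> m)) \<longlonglongrightarrow> (\<integral>\<omega>. eexp (psum F \<omega>) \<partial>\<Omega>)"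
    by simp
  moreover have "(\<lambda>n. eexp (\<Sum>m\<in>{- int n..int n}. \<psi> m)) \<longlonglongrightarrow> eexp (lap_exponent F)"
    unfolding suminf_lap_exponent[OF F, symmetric] \<psi>_def
    by (intro tendsto_eexp nn_integral_count_space_int(2))
  ultimately show ?thesis by (rule LIMSEQ_unique)
qed

end

section \<open>A selfsimilar additive jump process\<close>

lemma Lim_at_left_mono:
  fixes f :: "real \<Rightarrow> real"
  assumes "0 < t" and mono: "\<And>a b. 0 \<le> a \<Longrightarrow> a \<le> b \<Longrightarrow> f a \<le> f b"
  shows "\<exists>l. (f \<longlongrightarrow> l) (at_left t)"
proof -
  have "(f \<longlongrightarrow> Sup (f ` ({..<t} \<inter> {0..}))) (at t within {..<t} \<inter> {0..})"
    using mono by (intro Lim_left_bound[where K = "f t"]) auto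
  moreover have "at t within {..<t} \<inter> {0..} = at_left t"
    using \<open>0 < t\<close> by (intro at_within_nhd[of t "{0<..}"]) auto
  ultimately show ?thesis by auto
qed

text \<open>Bounding by a product makes the expectation over a Poisson number of points explicit, by
  \<open>nn_integral_blk_prod\<close>.\<close>

lemma ln_one_plus_sum_le:
  fixes f :: "nat \<Rightarrow> real"
  assumes "\<And>i. 0 \<le> f i"
  shows "ln (1 + (\<Sum>i<n. f i)) \<le> (\<Prod>i<n. 1 + ln (1 + f i))"
proof -
  have s0: "0 \<le> (\<Sum>i<n. f i)" for n using assms by (simp add: sum_nonneg)
  \<comment> \<open>The \<open>- 1\<close> is the invariant: as the product \<open>?p\<close> is at
    least \<open>1\<close>, the new logarithm is at most \<open>?p\<close> times itself.\<close>
  have "ln (1 + (\<Sum>i<n. f i)) \<le> (\<Prod>i<n. 1 + ln (1 + f i)) - 1"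
  proof (induction n)
    case (Suc n)
    let ?s = "\<Sum>i<n. f i" and ?p = "\<Prod>i<n. 1 + ln (1 + f i)"
    have p1: "1 \<le> ?p" using assms by (intro prod_ge_1) simp
    have l0: "0 \<le> ln (1 + f n)" using assms[of n] by simp
    have "1 + (?s + f n) \<le> (1 + ?s) * (1 + f n)"
      using s0[of n] assms[of n] by (simp add: algebra_simps)
    then have "ln (1 + (?s + f n)) \<le> ln ((1 + ?s) * (1 + f n))"
      using s0[of n] assms[of n] by (intro ln_mono) auto
    also have "\<dots> = ln (1 + ?s) + ln (1 + f n)"
      using s0[of n] assms[of n] by (intro ln_mult_pos) auto
    also have "\<dots> \<le> (?p - 1) + ?p * ln (1 + f n)"
      using Suc p1 l0 by (intro add_mono) (auto simp: mult_le_cancel_right1)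
    finally show ?case by (simp add: algebra_simps)
  qed simp
  then show ?thesis by simp
qed

context marked_poisson
begin

section \<open>Sums over the points of a sample\<close>

lemma bsum_nonneg: "(\<And>T r. 0 \<le> F T r) \<Longrightarrow> 0 \<le> bsum F m b"
  unfolding bsum_def by (intro sum_nonneg) simp

lemma bsum_mono:
  assumes "\<And>T r. real_of_int m \<le> T \<Longrightarrow> T < real_of_int m + 1 \<Longrightarrow> 0 \<le> r \<Longrightarrow> F T r \<le> G T r"
  shows "bsum F m b \<le> bsum G m b"
  unfolding bsum_def by (intro sum_mono assms) (auto simp: frac_lt_1)

lemma bsum_cong:
  assumes "\<And>T r. real_of_int m \<le> T \<Longrightarrow> T < real_of_int m + 1 \<Longrightarrow> 0 \<le> r \<Longrightarrow> F T r = G T r"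
  shows "bsum F m b = bsum G m b"
  unfolding bsum_def by (intro sum.cong refl assms) (auto simp: frac_lt_1)

lemma bsum_cmult: "bsum (\<lambda>T r. c * F T r) m b = c * bsum F m b"
  by (simp add: bsum_def sum_distrib_left)

lemma bsum_sum: "bsum (\<lambda>T r. \<Sum>i\<in>I. F i T r) m b = (\<Sum>i\<in>I. bsum (F i) m b)"
  unfolding bsum_def by (rule sum.swap)

lemma psum_mono: "(\<And>T r. 0 \<le> r \<Longrightarrow> F T r \<le> G T r) \<Longrightarrow> psum F \<omega> \<le> psum G \<omega>"
  unfolding psum_def by (intro nn_integral_mono ennreal_leI bsum_mono) auto

lemma psum_sum:
  assumes "finite I" "\<And>i. i \<in> I \<Longrightarrow> 0 \<le> \<theta> i" "\<And>i T r. i \<in> I \<Longrightarrow> 0 \<le> F i T r"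
  shows "psum (\<lambda>T r. \<Sum>i\<in>I. \<theta> i * F i T r) \<omega> = (\<Sum>i\<in>I. ennreal (\<theta> i) * psum (F i) \<omega>)"
proof -
  have "psum (\<lambda>T r. \<Sum>i\<in>I. \<theta> i * F i T r) \<omega> = (\<integral>\<^sup>+m. (\<Sum>i\<in>I. ennreal (\<theta> i) * ennreal (bsum (F i) m (\<omega> m))) \<partial>count_space UNIV)"
    unfolding psum_def bsum_sum bsum_cmult using assms
    by (intro nn_integral_cong) (auto simp: sum_ennreal[symmetric] ennreal_mult bsum_nonneg simp del: sum_ennreal)
  also have "\<dots> = (\<Sum>i\<in>I. ennreal (\<theta> i) * psum (F i) \<omega>)"
    unfolding psum_def by (simp add: nn_integral_sum nn_integral_cmult)
  finally show ?thesis .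
qed

lemma psum_add:
  assumes "\<And>T r. 0 \<le> F T r" "\<And>T r. 0 \<le> G T r"
  shows "psum (\<lambda>T r. F T r + G T r) \<omega> = psum F \<omega> + psum G \<omega>"
proof -
  have "psum (\<lambda>T r. \<Sum>i\<in>UNIV. (if i then F T r else G T r)) \<omega>
    = (\<Sum>i\<in>UNIV. psum (\<lambda>T r. if i then F T r else G T r) \<omega>)"
    using psum_sum[of UNIV "\<lambda>_. 1" "\<lambda>i T r. if i then F T r else G T r" \<omega>] assms by simp
  then show ?thesis by (simp add: UNIV_bool add.commute)
qed

lemma psum_finite_range:
  assumes "\<And>T r. 0 \<le> F T r" "\<And>T r. T \<notin> {a..<b} \<Longrightarrow> F T r = 0"
  shows "psum F \<omega> < \<top>"
proof -
  have "psum F \<omega> = (\<Sum>m\<in>{\<lfloor>a\<rfloor> - 1..\<lceil>b\<rceil>}. ennreal (bsum F m (\<omega> m)))"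
    unfolding psum_def
  proof (rule nn_integral_count_space')
    fix m assume "m \<notin> {\<lfloor>a\<rfloor> - 1..\<lceil>b\<rceil>}"
    then have "m + 1 < a \<or> b < m" by auto linarith+
    then have "bsum F m (\<omega> m) = bsum (\<lambda>_ _. 0) m (\<omega> m)"
      by (intro bsum_cong assms(2)) auto
    then show "ennreal (bsum F m (\<omega> m)) = 0" by (simp add: bsum_def)
  qed auto
  also have "\<dots> < \<top>" by simp
  finally show ?thesis .
qed

lemma emeasure_component:
  assumes [measurable]: "A \<in> sets blk"
  shows "emeasure \<Omega> {\<omega>. \<omega> m \<in> A} = emeasure blk A"
proof -
  have "emeasure blk A = emeasure (distr \<Omega> blk (\<lambda>\<omega>. \<omega> m)) A"
    unfolding \<Omega>_def by (subst blks.PiM_component) auto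
  also have "\<dots> = emeasure \<Omega> {\<omega>. \<omega> m \<in> A}"
    by (subst emeasure_distr) (auto simp: vimage_def)
  finally show ?thesis by simp
qed

text \<open>Any enumeration \<open>f\<close> of blocks is allowed, since all components have the
  same law; it will run both to plus and to minus infinity.\<close>

lemma AE_component_eventually_le:
  fixes D :: "block \<Rightarrow> real" and u :: "nat \<Rightarrow> real"
  assumes [measurable]: "D \<in> borel_measurable blk"
    and fin: "(\<Sum>n. emeasure blk {b\<in>space blk. u n < D b}) < \<infinity>"
  shows "AE \<omega> in \<Omega>. \<exists>a::nat. \<forall>n\<ge>a. D (\<omega> (f n)) \<le> u n"
proof -
  have "emeasure \<Omega> {\<omega>\<in>space \<Omega>. u n < D (\<omega> (f n))} = emeasure blk {b\<in>space blk. u n < D b}" for n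
  proof -
    have "{b\<in>space blk. u n < D b} \<in> sets blk" by measurable
    from emeasure_component[OF this, of "f n"] show ?thesis by simp
  qed
  then have "AE \<omega> in \<Omega>. \<exists>a. \<forall>n\<ge>a. \<omega> \<notin> {\<omega>\<in>space \<Omega>. u n < D (\<omega> (f n))}"
    using fin by (intro \<Omega>.borel_cantelli_suminf) (simp_all del: space_\<Omega>)
  then show ?thesis by (simp add: not_less)
qed

lemma nn_integral_pnt_mark:
  assumes [measurable]: "f \<in> borel_measurable borel"
  shows "(\<integral>\<^sup>+x. f (snd x) \<partial>pnt) = (\<integral>\<^sup>+r. f r \<partial>\<pi>)"
  unfolding pnt_def by (subst mark.nn_integral_fst[symmetric]) (auto simp: unif.emeasure_space_1)

text \<open>The unweighted sum of the marks controls every contribution of a block up to its largest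
  exponential weight.\<close>

definition total :: "block \<Rightarrow> real" where
  "total b = (\<Sum>i<fst b. \<bar>snd (snd b i)\<bar>)"

lemma total_nonneg: "0 \<le> total b"
  unfolding total_def by (intro sum_nonneg) auto

lemma total_measurable [measurable]: "total \<in> borel_measurable blk"
  unfolding total_def by (intro sum_lessThan_measurable) measurable

end

text \<open>The logarithmic moment makes the sum over the infinitely many points before time
  \<open>1\<close> converge.\<close>

locale ss_poisson = marked_poisson +
  fixes H :: real
  assumes H_pos: "0 < H" and log_moment: "(\<integral>\<^sup>+r. ennreal (ln (1 + \<bar>r\<bar>)) \<partial>\<pi>) < \<infinity>"
begin

definition jump :: "real \<Rightarrow> real \<Rightarrow> real \<Rightarrow> real \<Rightarrow> real" where
  "jump s t T r = (if s < exp T \<and> exp T \<le> t then exp (H * T) * \<bar>r\<bar> else 0)"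

definition past :: "real \<Rightarrow> real \<Rightarrow> real" where
  "past T r = (if T < 0 then exp (H * T) * \<bar>r\<bar> else 0)"

definition good :: "sample \<Rightarrow> bool" where
  "good \<omega> \<longleftrightarrow> psum past \<omega> < \<top>"

text \<open>One exceptional set serves all \<open>F\<close>. On it every value is set to
  \<open>0\<close>, so increments are exact differences at every sample point, not just almost
  surely.\<close>

definition val :: "(real \<Rightarrow> real \<Rightarrow> real) \<Rightarrow> sample \<Rightarrow> real" where
  "val F \<omega> = (if good \<omega> then enn2real (psum F \<omega>) else 0)"

lemma jump_measurable [measurable]: "case_prod (jump s t) \<in> borel_measurable (borel \<Otimes>\<^sub>M borel)"
  unfolding jump_def by measurable

lemma past_measurable [measurable]: "case_prod past \<in> borel_measurable (borel \<Otimes>\<^sub>M borel)"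
  unfolding past_def by measurable

lemma good_measurable [measurable]: "Measurable.pred \<Omega> good"
  unfolding good_def using psum_measurable[OF past_measurable] by measurable

lemma val_measurable:
  assumes "case_prod F \<in> borel_measurable (borel \<Otimes>\<^sub>M borel)"
  shows "val F \<in> borel_measurable \<Omega>"
proof -
  note [measurable] = psum_measurable[OF assms]
  show ?thesis unfolding val_def[abs_def] by measurable
qed

lemma jump_nonneg: "0 \<le> jump s t T r"
  by (simp add: jump_def)

lemma val_nonneg: "0 \<le> val F \<omega>"
  by (simp add: val_def)

text \<open>The generalised inverse of \<open>exp (h * x)\<close> is at most
  \<open>ln (1 + x) / h\<close>. The logarithm of the sum is bounded by a product over the marks,
  whose Poisson mean is finite by \<open>log_moment\<close>.\<close>

lemma suminf_total_tail: "0 < h \<Longrightarrow> (\<Sum>n. emeasure blk {b\<in>space blk. exp (h * real n) < total b}) < \<infinity>"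
proof -
  assume h: "0 < h"
  have "(\<integral>\<^sup>+b. ennreal (gen_inv (\<lambda>x. exp (h * x)) (total b / 1)) \<partial>blk) \<le> (\<integral>\<^sup>+b. ennreal (1 / h) * (\<Prod>i<fst b. ennreal (1 + ln (1 + \<bar>snd (snd b i)\<bar>))) \<partial>blk)"
  proof (rule nn_integral_mono)
    fix b
    have "gen_inv (\<lambda>x. exp (h * x)) (total b) \<le> ln (1 + total b) / h"
    proof (rule ccontr)
      assume "\<not> ?thesis"
      then have "exp (h * (ln (1 + total b) / h)) < total b"
        using h total_nonneg[of b] by (intro gen_inv_lower[OF G1_exp[OF h]]) auto
      then show False using h total_nonneg[of b] by simp
    qed
    also have "ln (1 + total b) \<le> (\<Prod>i<fst b. 1 + ln (1 + \<bar>snd (snd b i)\<bar>))"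
      unfolding total_def by (intro ln_one_plus_sum_le) auto
    finally have "gen_inv (\<lambda>x. exp (h * x)) (total b) \<le> (1 / h) * (\<Prod>i<fst b. 1 + ln (1 + \<bar>snd (snd b i)\<bar>))"
      using h by (simp add: divide_right_mono)
    then have "ennreal (gen_inv (\<lambda>x. exp (h * x)) (total b)) \<le> ennreal ((1 / h) * (\<Prod>i<fst b. 1 + ln (1 + \<bar>snd (snd b i)\<bar>)))"
      by (rule ennreal_leI)
    also have "\<dots> = ennreal (1 / h) * (\<Prod>i<fst b. ennreal (1 + ln (1 + \<bar>snd (snd b i)\<bar>)))"
    proof -
      have "(\<Prod>i<fst b. ennreal (1 + ln (1 + \<bar>snd (snd b i)\<bar>))) = ennreal (\<Prod>i<fst b. 1 + ln (1 + \<bar>snd (snd b i)\<bar>))"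
        by (intro prod_ennreal) auto
      then show ?thesis
        using h by (subst ennreal_mult) (auto intro!: prod_nonneg add_nonneg_nonneg)
    qed
    finally show "ennreal (gen_inv (\<lambda>x. exp (h * x)) (total b / 1)) \<le> \<dots>" by simp
  qed
  also have "\<dots> = ennreal (1 / h) * (\<integral>\<^sup>+b. (\<Prod>i<fst b. ennreal (1 + ln (1 + \<bar>snd (snd b i)\<bar>))) \<partial>blk)"
    by (rule nn_integral_cmult, rule measurable_compose_countable[OF _ count_measurable]) measurable
  also have "\<dots> < \<infinity>"
  proof -
    have "(\<integral>\<^sup>+x. ennreal (1 + ln (1 + \<bar>snd x\<bar>)) \<partial>pnt) = (\<integral>\<^sup>+r. ennreal (1 + ln (1 + \<bar>r\<bar>)) \<partial>\<pi>)"
      by (rule nn_integral_pnt_mark[where f = "\<lambda>r. ennreal (1 + ln (1 + \<bar>r\<bar>))"]) measurable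
    also have "\<dots> = (\<integral>\<^sup>+r. 1 + ennreal (ln (1 + \<bar>r\<bar>)) \<partial>\<pi>)"
      by (intro nn_integral_cong) (simp add: ennreal_plus)
    also have "\<dots> = 1 + (\<integral>\<^sup>+r. ennreal (ln (1 + \<bar>r\<bar>)) \<partial>\<pi>)"
      by (subst nn_integral_add) (auto simp: mark.emeasure_space_1)
    also have "\<dots> < \<infinity>" using log_moment by simp
    finally have "(\<integral>\<^sup>+b. (\<Prod>i<fst b. ennreal (1 + ln (1 + \<bar>snd (snd b i)\<bar>))) \<partial>blk) < \<infinity>"
      using nn_integral_blk_prod_finite[of "\<lambda>x. ennreal (1 + ln (1 + \<bar>snd x\<bar>))"] by simp
    then show ?thesis by (simp add: ennreal_mult_less_top)
  qed
  finally show ?thesis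
    using blk.suminf_tail_le_nn_integral_gen_inv[of total, OF _ G1_exp[OF h], of 1] by simp
qed

text \<open>Block \<open>- n\<close> has weight at most \<open>exp (H * (1 - n))\<close>. The tail
  bound is used at rate \<open>H / 2\<close>, so that its marks grow more slowly and a convergent
  geometric series remains.\<close>

lemma AE_good: "AE \<omega> in \<Omega>. good \<omega>"
proof -
  have "AE \<omega> in \<Omega>. \<exists>a. \<forall>n\<ge>a. total (\<omega> (- int n)) \<le> exp (H / 2 * real n)"
    using H_pos by (intro AE_component_eventually_le suminf_total_tail) auto
  then show ?thesis
  proof eventually_elim
    case (elim \<omega>)
    then obtain a where a: "\<And>n. a \<le> n \<Longrightarrow> total (\<omega> (- int n)) \<le> exp (H / 2 * real n)" by blast
    define f where "f n = bsum past (- int n) (\<omega> (- int n))" for n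
    have f0: "0 \<le> f n" for n unfolding f_def by (intro bsum_nonneg) (simp add: past_def)
    have "f n \<le> exp H * exp (- H / 2) ^ n" if "a \<le> n" for n
    proof -
      have "f n \<le> bsum (\<lambda>T r. exp (H * (1 - real n)) * \<bar>r\<bar>) (- int n) (\<omega> (- int n))"
        unfolding f_def using H_pos by (intro bsum_mono) (auto simp: past_def intro!: mult_right_mono)
      also have "\<dots> = exp (H * (1 - real n)) * total (\<omega> (- int n))"
        by (simp add: bsum_def total_def sum_distrib_left)
      also have "\<dots> \<le> exp (H * (1 - real n)) * exp (H / 2 * real n)"
        using a[OF that] by (intro mult_left_mono) auto
      also have "\<dots> = exp H * exp (- H / 2) ^ n"
        by (simp add: exp_add[symmetric] exp_of_nat_mult[symmetric] algebra_simps)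
      finally show ?thesis .
    qed
    then have "summable f"
      using f0 H_pos
      by (intro summable_comparison_test'[of "\<lambda>n. exp H * exp (- H / 2) ^ n" a f] summable_mult summable_geometric) auto
    then have fin: "(\<Sum>n. ennreal (f n)) < \<top>"
      using f0 by (simp add: ennreal_suminf_neq_top less_top[symmetric])
    have "psum past \<omega> = (\<integral>\<^sup>+m. ennreal (bsum past m (\<omega> m)) \<partial>count_space (range (\<lambda>n. - int n)))"
      unfolding psum_def
    proof (rule nn_integral_count_space_eq)
      fix m assume m: "m \<in> UNIV - range (\<lambda>n. - int n)"
      have "0 < m"
      proof (rule ccontr)
        assume "\<not> 0 < m"
        then have "m = - int (nat (- m))" by simp
        with m show False by blast
      qed
      then have "bsum past m (\<omega> m) = bsum (\<lambda>_ _. 0) m (\<omega> m)"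
        by (intro bsum_cong) (auto simp: past_def)
      then show "ennreal (bsum past m (\<omega> m)) = 0" by (simp add: bsum_def)
    qed auto
    also have "\<dots> = (\<integral>\<^sup>+n. ennreal (f n) \<partial>count_space UNIV)"
      unfolding f_def
      by (rule nn_integral_bij_count_space[symmetric]) (auto simp: bij_betw_def inj_on_def)
    also have "\<dots> = (\<Sum>n. ennreal (f n))" by (rule nn_integral_count_space_nat)
    finally show ?case using fin by (simp add: good_def)
  qed
qed

lemma psum_jump_finite:
  assumes "good \<omega>" shows "psum (jump s t) \<omega> < \<top>"
proof -
  \<comment> \<open>The \<open>+ 1\<close> keeps the point \<open>T = ln t\<close> inside a
    half-open interval; the maximum covers times \<open>t < 1\<close>, where \<open>past\<close>
    suffices.\<close>
  let ?G = "\<lambda>T r. if 0 \<le> T \<and> T < max 0 (ln t) + 1 then exp (H * T) * \<bar>r\<bar> else 0"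
  have le: "jump s t T r \<le> past T r + ?G T r" for T r
  proof (cases "exp T \<le> t")
    case True
    then have "T \<le> ln t" by (metis exp_gt_zero less_le_trans ln_ge_iff)
    then show ?thesis by (auto simp: jump_def past_def)
  qed (auto simp: jump_def past_def)
  have "psum (jump s t) \<omega> \<le> psum (\<lambda>T r. past T r + ?G T r) \<omega>"
    by (intro psum_mono le)
  also have "\<dots> = psum past \<omega> + psum ?G \<omega>"
    by (intro psum_add) (auto simp: past_def)
  also have "psum ?G \<omega> < \<top>"
    by (rule psum_finite_range[of _ 0 "max 0 (ln t) + 1"]) auto
  then have "psum past \<omega> + psum ?G \<omega> < \<top>"
    using assms by (simp add: good_def)
  finally show ?thesis .
qed

text \<open>Almost surely a nonnegative combination of values is the point sum of the combined
  function, so a joint transform is one instance of the Laplace functional.\<close>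

lemma integral_exp_val:
  assumes "finite I" and F: "\<And>i. i \<in> I \<Longrightarrow> case_prod (F i) \<in> borel_measurable (borel \<Otimes>\<^sub>M borel)"
    and F0: "\<And>i T r. i \<in> I \<Longrightarrow> 0 \<le> F i T r" and fin: "\<And>i \<omega>. i \<in> I \<Longrightarrow> good \<omega> \<Longrightarrow> psum (F i) \<omega> < \<top>"
    and \<theta>: "\<And>i. i \<in> I \<Longrightarrow> 0 \<le> \<theta> i"
  shows "(\<integral>\<omega>. exp (- (\<Sum>i\<in>I. \<theta> i * val (F i) \<omega>)) \<partial>\<Omega>) = eexp (lap_exponent (\<lambda>T r. \<Sum>i\<in>I. \<theta> i * F i T r))"
proof -
  have G [measurable]: "case_prod (\<lambda>T r. \<Sum>i\<in>I. \<theta> i * F i T r) \<in> borel_measurable (borel \<Otimes>\<^sub>M borel)"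
    using F by (simp add: split_beta')
  have "(\<integral>\<omega>. exp (- (\<Sum>i\<in>I. \<theta> i * val (F i) \<omega>)) \<partial>\<Omega>) = (\<integral>\<omega>. eexp (psum (\<lambda>T r. \<Sum>i\<in>I. \<theta> i * F i T r) \<omega>) \<partial>\<Omega>)"
  proof (rule integral_cong_AE)
    show "(\<lambda>\<omega>. exp (- (\<Sum>i\<in>I. \<theta> i * val (F i) \<omega>))) \<in> borel_measurable \<Omega>"
      using F val_measurable by measurable
    show "(\<lambda>\<omega>. eexp (psum (\<lambda>T r. \<Sum>i\<in>I. \<theta> i * F i T r) \<omega>)) \<in> borel_measurable \<Omega>"
      using psum_measurable[OF G] by measurable
    show "AE \<omega> in \<Omega>. exp (- (\<Sum>i\<in>I. \<theta> i * val (F i) \<omega>)) = eexp (psum (\<lambda>T r. \<Sum>i\<in>I. \<theta> i * F i T r) \<omega>)"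
      using AE_good
    proof eventually_elim
      case (elim \<omega>)
      have "ennreal (\<theta> i) * psum (F i) \<omega> = ennreal (\<theta> i * val (F i) \<omega>)" if "i \<in> I" for i
        using fin[OF that elim] \<theta>[OF that] elim by (simp add: val_def ennreal_mult)
      then have "psum (\<lambda>T r. \<Sum>i\<in>I. \<theta> i * F i T r) \<omega> = ennreal (\<Sum>i\<in>I. \<theta> i * val (F i) \<omega>)"
        using \<theta> F0 val_nonneg by (subst psum_sum) (auto simp: \<open>finite I\<close>)
      then show ?case
        using \<theta> val_nonneg by (simp add: eexp_ennreal sum_nonneg)
    qed
  qed
  also have "\<dots> = eexp (lap_exponent (\<lambda>T r. \<Sum>i\<in>I. \<theta> i * F i T r))"
    using \<theta> F0 by (intro laplace_functional G sum_nonneg) auto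
  finally show ?thesis .
qed

text \<open>At each point at most one summand is nonzero, and there \<open>1 - exp (- x)\<close> is
  additive. This is what makes increments independent.\<close>

lemma lap_exponent_disjoint:
  assumes "finite I" and F [measurable]: "\<And>i. i \<in> I \<Longrightarrow> case_prod (F i) \<in> borel_measurable (borel \<Otimes>\<^sub>M borel)"
    and F0: "\<And>i T r. i \<in> I \<Longrightarrow> 0 \<le> F i T r"
    and disj: "\<And>i j T r. i \<in> I \<Longrightarrow> j \<in> I \<Longrightarrow> i \<noteq> j \<Longrightarrow> F i T r = 0 \<or> F j T r = 0"
  shows "lap_exponent (\<lambda>T r. \<Sum>i\<in>I. F i T r) = (\<Sum>i\<in>I. lap_exponent (F i))"
proof -
  have "1 - exp (- (\<Sum>i\<in>I. F i T r)) = (\<Sum>i\<in>I. 1 - exp (- F i T r))" for T r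
  proof (cases "\<exists>j\<in>I. F j T r \<noteq> 0")
    case True
    then obtain j where j: "j \<in> I" "F j T r \<noteq> 0" by blast
    then have 0: "F i T r = 0" if "i \<in> I - {j}" for i
      using disj[of i j T r] that by auto
    show ?thesis
      using 0 by (simp add: sum.remove[OF \<open>finite I\<close> j(1)])
  qed simp
  then have "ennreal (1 - exp (- (\<Sum>i\<in>I. F i T r))) = (\<Sum>i\<in>I. ennreal (1 - exp (- F i T r)))" for T r
    using F0 by (subst sum_ennreal) auto
  then have "lap_exponent (\<lambda>T r. \<Sum>i\<in>I. F i T r) = (\<integral>\<^sup>+T. \<integral>\<^sup>+r. (\<Sum>i\<in>I. ennreal (1 - exp (- F i T \<bar>r\<bar>))) \<partial>\<pi> \<partial>lborel)"
    by (simp add: lap_exponent_def)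
  also have "\<dots> = (\<integral>\<^sup>+T. (\<Sum>i\<in>I. \<integral>\<^sup>+r. ennreal (1 - exp (- F i T \<bar>r\<bar>)) \<partial>\<pi>) \<partial>lborel)"
    by (intro nn_integral_cong nn_integral_sum) measurable
  also have "\<dots> = (\<Sum>i\<in>I. lap_exponent (F i))"
    unfolding lap_exponent_def by (intro nn_integral_sum) measurable
  finally show ?thesis .
qed

text \<open>Translation invariance of Lebesgue measure in logarithmic time, the source of
  selfsimilarity.\<close>

lemma lap_exponent_shift:
  assumes [measurable]: "case_prod F \<in> borel_measurable (borel \<Otimes>\<^sub>M borel)"
  shows "lap_exponent (\<lambda>T. F (c + T)) = lap_exponent F"
  unfolding lap_exponent_def by (subst (2) nn_integral_real_affine[of _ 1 c]) simp_all

section \<open>The process and its defining properties\<close>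

definition proc :: "real \<Rightarrow> sample \<Rightarrow> real" where
  "proc t = val (jump 0 t)"

lemma proc_measurable [measurable]: "proc t \<in> borel_measurable \<Omega>"
  unfolding proc_def by (rule val_measurable) measurable

lemma proc_nonneg: "0 \<le> proc t \<omega>"
  by (simp add: proc_def val_nonneg)

lemma proc_diff:
  assumes "0 \<le> s" "s \<le> t"
  shows "proc t \<omega> - proc s \<omega> = val (jump s t) \<omega>"
proof (cases "good \<omega>")
  case True
  have "jump 0 t = (\<lambda>T r. jump 0 s T r + jump s t T r)"
    using assms by (auto simp: jump_def fun_eq_iff)
  then have "psum (jump 0 t) \<omega> = psum (jump 0 s) \<omega> + psum (jump s t) \<omega>"
    by (simp add: psum_add jump_nonneg)
  then show ?thesis
    using True psum_jump_finite[OF True] by (simp add: proc_def val_def enn2real_plus)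
qed (simp add: proc_def val_def)

text \<open>Disjoint time intervals collect points from disjoint sets, so the exponents of the
  weighted increments add and the transform factors.\<close>

lemma proc_indep:
  fixes k :: nat and t :: "nat \<Rightarrow> real"
  assumes t: "0 \<le> t 0" "strict_mono_on {..k} t"
  shows "\<Omega>.indep_vars (\<lambda>_. borel) (\<lambda>i \<omega>. proc (t (Suc i)) \<omega> - proc (t i) \<omega>) {..<k}"
proof -
  have mono: "t i \<le> t j" if "i \<le> j" "j \<le> k" for i j
    using t(2) that by (auto simp: strict_mono_on_def le_less)
  have t0: "0 \<le> t i" if "i \<le> k" for i using t(1) mono[of 0 i] that by simp
  let ?F = "\<lambda>i. jump (t i) (t (Suc i))"
  have "\<Omega>.indep_vars (\<lambda>_. borel) (\<lambda>i. val (?F i)) {..<k}"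
  proof (rule \<Omega>.indep_vars_laplaceI)
    fix \<theta> :: "nat \<Rightarrow> real" assume \<theta>: "\<And>j. 0 \<le> \<theta> j"
    have "(\<integral>\<omega>. exp (- (\<Sum>i<k. \<theta> i * val (?F i) \<omega>)) \<partial>\<Omega>) = eexp (lap_exponent (\<lambda>T r. \<Sum>i<k. \<theta> i * ?F i T r))"
      using \<theta> by (intro integral_exp_val jump_nonneg psum_jump_finite) auto
    also have "\<dots> = eexp (\<Sum>i<k. lap_exponent (\<lambda>T r. \<theta> i * ?F i T r))"
    proof (subst lap_exponent_disjoint)
      fix i j T r assume ij: "i \<in> {..<k}" "j \<in> {..<k}" "i \<noteq> j"
      then have "t (Suc i) \<le> t j \<or> t (Suc j) \<le> t i"
        using mono[of "Suc i" j] mono[of "Suc j" i] by (cases "i < j") auto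
      then show "\<theta> i * ?F i T r = 0 \<or> \<theta> j * ?F j T r = 0"
        by (auto simp: jump_def)
    qed (use \<theta> in \<open>auto simp: jump_nonneg\<close>)
    also have "\<dots> = (\<Prod>i<k. eexp (lap_exponent (\<lambda>T r. \<theta> i * ?F i T r)))"
      by (simp add: eexp_sum)
    also have "\<dots> = (\<Prod>i<k. \<integral>\<omega>. exp (- (\<theta> i * val (?F i) \<omega>)) \<partial>\<Omega>)"
    proof (rule prod.cong[OF refl])
      fix i
      show "eexp (lap_exponent (\<lambda>T r. \<theta> i * ?F i T r)) = (\<integral>\<omega>. exp (- (\<theta> i * val (?F i) \<omega>)) \<partial>\<Omega>)"
        using integral_exp_val[of "{i}" ?F \<theta>] \<theta> by (simp add: jump_nonneg psum_jump_finite)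
    qed
    finally show "(\<integral>\<omega>. exp (- (\<Sum>i<k. \<theta> i * val (?F i) \<omega>)) \<partial>\<Omega>) = \<dots>" .
  qed (auto intro!: val_measurable simp: val_nonneg)
  then show ?thesis
  proof (rule \<Omega>.indep_vars_cong[THEN iffD1, rotated -1])
    fix i assume "i \<in> {..<k}"
    then show "val (?F i) = (\<lambda>\<omega>. proc (t (Suc i)) \<omega> - proc (t i) \<omega>)"
      using t0[of i] mono[of i "Suc i"] by (auto simp: proc_diff)
  qed auto
qed

text \<open>Multiplying time by \<open>c\<close> shifts the points by \<open>ln c\<close>, which
  multiplies each jump \<open>exp (H * T) * r\<close> by \<open>c powr H\<close>.\<close>

lemma proc_selfsimilar:
  assumes "finite J" "0 < c"
  shows "distr \<Omega> (Pi\<^sub>M J (\<lambda>_. borel)) (\<lambda>\<omega>. \<lambda>t\<in>J. proc (c * t) \<omega>)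
    = distr \<Omega> (Pi\<^sub>M J (\<lambda>_. borel)) (\<lambda>\<omega>. \<lambda>t\<in>J. c powr H * proc t \<omega>)"
proof (rule laplace_unique[OF prob_space_\<Omega> prob_space_\<Omega> \<open>finite J\<close>])
  fix \<theta> :: "real \<Rightarrow> real" assume \<theta>: "\<And>j. 0 \<le> \<theta> j"
  have "(\<integral>\<omega>. exp (- (\<Sum>t\<in>J. \<theta> t * proc (c * t) \<omega>)) \<partial>\<Omega>) = eexp (lap_exponent (\<lambda>T r. \<Sum>t\<in>J. \<theta> t * jump 0 (c * t) T r))"
    unfolding proc_def using \<theta> \<open>finite J\<close> by (intro integral_exp_val jump_nonneg psum_jump_finite) auto
  also have "lap_exponent (\<lambda>T r. \<Sum>t\<in>J. \<theta> t * jump 0 (c * t) T r)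
     = lap_exponent (\<lambda>T r. \<Sum>t\<in>J. \<theta> t * jump 0 (c * t) (ln c + T) r)"
    by (rule lap_exponent_shift[symmetric]) simp
  also have "(\<lambda>T r. \<Sum>t\<in>J. \<theta> t * jump 0 (c * t) (ln c + T) r) = (\<lambda>T r. \<Sum>t\<in>J. (\<theta> t * c powr H) * jump 0 t T r)"
    using \<open>0 < c\<close> by (intro ext sum.cong refl) (auto simp: jump_def exp_add powr_def distrib_left)
  also have "eexp (lap_exponent \<dots>) = (\<integral>\<omega>. exp (- (\<Sum>t\<in>J. (\<theta> t * c powr H) * proc t \<omega>)) \<partial>\<Omega>)"
    unfolding proc_def using \<theta> \<open>finite J\<close>
    by (intro integral_exp_val[symmetric] jump_nonneg psum_jump_finite) auto
  finally show "(\<integral>\<omega>. exp (- (\<Sum>t\<in>J. \<theta> t * proc (c * t) \<omega>)) \<partial>\<Omega>)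
    = (\<integral>\<omega>. exp (- (\<Sum>t\<in>J. \<theta> t * (c powr H * proc t \<omega>))) \<partial>\<Omega>)"
    by (simp add: mult.assoc)
qed (auto simp: proc_nonneg)

lemma proc_mono: "0 \<le> s \<Longrightarrow> s \<le> t \<Longrightarrow> proc s \<omega> \<le> proc t \<omega>"
  using proc_diff[of s t \<omega>] val_nonneg[of "jump s t" \<omega>] by simp

text \<open>Dominated convergence over the blocks, with the jumps up to \<open>t + 1\<close> as
  dominating sum. A point with \<open>exp T > t\<close> drops out once \<open>S n < exp T\<close>;
  one at time \<open>t\<close> itself is already included.\<close>

lemma proc_right_continuous:
  assumes "good \<omega>"
  shows "((\<lambda>t. proc t \<omega>) \<longlongrightarrow> proc t \<omega>) (at_right t)"
proof (rule tendsto_at_right_sequentially[of _ "t + 1"])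
  fix S :: "nat \<Rightarrow> real" assume S: "\<And>n. t < S n" "\<And>n. S n < t + 1" "S \<longlonglongrightarrow> t"
  have "(\<lambda>n. psum (jump 0 (S n)) \<omega>) \<longlonglongrightarrow> psum (jump 0 t) \<omega>"
    unfolding psum_def
  proof (rule nn_integral_dominated_convergence[where w = "\<lambda>m. ennreal (bsum (jump 0 (t + 1)) m (\<omega> m))"])
    show "(\<integral>\<^sup>+m. ennreal (bsum (jump 0 (t + 1)) m (\<omega> m)) \<partial>count_space UNIV) < \<infinity>"
      using psum_jump_finite[OF assms] by (simp add: psum_def)
    show "AE m in count_space UNIV. ennreal (bsum (jump 0 (S n)) m (\<omega> m)) \<le> ennreal (bsum (jump 0 (t + 1)) m (\<omega> m))" for n
      using S(2)[of n] by (intro AE_I2 ennreal_leI bsum_mono) (auto simp: jump_def)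
    have "(\<lambda>n. jump 0 (S n) T r) \<longlonglongrightarrow> jump 0 t T r" for T r
    proof (cases "exp T \<le> t")
      case True
      then have "jump 0 (S n) T r = jump 0 t T r" for n using S(1)[of n] by (simp add: jump_def)
      then show ?thesis by simp
    next
      case False
      then have "\<forall>\<^sub>F n in sequentially. S n < exp T" using S(3) by (intro order_tendstoD(2)) auto
      then have "\<forall>\<^sub>F n in sequentially. jump 0 t T r = jump 0 (S n) T r"
        by eventually_elim (use False in \<open>auto simp: jump_def\<close>)
      then show ?thesis by (rule Lim_transform_eventually[rotated]) simp
    qed
    then show "AE m in count_space UNIV. (\<lambda>n. ennreal (bsum (jump 0 (S n)) m (\<omega> m))) \<longlonglongrightarrow> ennreal (bsum (jump 0 t) m (\<omega> m))"
      unfolding bsum_def by (intro AE_I2 tendsto_ennrealI tendsto_sum)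
  qed auto
  moreover have "psum (jump 0 t) \<omega> = ennreal (proc t \<omega>)"
    using assms psum_jump_finite[OF assms] by (simp add: proc_def val_def)
  ultimately have "(\<lambda>n. enn2real (psum (jump 0 (S n)) \<omega>)) \<longlonglongrightarrow> proc t \<omega>"
    by (intro tendsto_enn2real proc_nonneg) simp
  then show "(\<lambda>n. proc (S n) \<omega>) \<longlonglongrightarrow> proc t \<omega>"
    using assms by (simp add: proc_def val_def)
qed simp

theorem selfsimilar_additive_proc:
  fixes v :: "real ^ 'n"
  shows "selfsimilar_additive \<Omega> H (\<lambda>t \<omega>. proc t \<omega> *\<^sub>R v)"
  unfolding selfsimilar_additive_def
proof (intro conjI allI impI)
  show "prob_space \<Omega>" by (rule prob_space_\<Omega>)
  show "(\<lambda>\<omega>. proc t \<omega> *\<^sub>R v) \<in> \<Omega> \<rightarrow>\<^sub>M borel" for t by measurable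
  show "selfsimilar \<Omega> H (\<lambda>t \<omega>. proc t \<omega> *\<^sub>R v)"
    unfolding selfsimilar_def eq_fdd_def
  proof (intro allI impI, elim conjE)
    fix c :: real and J :: "real set" assume c: "0 < c" and J: "finite J"
    define \<phi> where "\<phi> y = (\<lambda>t\<in>J. y t *\<^sub>R v)" for y :: "real \<Rightarrow> real"
    have \<phi> [measurable]: "\<phi> \<in> Pi\<^sub>M J (\<lambda>_. borel) \<rightarrow>\<^sub>M Pi\<^sub>M J (\<lambda>_. borel)"
      unfolding \<phi>_def by (intro measurable_restrict) measurable
    have 1: "fdd \<Omega> (\<lambda>t \<omega>. z t \<omega> *\<^sub>R v) J = distr (distr \<Omega> (Pi\<^sub>M J (\<lambda>_. borel)) (\<lambda>\<omega>. \<lambda>t\<in>J. z t \<omega>)) (Pi\<^sub>M J (\<lambda>_. borel)) \<phi>"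
      if "\<And>t. z t \<in> borel_measurable \<Omega>" for z :: "real \<Rightarrow> sample \<Rightarrow> real"
    proof (subst distr_distr)
      show "(\<lambda>\<omega>. \<lambda>t\<in>J. z t \<omega>) \<in> \<Omega> \<rightarrow>\<^sub>M Pi\<^sub>M J (\<lambda>_. borel)"
        using that by (intro measurable_restrict) auto
      show "fdd \<Omega> (\<lambda>t \<omega>. z t \<omega> *\<^sub>R v) J = distr \<Omega> (Pi\<^sub>M J (\<lambda>_. borel)) (\<phi> \<circ> (\<lambda>\<omega>. \<lambda>t\<in>J. z t \<omega>))"
        unfolding fdd_def by (intro distr_cong refl) (auto simp: \<phi>_def comp_def restrict_def)
    qed (rule \<phi>)
    show "fdd \<Omega> (\<lambda>t \<omega>. proc (c * t) \<omega> *\<^sub>R v) J = fdd \<Omega> (\<lambda>t \<omega>. (c powr H) *\<^sub>R proc t \<omega> *\<^sub>R v) J"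
      using 1[of "\<lambda>t. proc (c * t)"] 1[of "\<lambda>t \<omega>. c powr H * proc t \<omega>"] proc_selfsimilar[OF J c] by simp
  qed
  show "independent_increments \<Omega> (\<lambda>t \<omega>. proc t \<omega> *\<^sub>R v)"
    unfolding independent_increments_def
  proof (intro allI impI, elim conjE)
    fix k :: nat and t :: "nat \<Rightarrow> real" assume t: "0 \<le> t 0" "strict_mono_on {..k} t"
    have "\<Omega>.indep_vars (\<lambda>_. borel) (\<lambda>i \<omega>. (proc (t (Suc i)) \<omega> - proc (t i) \<omega>) *\<^sub>R v) {..<k}"
      by (rule \<Omega>.indep_vars_compose2[OF proc_indep[OF t]]) measurable
    then show "\<Omega>.indep_vars (\<lambda>_. borel) (\<lambda>i \<omega>. proc (t (Suc i)) \<omega> *\<^sub>R v - proc (t i) \<omega> *\<^sub>R v) {..<k}"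
      by (simp add: scaleR_diff_left)
  qed
  show "AE \<omega> in \<Omega>. cadlag (\<lambda>t. proc t \<omega> *\<^sub>R v)"
    using AE_good
  proof eventually_elim
    case (elim \<omega>)
    show ?case
      unfolding cadlag_def
    proof (intro conjI allI impI)
      show "((\<lambda>t. proc t \<omega> *\<^sub>R v) \<longlongrightarrow> proc t \<omega> *\<^sub>R v) (at_right t)" for t
        by (intro tendsto_scaleR proc_right_continuous[OF elim] tendsto_const)
      fix t :: real assume "0 < t"
      then obtain l where "((\<lambda>t. proc t \<omega>) \<longlongrightarrow> l) (at_left t)"
        using Lim_at_left_mono[of t "\<lambda>t. proc t \<omega>"] proc_mono by blast
      then show "\<exists>l. ((\<lambda>t. proc t \<omega> *\<^sub>R v) \<longlongrightarrow> l) (at_left t)"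
        by (intro exI[of _ "l *\<^sub>R v"] tendsto_scaleR tendsto_const)
    qed
  qed
qed

end

section \<open>The upper limit is a positive constant\<close>

context marked_poisson
begin

lemma prob_components:
  assumes "finite J" and A: "\<And>m. m \<in> J \<Longrightarrow> A m \<in> sets blk"
  shows "\<Omega>.prob {\<omega>\<in>space \<Omega>. \<forall>m\<in>J. \<omega> m \<in> A m} = (\<Prod>m\<in>J. blk.prob (A m))"
proof -
  have "emeasure \<Omega> {\<omega>\<in>space \<Omega>. \<forall>m\<in>J. \<omega> m \<in> A m} = (\<Prod>m\<in>J. emeasure blk (A m))"
    unfolding \<Omega>_def using assms by (intro blks.emeasure_PiM_Collect) auto
  then show ?thesis
    by (simp add: \<Omega>.emeasure_eq_measure blk.emeasure_eq_measure prod_ennreal prod_nonneg)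
qed

text \<open>The supply of marks is independent of their number, so demanding a first point costs
  only a constant factor. This gives the lower bound on large jumps.\<close>

lemma emeasure_first_mark:
  assumes [measurable]: "S \<in> sets borel"
  shows "emeasure blk {b\<in>space blk. 1 \<le> fst b \<and> snd (snd b 0) \<in> S}
    = ennreal (measure_pmf.prob (poisson_pmf 1) {1..}) * emeasure \<pi> S"
proof -
  have "emeasure \<pi> S = (\<integral>\<^sup>+x. indicator S (snd x) \<partial>pnt)"
    by (subst nn_integral_pnt_mark) (auto simp: sets_mark)
  also have "\<dots> = (\<integral>\<^sup>+x. indicator {x. snd x \<in> S} x \<partial>pnt)"
    by (intro nn_integral_cong) (auto simp: indicator_def)
  also have "\<dots> = emeasure pnt {x. snd x \<in> S}"
  proof (rule nn_integral_indicator)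
    have "{x\<in>space pnt. snd x \<in> S} \<in> sets pnt" by measurable
    then show "{x. snd x \<in> S} \<in> sets pnt"
      by (simp add: sets_eq_imp_space_eq[OF sets_pnt] space_pair_measure)
  qed
  also have "\<dots> = emeasure pnts {p\<in>space pnts. p 0 \<in> {x. snd x \<in> S}}"
    unfolding pnts_def
  proof (rule pnts.emeasure_PiM_Collect_single[symmetric])
    have "{x\<in>space pnt. snd x \<in> S} \<in> sets pnt" by measurable
    then show "{x. snd x \<in> S} \<in> sets pnt"
      by (simp add: sets_eq_imp_space_eq[OF sets_pnt] space_pair_measure)
  qed simp
  finally have 1: "emeasure \<pi> S = emeasure pnts {p\<in>space pnts. snd (p 0) \<in> S}" by simp
  have "{b\<in>space blk. 1 \<le> fst b \<and> snd (snd b 0) \<in> S} = {1..} \<times> {p\<in>space pnts. snd (p 0) \<in> S}"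
    by auto
  moreover have "{p\<in>space pnts. snd (p 0) \<in> S} \<in> sets pnts" by measurable
  ultimately show ?thesis
    unfolding 1 blk_def by (simp add: pnts'.emeasure_pair_measure_Times measure_pmf.emeasure_eq_measure)
qed

lemma indep_sets_components:
  "\<Omega>.indep_sets (\<lambda>n. sets (vimage_algebra (space \<Omega>) (\<lambda>\<omega>. \<omega> (int n)) blk)) UNIV"
proof -
  have vs: "sets (vimage_algebra (space \<Omega>) (\<lambda>\<omega>. \<omega> (int n)) blk) = {{\<omega>. \<omega> (int n) \<in> A} | A. A \<in> sets blk}" for n
    by (subst sets_vimage_algebra2) (auto simp: vimage_def)
  show ?thesis
    unfolding \<Omega>.indep_sets_def vs
  proof (intro conjI ballI allI impI)
    fix n
    show "{{\<omega>. \<omega> (int n) \<in> A} |A. A \<in> sets blk} \<subseteq> \<Omega>.events"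
    proof safe
      fix A assume "A \<in> sets blk"
      from measurable_sets[OF component_measurable this, of "int n"]
      show "{\<omega>. \<omega> (int n) \<in> A} \<in> \<Omega>.events" by (simp add: vimage_def)
    qed
  next
    fix J :: "nat set" and E
    assume J: "J \<noteq> {}" "finite J" and E: "E \<in> (\<Pi> j\<in>J. {{\<omega>. \<omega> (int j) \<in> A} |A. A \<in> sets blk})"
    then have "\<forall>j\<in>J. \<exists>A. A \<in> sets blk \<and> E j = {\<omega>. \<omega> (int j) \<in> A}"
      by (fastforce simp: Pi_iff)
    then obtain A where A: "\<And>j. j \<in> J \<Longrightarrow> A j \<in> sets blk" "\<And>j. j \<in> J \<Longrightarrow> E j = {\<omega>. \<omega> (int j) \<in> A j}"
      by metis
    have "\<Omega>.prob (\<Inter>j\<in>J. E j) = \<Omega>.prob {\<omega>\<in>space \<Omega>. \<forall>m\<in>int ` J. \<omega> m \<in> A (nat m)}"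
      using A(2) J by (intro arg_cong[where f="\<Omega>.prob"]) auto
    also have "\<dots> = (\<Prod>m\<in>int ` J. blk.prob (A (nat m)))"
      using A J by (intro prob_components) auto
    also have "\<dots> = (\<Prod>j\<in>J. blk.prob (A j))"
      by (subst prod.reindex) auto
    also have "\<dots> = (\<Prod>j\<in>J. \<Omega>.prob (E j))"
      using A emeasure_component[OF A(1)]
      by (intro prod.cong) (auto simp: measure_def)
    finally show "\<Omega>.prob (\<Inter>j\<in>J. E j) = (\<Prod>j\<in>J. \<Omega>.prob (E j))" .
  qed
qed

end

text \<open>\<open>upper\<close> makes the upper limit finite, \<open>lower\<close> keeps it at
  least \<open>1 / c\<close>; the two series probe the growth function at different levels.\<close>

locale ss_growth = ss_poisson +
  fixes g :: "real \<Rightarrow> real" and c :: real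
  assumes g: "g \<in> G1"
    and upper: "(\<Sum>n. emeasure blk {b\<in>space blk. g (real n) < total b}) < \<infinity>"
    and c_pos: "0 < c"
    and lower: "(\<Sum>n. emeasure \<pi> {r. g (real (Suc n)) < c * \<bar>r\<bar>}) = \<infinity>"
begin

section \<open>The normalised process along its jump times\<close>

definition cnt :: "nat \<Rightarrow> sample \<Rightarrow> nat" where
  "cnt n \<omega> = fst (\<omega> (int n))"

definition loc :: "nat \<Rightarrow> nat \<Rightarrow> sample \<Rightarrow> real" where
  "loc n i \<omega> = real n + frac (fst (snd (\<omega> (int n)) i))"

definition jsize :: "nat \<Rightarrow> nat \<Rightarrow> sample \<Rightarrow> real" where
  "jsize n i \<omega> = \<bar>snd (snd (\<omega> (int n)) i)\<bar>"

text \<open>The contribution of block \<open>k\<close> at logarithmic time \<open>s\<close>, already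
  divided by \<open>exp (H * s)\<close>; that factor makes old points fade.\<close>

definition bval :: "nat \<Rightarrow> real \<Rightarrow> sample \<Rightarrow> real" where
  "bval k s \<omega> = (\<Sum>i<cnt k \<omega>. if loc k i \<omega> \<le> s then exp (H * (loc k i \<omega> - s)) * jsize k i \<omega> else 0)"

definition yval :: "nat \<Rightarrow> nat \<Rightarrow> real \<Rightarrow> sample \<Rightarrow> real" where
  "yval N n s \<omega> = (\<Sum>k\<in>{N..n}. bval k s \<omega>)"

text \<open>\<open>L N\<close> is the upper limit, along the jump times, of the normalised process built from the
  points in \<open>[N, \<infinity>)\<close> only. Between jumps the normalised process decreases, so nothing is lost by
  looking at jump times, and it depends on countably many random variables.\<close>

definition V :: "nat \<Rightarrow> nat \<Rightarrow> sample \<Rightarrow> ereal" where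
  "V N n \<omega> = (SUP i. if i < cnt n \<omega> then ereal (yval N n (loc n i \<omega>) \<omega> / g (loc n i \<omega>)) else 0)"

definition L :: "nat \<Rightarrow> sample \<Rightarrow> ereal" where
  "L N \<omega> = limsup (\<lambda>n. V N (n + N) \<omega>)"

lemma loc_bounds: "real n \<le> loc n i \<omega>" "loc n i \<omega> < real n + 1"
  by (auto simp: loc_def frac_lt_1)

lemma g_loc_pos: "0 < g (loc n i \<omega>)"
  using loc_bounds(1)[of n i \<omega>] by (intro G1_pos[OF g]) linarith

lemma bval_nonneg: "0 \<le> bval k s \<omega>"
  unfolding bval_def by (intro sum_nonneg) (auto simp: jsize_def)

lemma yval_nonneg: "0 \<le> yval N n s \<omega>"
  unfolding yval_def by (intro sum_nonneg bval_nonneg)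

lemma bval_le: "bval k s \<omega> \<le> exp (H * (real k + 1 - s)) * total (\<omega> (int k))"
proof -
  have "bval k s \<omega> \<le> (\<Sum>i<cnt k \<omega>. exp (H * (real k + 1 - s)) * jsize k i \<omega>)"
    unfolding bval_def
  proof (rule sum_mono)
    fix i
    have "exp (H * (loc k i \<omega> - s)) \<le> exp (H * (real k + 1 - s))"
      using loc_bounds(2)[of k i \<omega>] H_pos by simp
    then have "exp (H * (loc k i \<omega> - s)) * jsize k i \<omega> \<le> exp (H * (real k + 1 - s)) * jsize k i \<omega>"
      by (rule mult_right_mono) (simp add: jsize_def)
    then show "(if loc k i \<omega> \<le> s then exp (H * (loc k i \<omega> - s)) * jsize k i \<omega> else 0)
      \<le> exp (H * (real k + 1 - s)) * jsize k i \<omega>"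
      by (simp add: jsize_def)
  qed
  also have "\<dots> = exp (H * (real k + 1 - s)) * total (\<omega> (int k))"
    by (simp add: total_def jsize_def cnt_def sum_distrib_left)
  finally show ?thesis .
qed

lemma sum_bval_le: "(\<Sum>k<M. bval k s \<omega>) \<le> exp (H * (real M - s)) * (\<Sum>k<M. total (\<omega> (int k)))"
  unfolding sum_distrib_left
proof (rule sum_mono)
  fix k assume "k \<in> {..<M}"
  then have "real k + 1 \<le> real M" by simp
  then have "exp (H * (real k + 1 - s)) \<le> exp (H * (real M - s))" using H_pos by simp
  then have "exp (H * (real k + 1 - s)) * total (\<omega> (int k)) \<le> exp (H * (real M - s)) * total (\<omega> (int k))"
    by (rule mult_right_mono) (rule total_nonneg)
  with bval_le[of k s \<omega>] show "bval k s \<omega> \<le> exp (H * (real M - s)) * total (\<omega> (int k))" by simp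
qed

lemma V_nonneg: "0 \<le> V N n \<omega>"
  unfolding V_def by (rule SUP_upper2[of "cnt n \<omega>"]) auto

lemma V_le:
  assumes "0 \<le> y" "\<And>i. i < cnt n \<omega> \<Longrightarrow> yval N n (loc n i \<omega>) \<omega> / g (loc n i \<omega>) \<le> y"
  shows "V N n \<omega> \<le> ereal y"
  unfolding V_def using assms by (intro SUP_least) auto

lemma le_V: "i < cnt n \<omega> \<Longrightarrow> ereal (yval N n (loc n i \<omega>) \<omega> / g (loc n i \<omega>)) \<le> V N n \<omega>"
  unfolding V_def by (rule SUP_upper2[of i]) auto

text \<open>The space is left open: the statement is used both for \<Omega> and for the
  sub-\<sigma>-algebra generated by the blocks from \<open>N\<close> on.\<close>

lemma L_measurable:
  assumes M: "\<And>n. N \<le> n \<Longrightarrow> (\<lambda>\<omega>. \<omega> (int n)) \<in> M \<rightarrow>\<^sub>M blk"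
  shows "L N \<in> borel_measurable M"
proof -
  \<comment> \<open>\<open>g\<close> is monotone on \<open>[0, \<infinity>)\<close> only, hence the
    truncated argument.\<close>
  have "mono (\<lambda>u. g (max 0 u))" using G1_mono[OF g] by (auto simp: mono_def max_def)
  then have gm: "(\<lambda>u. g (max 0 u)) \<in> borel_measurable borel" by (rule borel_measurable_mono)
  have cnt: "cnt n \<in> M \<rightarrow>\<^sub>M count_space UNIV" if "N \<le> n" for n
    unfolding cnt_def[abs_def] by (rule measurable_compose[OF M[OF that] count_measurable])
  have pt: "(\<lambda>\<omega>. snd (\<omega> (int n)) i) \<in> M \<rightarrow>\<^sub>M borel \<Otimes>\<^sub>M borel" if "N \<le> n" for n i
    by (rule measurable_compose[OF M[OF that] point_measurable])
  have loc: "loc n i \<in> borel_measurable M" if "N \<le> n" for n i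
    unfolding loc_def[abs_def] using pt[OF that] by measurable
  have jsize: "jsize n i \<in> borel_measurable M" if "N \<le> n" for n i
    unfolding jsize_def[abs_def] using pt[OF that] by measurable
  have bval: "(\<lambda>\<omega>. bval k (loc n i \<omega>) \<omega>) \<in> borel_measurable M" if "N \<le> n" "N \<le> k" for n i k
    unfolding bval_def
  proof (rule sum_lessThan_measurable[OF cnt[OF that(2)]])
    fix j
    note [measurable] = loc[OF that(1), of i] loc[OF that(2), of j] jsize[OF that(2), of j]
    show "(\<lambda>\<omega>. if loc k j \<omega> \<le> loc n i \<omega> then exp (H * (loc k j \<omega> - loc n i \<omega>)) * jsize k j \<omega> else 0) \<in> borel_measurable M"
      by measurable
  qed
  have yval: "(\<lambda>\<omega>. yval N n (loc n i \<omega>) \<omega>) \<in> borel_measurable M" if "N \<le> n" for n i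
    unfolding yval_def using that by (intro borel_measurable_sum bval) auto
  have V: "V N n \<in> borel_measurable M" if "N \<le> n" for n
    unfolding V_def[abs_def]
  proof (rule borel_measurable_SUP)
    fix i
    note [measurable] = cnt[OF that] yval[OF that, of i] loc[OF that, of i]
    have "(\<lambda>\<omega>. g (max 0 (loc n i \<omega>))) \<in> borel_measurable M"
      by (rule measurable_compose[OF loc[OF that] gm])
    moreover have "max 0 (loc n i \<omega>) = loc n i \<omega>" for \<omega>
      using loc_bounds(1)[of n i \<omega>] by simp
    ultimately have [measurable]: "(\<lambda>\<omega>. g (loc n i \<omega>)) \<in> borel_measurable M" by simp
    show "(\<lambda>\<omega>. if i < cnt n \<omega> then ereal (yval N n (loc n i \<omega>) \<omega> / g (loc n i \<omega>)) else 0) \<in> borel_measurable M"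
      by measurable
  qed simp
  show ?thesis
    unfolding L_def[abs_def] by (intro borel_measurable_limsup V) simp
qed

text \<open>At logarithmic time \<open>s\<close> the first \<open>N\<close> blocks contribute at
  most \<open>exp (- H * s) * Q\<close>, which tends to \<open>0\<close>. Forgetting them leaves the
  upper limit unchanged and makes it a tail variable.\<close>

lemma L_eq: "L N \<omega> = L 0 \<omega>"
proof -
  define Q where "Q = exp (H * real N) * (\<Sum>k<N. total (\<omega> (int k))) / g 0"
  have Q0: "0 \<le> Q" unfolding Q_def
    using G1_pos[OF g, of 0] by (intro divide_nonneg_pos mult_nonneg_nonneg sum_nonneg total_nonneg) auto
  have "V N n \<omega> \<le> V 0 n \<omega>" for n
    unfolding V_def yval_def
  proof (intro SUP_mono bexI)
    fix i
    show "(if i < cnt n \<omega> then ereal ((\<Sum>k\<in>{N..n}. bval k (loc n i \<omega>) \<omega>) / g (loc n i \<omega>)) else 0)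
      \<le> (if i < cnt n \<omega> then ereal ((\<Sum>k\<in>{0..n}. bval k (loc n i \<omega>) \<omega>) / g (loc n i \<omega>)) else 0)"
      using g_loc_pos[of n i \<omega>] by (auto intro!: divide_right_mono sum_mono2 bval_nonneg)
  qed auto
  then have 1: "L N \<omega> \<le> limsup (\<lambda>n. V 0 (n + N) \<omega>)"
    unfolding L_def by (intro Limsup_mono always_eventually) auto
  have le: "V 0 n \<omega> \<le> ereal (exp (- H * real n) * Q) + V N n \<omega>" if "N \<le> n" for n
    unfolding V_def[of 0]
  proof (rule SUP_least)
    fix i
    show "(if i < cnt n \<omega> then ereal (yval 0 n (loc n i \<omega>) \<omega> / g (loc n i \<omega>)) else 0) \<le> ereal (exp (- H * real n) * Q) + V N n \<omega>"
    proof (cases "i < cnt n \<omega>")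
      case True
      let ?s = "loc n i \<omega>"
      have s: "real n \<le> ?s" by (rule loc_bounds)
      have gs: "g 0 \<le> g ?s" using s by (intro G1_mono[OF g]) auto
      have "{0..n} = {..<N} \<union> {N..n}" "{..<N} \<inter> {N..n} = {}" using that by auto
      then have "yval 0 n ?s \<omega> = (\<Sum>k<N. bval k ?s \<omega>) + yval N n ?s \<omega>"
        unfolding yval_def by (simp add: sum.union_disjoint)
      then have "yval 0 n ?s \<omega> / g ?s = (\<Sum>k<N. bval k ?s \<omega>) / g ?s + yval N n ?s \<omega> / g ?s"
        by (simp add: add_divide_distrib)
      also have "(\<Sum>k<N. bval k ?s \<omega>) / g ?s \<le> (exp (H * (real N - ?s)) * (\<Sum>k<N. total (\<omega> (int k)))) / g 0"
        using gs G1_pos[OF g, of 0] sum_bval_le[of ?s \<omega> N] by (intro frac_le) (auto intro!: mult_nonneg_nonneg sum_nonneg total_nonneg)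
      also have "\<dots> = exp (- H * ?s) * Q"
        by (simp add: Q_def right_diff_distrib exp_diff exp_minus field_simps)
      also have "\<dots> \<le> exp (- H * real n) * Q"
        using s H_pos Q0 by (intro mult_right_mono) auto
      finally have "ereal (yval 0 n ?s \<omega> / g ?s) \<le> ereal (exp (- H * real n) * Q) + ereal (yval N n ?s \<omega> / g ?s)"
        by simp
      also have "\<dots> \<le> ereal (exp (- H * real n) * Q) + V N n \<omega>"
        by (intro add_left_mono le_V True)
      finally show ?thesis using True by simp
    next
      case False
      have "0 \<le> ereal (exp (- H * real n) * Q) + V N n \<omega>"
        using V_nonneg[of N n \<omega>] Q0 by (intro add_nonneg_nonneg) auto
      then show ?thesis using False by simp
    qed
  qed
  have lim: "(\<lambda>n. ereal (exp (- H * real (n + N)) * Q)) \<longlonglongrightarrow> 0"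
  proof -
    have "(\<lambda>n. exp (- H * real (n + N)) * Q) \<longlonglongrightarrow> 0"
      using H_pos by real_asymp
    then show ?thesis by (simp add: zero_ereal_def)
  qed
  have "limsup (\<lambda>n. V 0 (n + N) \<omega>) \<le> limsup (\<lambda>n. ereal (exp (- H * real (n + N)) * Q) + V N (n + N) \<omega>)"
  proof (intro Limsup_mono always_eventually allI)
    show "V 0 (n + N) \<omega> \<le> ereal (exp (- H * real (n + N)) * Q) + V N (n + N) \<omega>" for n
      by (rule le) simp
  qed
  also have "\<dots> = 0 + L N \<omega>"
    unfolding L_def by (rule ereal_limsup_lim_add[OF lim]) simp
  finally have "limsup (\<lambda>n. V 0 (n + N) \<omega>) = L N \<omega>" using 1 by simp
  then show ?thesis
    using limsup_shift_k[of "\<lambda>n. V 0 n \<omega>" N] by (simp add: L_def)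
qed

lemma prob_L_zero_one: "\<Omega>.prob {\<omega>\<in>space \<Omega>. L 0 \<omega> \<le> a} = 0 \<or> \<Omega>.prob {\<omega>\<in>space \<Omega>. L 0 \<omega> \<le> a} = 1"
proof -
  define A where "A n = sets (vimage_algebra (space \<Omega>) (\<lambda>\<omega>. \<omega> (int n)) blk)" for n
  show ?thesis
  proof (rule \<Omega>.kolmogorov_0_1_law[of A])
    show "sigma_algebra (space \<Omega>) (A n)" for n
      using sets.sigma_algebra_axioms[of "vimage_algebra (space \<Omega>) (\<lambda>\<omega>. \<omega> (int n)) blk"]
      by (simp add: A_def)
    show "\<Omega>.indep_sets A UNIV"
      unfolding A_def[abs_def] by (rule indep_sets_components)
    show "{\<omega>\<in>space \<Omega>. L 0 \<omega> \<le> a} \<in> \<Omega>.tail_events A"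
      unfolding \<Omega>.tail_events_def
    proof (rule InterI, safe)
      fix N
      define M where "M = sigma (space \<Omega>) (\<Union> (A ` {N..}))"
      have M: "space M = UNIV" "sets M = sigma_sets (space \<Omega>) (\<Union> (A ` {N..}))"
        by (auto simp: M_def)
      have "L N \<in> borel_measurable M"
      proof (rule L_measurable)
        fix n assume n: "N \<le> n"
        show "(\<lambda>\<omega>. \<omega> (int n)) \<in> M \<rightarrow>\<^sub>M blk"
        proof (rule measurableI)
          fix S assume "S \<in> sets blk"
          then have "(\<lambda>\<omega>. \<omega> (int n)) -` S \<inter> space \<Omega> \<in> A n"
            unfolding A_def by (subst sets_vimage_algebra2) auto
          then show "(\<lambda>\<omega>. \<omega> (int n)) -` S \<inter> space M \<in> sets M"
            using n unfolding M by (auto intro!: sigma_sets.Basic)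
        qed simp
      qed
      then have "{\<omega>\<in>space M. L N \<omega> \<le> a} \<in> sets M"
        using measurable_sets[of "L N" M borel "{..a}"] by (simp add: vimage_def Int_def conj_commute)
      then show "{\<omega>\<in>space \<Omega>. L 0 \<omega> \<le> a} \<in> sigma_sets (space \<Omega>) (\<Union> (A ` {N..}))"
        by (simp add: M L_eq[of N])
    qed
  qed
qed

text \<open>Eventually each block total is at most \<open>g n\<close>, so the weighted past is a
  geometric series dominated by its last term.\<close>

lemma AE_L_finite: "AE \<omega> in \<Omega>. L 0 \<omega> < \<infinity>"
proof -
  have "AE \<omega> in \<Omega>. \<exists>a. \<forall>n\<ge>a. total (\<omega> (int n)) \<le> g (real n)"
    by (rule AE_component_eventually_le[OF _ upper]) measurable
  then show ?thesis
  proof eventually_elim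
    case (elim \<omega>)
    then obtain a where a: "\<And>n. a \<le> n \<Longrightarrow> total (\<omega> (int n)) \<le> g (real n)" by blast
    define y where "y n = (\<Sum>k<n. exp (H * real k) * total (\<omega> (int k)))" for n
    have H1: "1 < exp H" using H_pos by simp
    have step: "y (Suc n) \<le> y n + 1 * (exp (H * real n) * g (real n))" if "a \<le> n" for n
      using a[OF that] by (simp add: y_def)
    obtain K where K: "0 \<le> K" "\<And>n. a \<le> n \<Longrightarrow> y n \<le> K + 1 / (exp H - 1) * (exp (H * real n) * g (real n))"
      using geometric_growth[OF g H_pos zero_le_one step] by blast
    \<comment> \<open>\<open>exp H\<close> pays for the position inside a block,
      \<open>K / g 0\<close> absorbs the additive constant into the normalisation, and the remaining
      terms are the past blocks and the current one.\<close>
    define B where "B = exp H * (K / g 0 + 1 / (exp H - 1) + 1)"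
    have B0: "0 \<le> B"
      using K(1) H1 G1_pos[OF g, of 0] by (auto simp: B_def intro!: mult_nonneg_nonneg add_nonneg_nonneg)
    have "V 0 n \<omega> \<le> ereal B" if n: "a \<le> n" for n
    proof (rule V_le[OF B0])
      fix i
      let ?s = "loc n i \<omega>"
      have s: "real n \<le> ?s" by (rule loc_bounds)
      have gs: "g (real n) \<le> g ?s" using s by (intro G1_mono[OF g]) auto
      have g0: "0 < g 0" "0 < g (real n)" "g 0 \<le> g (real n)"
        using G1_pos[OF g, of 0] G1_pos[OF g, of "real n"] G1_mono[OF g, of 0 "real n"] by auto
      have "yval 0 n ?s \<omega> \<le> (\<Sum>k<Suc n. exp (H * (1 - ?s)) * (exp (H * real k) * total (\<omega> (int k))))"
        unfolding yval_def atLeast0AtMost lessThan_Suc_atMost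
        by (intro sum_mono order_trans[OF bval_le]) (simp add: distrib_left right_diff_distrib exp_add exp_diff mult_ac)
      also have "\<dots> = exp (H * (1 - ?s)) * y (Suc n)"
        by (simp only: y_def sum_distrib_left)
      also have "\<dots> \<le> exp (H * (1 - real n)) * y (Suc n)"
        using s H_pos by (intro mult_right_mono) (auto simp: y_def intro!: sum_nonneg total_nonneg add_nonneg_nonneg mult_nonneg_nonneg)
      also have "y (Suc n) \<le> K + (1 / (exp H - 1) + 1) * (exp (H * real n) * g (real n))"
        using step[OF n] K(2)[OF n] by (simp add: distrib_right)
      also have "K \<le> K / g 0 * (exp (H * real n) * g (real n))"
      proof -
        have "g 0 * 1 \<le> g (real n) * exp (H * real n)"
          using g0 H_pos by (intro mult_mono) auto
        then have "K * g 0 \<le> K * (exp (H * real n) * g (real n))"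
          using K(1) by (intro mult_left_mono) (auto simp: mult.commute)
        then show ?thesis using g0 by (simp add: field_simps)
      qed
      also have "exp (H * (1 - real n)) * (K / g 0 * (exp (H * real n) * g (real n)) + (1 / (exp H - 1) + 1) * (exp (H * real n) * g (real n)))
         = B * g (real n)"
        by (simp add: B_def right_diff_distrib exp_diff field_simps)
      also have "B * g (real n) \<le> B * g ?s" using gs B0 by (rule mult_left_mono)
      finally have "yval 0 n ?s \<omega> \<le> B * g ?s" by simp
      then show "yval 0 n ?s \<omega> / g ?s \<le> B"
        using g_loc_pos[of n i \<omega>] by (simp add: pos_divide_le_eq)
    qed
    then have "L 0 \<omega> \<le> ereal B"
      unfolding L_def by (intro Limsup_bounded) (auto simp: eventually_sequentially)
    then show ?case using le_less_trans by fastforce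
  qed
qed

text \<open>By the second Borel-Cantelli lemma, infinitely many blocks have a first mark above
  \<open>g (Suc n) / c\<close>, hence above \<open>g / c\<close> at its own jump time.\<close>

lemma AE_L_ge: "AE \<omega> in \<Omega>. ereal (1 / c) \<le> L 0 \<omega>"
proof -
  define S where "S n = {r. g (real (Suc n)) < c * \<bar>r\<bar>}" for n
  have [measurable]: "S n \<in> sets borel" for n unfolding S_def by measurable
  define B where "B n = {b\<in>space blk. 1 \<le> fst b \<and> snd (snd b 0) \<in> S n}" for n
  have [measurable]: "B n \<in> sets blk" for n unfolding B_def by measurable
  define E where "E n = {\<omega>\<in>space \<Omega>. \<omega> (int n) \<in> B n}" for n
  have [measurable]: "E n \<in> \<Omega>.events" for n unfolding E_def by measurable
  define p where "p = measure_pmf.prob (poisson_pmf 1) {1::nat..}"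
  have p: "0 < p"
  proof -
    have "0 < measure_pmf.prob (poisson_pmf 1) {1::nat}" by (simp add: measure_pmf_single)
    also have "\<dots> \<le> p" unfolding p_def by (intro measure_pmf.finite_measure_mono) auto
    finally show ?thesis .
  qed
  have EB: "emeasure \<Omega> (E n) = emeasure blk (B n)" for n
    using emeasure_component[of "B n" "int n"] by (simp add: E_def)
  have EB': "\<Omega>.prob (E n) = blk.prob (B n)" for n using EB by (simp add: measure_def)
  have em: "emeasure \<Omega> (E n) = ennreal p * emeasure \<pi> (S n)" for n
    unfolding EB B_def p_def by (rule emeasure_first_mark) measurable
  have "AE \<omega> in \<Omega>. \<forall>a. \<exists>n\<ge>a. \<omega> \<in> E n"
  proof (rule \<Omega>.borel_cantelli_AE2)
    fix a b :: nat
    have "\<Omega>.prob {\<omega>\<in>space \<Omega>. \<forall>n\<in>{a..<b}. \<omega> \<notin> E n} = \<Omega>.prob {\<omega>\<in>space \<Omega>. \<forall>m\<in>int ` {a..<b}. \<omega> m \<in> space blk - B (nat m)}"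
      by (intro arg_cong[where f="\<Omega>.prob"]) (auto simp: E_def)
    also have "\<dots> = (\<Prod>m\<in>int ` {a..<b}. blk.prob (space blk - B (nat m)))"
    proof (rule prob_components)
      show "space blk - B (nat m) \<in> sets blk" for m by measurable
    qed simp
    also have "\<dots> = (\<Prod>n\<in>{a..<b}. blk.prob (space blk - B n))"
      by (subst prod.reindex) auto
    also have "\<dots> = (\<Prod>n\<in>{a..<b}. 1 - \<Omega>.prob (E n))"
      by (intro prod.cong refl) (subst blk.prob_compl, auto simp: EB')
    finally show "\<Omega>.prob {\<omega>\<in>space \<Omega>. \<forall>n\<in>{a..<b}. \<omega> \<notin> E n} = \<dots>" .
  next
    show "\<not> summable (\<lambda>n. \<Omega>.prob (E n))"
    proof
      assume "summable (\<lambda>n. \<Omega>.prob (E n))"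
      then have "(\<Sum>n. ennreal (\<Omega>.prob (E n))) \<noteq> \<top>"
        by (intro ennreal_suminf_neq_top) auto
      moreover have "(\<Sum>n. ennreal (\<Omega>.prob (E n))) = ennreal p * (\<Sum>n. emeasure \<pi> (S n))"
        by (simp add: \<Omega>.emeasure_eq_measure[symmetric] em ennreal_suminf_cmult)
      ultimately show False
        using lower p by (simp add: S_def ennreal_mult_eq_top_iff)
    qed
  qed measurable
  then show ?thesis
  proof eventually_elim
    case (elim \<omega>)
    show ?case
    proof (rule ccontr)
      assume "\<not> ?thesis"
      then have "limsup (\<lambda>n. V 0 n \<omega>) < ereal (1 / c)" by (simp add: L_def)
      then have "\<forall>\<^sub>F n in sequentially. V 0 n \<omega> < ereal (1 / c)" by (rule Limsup_lessD)
      then obtain a where a: "\<And>n. a \<le> n \<Longrightarrow> V 0 n \<omega> < ereal (1 / c)"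
        by (auto simp: eventually_sequentially)
      obtain n where n: "a \<le> n" "\<omega> \<in> E n" using elim by blast
      then have cn: "0 < cnt n \<omega>" and sz: "g (real (Suc n)) < c * jsize n 0 \<omega>"
        by (auto simp: E_def B_def S_def cnt_def jsize_def)
      let ?s = "loc n 0 \<omega>"
      have "g ?s \<le> g (real (Suc n))"
        using loc_bounds[of n 0 \<omega>] by (intro G1_mono[OF g]) auto
      with sz have 1: "g ?s / c \<le> jsize n 0 \<omega>" using c_pos by (simp add: pos_divide_le_eq mult.commute)
      \<comment> \<open>At its own jump time a point has exponential weight \<open>1\<close>, and
        the other points only add to it.\<close>
      also have "jsize n 0 \<omega> = (\<Sum>i\<in>{0}. if loc n i \<omega> \<le> ?s then exp (H * (loc n i \<omega> - ?s)) * jsize n i \<omega> else 0)"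
        by simp
      also have "\<dots> \<le> bval n ?s \<omega>"
        unfolding bval_def using cn by (intro sum_mono2) (auto simp: jsize_def)
      also have "\<dots> = (\<Sum>k\<in>{n}. bval k ?s \<omega>)" by simp
      also have "\<dots> \<le> yval 0 n ?s \<omega>"
        unfolding yval_def by (intro sum_mono2 bval_nonneg) auto
      finally have "1 / c \<le> yval 0 n ?s \<omega> / g ?s"
        using g_loc_pos[of n 0 \<omega>] c_pos by (simp add: field_simps)
      then have "ereal (1 / c) \<le> V 0 n \<omega>"
        using le_V[OF cn, of 0] by (meson ereal_less_eq(3) order_trans)
      with a[OF n(1)] show False by simp
    qed
  qed
qed

text \<open>The constant is the infimum of the levels that bound the upper limit almost surely.
  Finiteness makes this set nonempty, and \<open>1 / c\<close> bounds it from below.\<close>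

lemma L_const: "\<exists>C>0. AE \<omega> in \<Omega>. L 0 \<omega> = ereal C"
proof -
  have [measurable]: "L 0 \<in> borel_measurable \<Omega>" by (rule L_measurable) measurable
  define S where "S = {a::real. \<Omega>.prob {\<omega>\<in>space \<Omega>. L 0 \<omega> \<le> ereal a} = 1}"
  have S_AE: "AE \<omega> in \<Omega>. L 0 \<omega> \<le> ereal a" if "a \<in> S" for a
  proof -
    have "{\<omega>\<in>space \<Omega>. L 0 \<omega> \<le> ereal a} \<in> \<Omega>.events" by measurable
    from \<Omega>.AE_in_set_eq_1[OF this] that show ?thesis by (simp add: S_def)
  qed
  have not_S_AE: "AE \<omega> in \<Omega>. ereal a < L 0 \<omega>" if "a \<notin> S" for a
  proof -
    have "\<Omega>.prob {\<omega>\<in>space \<Omega>. L 0 \<omega> \<le> ereal a} = 0"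
      using prob_L_zero_one[of "ereal a"] that by (simp add: S_def)
    then have "AE \<omega> in \<Omega>. \<omega> \<notin> {\<omega>\<in>space \<Omega>. L 0 \<omega> \<le> ereal a}"
    proof (intro AE_not_in null_setsI)
      show "{\<omega>\<in>space \<Omega>. L 0 \<omega> \<le> ereal a} \<in> \<Omega>.events" by measurable
    qed (simp add: \<Omega>.emeasure_eq_measure)
    then show ?thesis by (simp add: not_le)
  qed
  have "S \<noteq> {}"
  proof
    assume "S = {}"
    then have "AE \<omega> in \<Omega>. \<forall>n::nat. ereal (real n) < L 0 \<omega>"
      using not_S_AE by (subst AE_all_countable) auto
    with AE_L_finite have "AE \<omega> in \<Omega>. False"
    proof eventually_elim
      case (elim \<omega>)
      obtain r where r: "L 0 \<omega> \<le> ereal r" using elim(1) by (cases "L 0 \<omega>") auto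
      obtain n :: nat where "r \<le> real n" using real_arch_simple by blast
      with r have "L 0 \<omega> \<le> ereal (real n)" by (meson ereal_less_eq(3) order_trans)
      with elim(2) show False by (meson leD)
    qed
    then show False by (simp add: \<Omega>.AE_False)
  qed
  have lb: "1 / c \<le> a" if "a \<in> S" for a
  proof (rule ccontr)
    assume na: "\<not> 1 / c \<le> a"
    from S_AE[OF that] AE_L_ge have "AE \<omega> in \<Omega>. False"
    proof eventually_elim
      case (elim \<omega>)
      then have "ereal (1 / c) \<le> ereal a" by (meson order_trans)
      with na show False by simp
    qed
    then show False by (simp add: \<Omega>.AE_False)
  qed
  then have bdd: "bdd_below S" by (intro bdd_belowI[of _ "1 / c"])
  define C where "C = Inf S"
  have C: "0 < C"
    using cInf_greatest[OF \<open>S \<noteq> {}\<close> lb] c_pos by (auto simp: C_def intro: less_le_trans[of 0 "1 / c"])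
  have "AE \<omega> in \<Omega>. \<forall>n::nat. ereal (C - 1 / Suc n) < L 0 \<omega> \<and> L 0 \<omega> \<le> ereal (C + 1 / Suc n)"
  proof (subst AE_all_countable, rule allI, rule AE_conjI)
    fix n :: nat
    have "C - 1 / Suc n \<notin> S"
      using cInf_lower[OF _ bdd, of "C - 1 / Suc n"] by (auto simp: C_def)
    then show "AE \<omega> in \<Omega>. ereal (C - 1 / Suc n) < L 0 \<omega>" by (rule not_S_AE)
    obtain a where a: "a \<in> S" "a < C + 1 / Suc n"
      using cInf_lessD[OF \<open>S \<noteq> {}\<close>, of "C + 1 / Suc n"] by (auto simp: C_def)
    from S_AE[OF a(1)] show "AE \<omega> in \<Omega>. L 0 \<omega> \<le> ereal (C + 1 / Suc n)"
      by eventually_elim (use a(2) in \<open>auto intro: order_trans\<close>)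
  qed
  then have "AE \<omega> in \<Omega>. L 0 \<omega> = ereal C"
  proof eventually_elim
    case (elim \<omega>)
    have 1: "(\<lambda>n. ereal (C - 1 / Suc n)) \<longlonglongrightarrow> ereal C" "(\<lambda>n. ereal (C + 1 / Suc n)) \<longlonglongrightarrow> ereal C"
      by (simp_all, real_asymp+)
    show ?case
    proof (rule antisym)
      show "L 0 \<omega> \<le> ereal C"
        by (rule LIMSEQ_le_const[OF 1(2)]) (use elim in auto)
      show "ereal C \<le> L 0 \<omega>"
        by (rule LIMSEQ_le_const2[OF 1(1)]) (use elim in \<open>auto intro: less_imp_le\<close>)
    qed
  qed
  with C show ?thesis by blast
qed

text \<open>The points before time \<open>1\<close> enter as a constant independent of
  \<open>s\<close>, so they disappear after normalisation.\<close>

lemma proc_exp: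
  assumes "good \<omega>" "0 \<le> s"
  shows "proc (exp s) \<omega> = enn2real (psum past \<omega>) + exp (H * s) * yval 0 (nat \<lfloor>s\<rfloor>) s \<omega>"
proof -
  define mid where "mid T r = (if 0 \<le> T \<and> T \<le> s then exp (H * T) * \<bar>r\<bar> else 0)" for T r :: real
  have "jump 0 (exp s) = (\<lambda>T r. past T r + mid T r)"
    using \<open>0 \<le> s\<close> by (auto simp: jump_def past_def mid_def fun_eq_iff)
  moreover have "psum (\<lambda>T r. past T r + mid T r) \<omega> = psum past \<omega> + psum mid \<omega>"
    by (rule psum_add) (auto simp: past_def mid_def)
  ultimately have 1: "psum (jump 0 (exp s)) \<omega> = psum past \<omega> + psum mid \<omega>"
    by simp
  have "psum mid \<omega> = (\<Sum>m\<in>int ` {0..nat \<lfloor>s\<rfloor>}. ennreal (bsum mid m (\<omega> m)))"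
    unfolding psum_def
  proof (rule nn_integral_count_space')
    fix m assume m: "m \<notin> int ` {0..nat \<lfloor>s\<rfloor>}"
    have "m < 0 \<or> s < m"
    proof (rule ccontr)
      assume "\<not> ?thesis"
      then have "m = int (nat m)" "nat m \<in> {0..nat \<lfloor>s\<rfloor>}" by (auto simp: le_floor_iff nat_mono)
      with m show False by blast
    qed
    then have "bsum mid m (\<omega> m) = bsum (\<lambda>_ _. 0) m (\<omega> m)"
      by (intro bsum_cong) (auto simp: mid_def)
    then show "ennreal (bsum mid m (\<omega> m)) = 0" by (simp add: bsum_def)
  qed auto
  also have "\<dots> = (\<Sum>k\<in>{0..nat \<lfloor>s\<rfloor>}. ennreal (exp (H * s) * bval k s \<omega>))"
  proof (subst sum.reindex)
    have "bsum mid (int k) (\<omega> (int k)) = exp (H * s) * bval k s \<omega>" for k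
      unfolding bsum_def bval_def sum_distrib_left cnt_def
      by (intro sum.cong refl) (auto simp: mid_def loc_def jsize_def right_diff_distrib exp_diff)
    then show "sum ((\<lambda>m. ennreal (bsum mid m (\<omega> m))) \<circ> int) {0..nat \<lfloor>s\<rfloor>} = (\<Sum>k\<in>{0..nat \<lfloor>s\<rfloor>}. ennreal (exp (H * s) * bval k s \<omega>))"
      by simp
  qed simp
  also have "\<dots> = ennreal (exp (H * s) * yval 0 (nat \<lfloor>s\<rfloor>) s \<omega>)"
    by (simp add: yval_def sum_distrib_left bval_nonneg)
  finally have 2: "psum mid \<omega> = ennreal (exp (H * s) * yval 0 (nat \<lfloor>s\<rfloor>) s \<omega>)" .
  show ?thesis
    using assms(1) 1 2 yval_nonneg[of 0 "nat \<lfloor>s\<rfloor>" s \<omega>]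
    by (simp add: proc_def val_def good_def enn2real_plus)
qed

text \<open>Since the last jump before \<open>s\<close> the normalised value has only decreased
  while \<open>g\<close> has increased, so the bound at that jump persists. If no jump from block
  \<open>M\<close> on precedes \<open>s\<close>, only the fading early blocks remain.\<close>

lemma yval_le_of_V:
  assumes V: "\<And>n. M \<le> n \<Longrightarrow> V 0 n \<omega> < ereal y" and "real M \<le> s"
  shows "yval 0 (nat \<lfloor>s\<rfloor>) s \<omega> \<le> y * g s + exp (H * (real M - s)) * (\<Sum>k<M. total (\<omega> (int k)))"
proof -
  define m where "m = nat \<lfloor>s\<rfloor>"
  have m: "M \<le> m" "real m \<le> s" using assms(2) by (auto simp: m_def le_nat_floor)
  have y: "0 \<le> y" using V[of M] V_nonneg[of 0 M \<omega>] by (metis ereal_less_eq(5) le_less_trans less_imp_le order_refl)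
  have gs: "0 < g s" using m(2) by (intro G1_pos[OF g]) linarith
  have Q0: "0 \<le> exp (H * (real M - s)) * (\<Sum>k<M. total (\<omega> (int k)))"
    by (intro mult_nonneg_nonneg sum_nonneg total_nonneg) auto
  define P where "P = {(k, i). k \<le> m \<and> i < cnt k \<omega> \<and> loc k i \<omega> \<le> s}"
  show ?thesis
  proof (cases "\<exists>(k, i)\<in>P. M \<le> k")
    case True
    then obtain k0 i0 where k0: "(k0, i0) \<in> P" "M \<le> k0" by blast
    have "finite P"
      by (rule finite_subset[of _ "SIGMA k:{..m}. {..<cnt k \<omega>}"]) (auto simp: P_def)
    define \<tau> where "\<tau> = Max ((\<lambda>(k, i). loc k i \<omega>) ` P)"
    have "\<tau> \<in> (\<lambda>(k, i). loc k i \<omega>) ` P"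
      unfolding \<tau>_def using \<open>finite P\<close> k0 by (intro Max_in) auto
    then obtain k1 i1 where k1: "(k1, i1) \<in> P" "\<tau> = loc k1 i1 \<omega>" by auto
    have max: "loc k i \<omega> \<le> \<tau>" if "(k, i) \<in> P" for k i
      unfolding \<tau>_def using \<open>finite P\<close> that by (intro Max_ge) force+
    have \<tau>s: "\<tau> \<le> s" "k1 \<le> m" "i1 < cnt k1 \<omega>" using k1 by (auto simp: P_def)
    \<comment> \<open>The last jump is not earlier than some point of a block from \<open>M\<close>
      on, so its own block index is at least \<open>M\<close> and the hypothesis applies
      there.\<close>
    have "real M < real k1 + 1"
      using max[OF k0(1)] loc_bounds(1)[of k0 i0 \<omega>] loc_bounds(2)[of k1 i1 \<omega>] k0(2) k1(2) by linarith
    then have Mk1: "M \<le> k1" by linarith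
    have "bval k s \<omega> = exp (- (H * (s - \<tau>))) * bval k \<tau> \<omega>" if "k \<le> m" for k
      unfolding bval_def sum_distrib_left
    proof (rule sum.cong[OF refl])
      fix i assume i: "i \<in> {..<cnt k \<omega>}"
      then have "loc k i \<omega> \<le> s \<longleftrightarrow> loc k i \<omega> \<le> \<tau>"
        using max[of k i] \<tau>s that by (auto simp: P_def)
      then show "(if loc k i \<omega> \<le> s then exp (H * (loc k i \<omega> - s)) * jsize k i \<omega> else 0)
        = exp (- (H * (s - \<tau>))) * (if loc k i \<omega> \<le> \<tau> then exp (H * (loc k i \<omega> - \<tau>)) * jsize k i \<omega> else 0)"
        by (simp add: exp_add[symmetric] algebra_simps)
    qed
    then have "yval 0 m s \<omega> = exp (- (H * (s - \<tau>))) * yval 0 m \<tau> \<omega>"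
      by (simp add: yval_def sum_distrib_left)
    also have "\<dots> \<le> 1 * yval 0 m \<tau> \<omega>"
      using \<tau>s H_pos by (intro mult_right_mono yval_nonneg) auto
    also have "yval 0 m \<tau> \<omega> = yval 0 k1 \<tau> \<omega>"
      unfolding yval_def
    proof (rule sum.mono_neutral_right)
      show "\<forall>k\<in>{0..m} - {0..k1}. bval k \<tau> \<omega> = 0"
      proof
        fix k assume k: "k \<in> {0..m} - {0..k1}"
        have "\<not> loc k i \<omega> \<le> \<tau>" for i
        proof -
          have "\<tau> < real k1 + 1" using loc_bounds(2)[of k1 i1 \<omega>] k1(2) by simp
          also have "\<dots> \<le> real k" using k by auto
          also have "\<dots> \<le> loc k i \<omega>" by (rule loc_bounds)
          finally show ?thesis by simp
        qed
        then show "bval k \<tau> \<omega> = 0" by (simp add: bval_def)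
      qed
    qed (use \<tau>s in auto)
    also have "1 * yval 0 k1 \<tau> \<omega> \<le> y * g \<tau>"
    proof -
      have "ereal (yval 0 k1 \<tau> \<omega> / g \<tau>) < ereal y"
        using le_V[OF \<tau>s(3), of 0] V[OF Mk1] unfolding k1(2) by (rule le_less_trans)
      then show ?thesis using g_loc_pos[of k1 i1 \<omega>] unfolding k1(2)[symmetric] by (simp add: field_simps)
    qed
    also have "y * g \<tau> \<le> y * g s"
      using \<tau>s y k1(2) loc_bounds(1)[of k1 i1 \<omega>] by (intro mult_left_mono G1_mono[OF g]) auto
    finally show ?thesis using Q0 by (simp add: m_def)
  next
    case False
    have "yval 0 m s \<omega> = (\<Sum>k<M. bval k s \<omega>)"
      unfolding yval_def
    proof (rule sum.mono_neutral_right)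
      show "\<forall>k\<in>{0..m} - {..<M}. bval k s \<omega> = 0"
      proof
        fix k assume k: "k \<in> {0..m} - {..<M}"
        show "bval k s \<omega> = 0"
          unfolding bval_def
        proof (rule sum.neutral, rule ballI)
          fix i assume "i \<in> {..<cnt k \<omega>}"
          then have "\<not> loc k i \<omega> \<le> s" using False k by (auto simp: P_def)
          then show "(if loc k i \<omega> \<le> s then exp (H * (loc k i \<omega> - s)) * jsize k i \<omega> else 0) = 0"
            by simp
        qed
      qed
    qed (use m in auto)
    also have "\<dots> \<le> exp (H * (real M - s)) * (\<Sum>k<M. total (\<omega> (int k)))"
      by (rule sum_bval_le)
    finally show ?thesis using y gs by (simp add: m_def add_increasing)
  qed
qed

text \<open>One inequality is evaluation at jump times; the other is \<open>yval_le_of_V\<close>,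
  whose error terms decay like \<open>exp (- H * s)\<close>.\<close>

lemma Limsup_proc:
  assumes "good \<omega>"
  shows "growth_limsup H g (\<lambda>t. proc t \<omega>) = L 0 \<omega>"
    (is "?Ls = _")
proof (rule antisym)
  define q where "q s = proc (exp s) \<omega> / (exp (H * s) * g s)" for s
  define A where "A = enn2real (psum past \<omega>)"
  have A: "0 \<le> A" by (simp add: A_def)
  have gpos: "0 < g s" if "0 \<le> s" for s using G1_pos[OF g that] .
  have q: "q s = A / (exp (H * s) * g s) + yval 0 (nat \<lfloor>s\<rfloor>) s \<omega> / g s" if "0 \<le> s" for s
    using gpos[OF that] by (simp add: q_def proc_exp[OF assms that] A_def add_divide_distrib)
  have ratio: "proc t \<omega> / (t powr H * g (ln t)) = q (ln t)" if "1 \<le> t" for t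
    using that by (simp add: q_def powr_def)
  show "L 0 \<omega> \<le> ?Ls"
  proof (rule ccontr)
    assume "\<not> ?thesis"
    then have "?Ls < L 0 \<omega>" by simp
    then obtain y where y: "?Ls < ereal y" "ereal y < L 0 \<omega>" using ereal_dense2 by blast
    from Limsup_lessD[OF y(1)] have "\<forall>\<^sub>F t in at_top. proc t \<omega> / (t powr H * g (ln t)) < y" by simp
    then obtain t0 where t0: "\<And>t. t0 \<le> t \<Longrightarrow> proc t \<omega> / (t powr H * g (ln t)) < y"
      unfolding eventually_at_top_linorder by blast
    have y0: "0 \<le> y"
    proof -
      have "0 \<le> q (ln (max 1 t0))"
        unfolding q_def by (intro divide_nonneg_pos proc_nonneg mult_pos_pos gpos) auto
      also have "\<dots> < y" using t0[of "max 1 t0"] ratio[of "max 1 t0"] by simp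
      finally show ?thesis by simp
    qed
    obtain N :: nat where N: "t0 \<le> real N" using real_arch_simple by blast
    have "V 0 n \<omega> \<le> ereal y" if n: "N \<le> n" for n
    proof (rule V_le[OF y0])
      fix i
      let ?s = "loc n i \<omega>"
      have s: "real n \<le> ?s" "0 \<le> ?s" "nat \<lfloor>?s\<rfloor> = n"
        using loc_bounds[of n i \<omega>] by (auto simp: nat_eq_iff floor_eq_iff)
      have "t0 \<le> exp ?s" using exp_ge_add_one_self[of ?s] N n s(1) by linarith
      then have "q ?s < y" using t0[of "exp ?s"] ratio[of "exp ?s"] s(2) by simp
      moreover have "yval 0 n ?s \<omega> / g ?s \<le> q ?s"
        unfolding q[OF s(2)] s(3) using A gpos[OF s(2)] by simp
      ultimately show "yval 0 n ?s \<omega> / g ?s \<le> y" by simp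
    qed
    then have "L 0 \<omega> \<le> ereal y"
      unfolding L_def by (intro Limsup_bounded) (auto simp: eventually_sequentially)
    with y(2) show False by simp
  qed
  show "?Ls \<le> L 0 \<omega>"
  proof (rule ccontr)
    assume "\<not> ?thesis"
    then have "L 0 \<omega> < ?Ls" by simp
    \<comment> \<open>Two levels above \<open>L 0\<close> are chosen so that the decaying error fits
      between them.\<close>
    then obtain y2 where y2: "L 0 \<omega> < ereal y2" "ereal y2 < ?Ls" using ereal_dense2 by blast
    then obtain y1 where y1: "L 0 \<omega> < ereal y1" "ereal y1 < ereal y2" using ereal_dense2 by blast
    have "\<forall>\<^sub>F n in sequentially. V 0 n \<omega> < ereal y1"
      using y1(1) unfolding L_def by (intro Limsup_lessD) simp
    then obtain M where M: "\<And>n. M \<le> n \<Longrightarrow> V 0 n \<omega> < ereal y1" by (auto simp: eventually_sequentially)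
    define Q where "Q = exp (H * real M) * (\<Sum>k<M. total (\<omega> (int k)))"
    have Q: "0 \<le> Q" unfolding Q_def by (intro mult_nonneg_nonneg sum_nonneg total_nonneg) auto
    have qle: "q s \<le> y1 + exp (- (H * s)) * ((A + Q) / g 0)" if s: "real M \<le> s" for s
    proof -
      have s0: "0 \<le> s" using s by linarith
      have gs: "g 0 \<le> g s" using s0 by (intro G1_mono[OF g]) auto
      have "yval 0 (nat \<lfloor>s\<rfloor>) s \<omega> \<le> y1 * g s + exp (- (H * s)) * Q"
        using yval_le_of_V[OF M s] by (simp add: Q_def right_diff_distrib exp_diff exp_minus field_simps)
      then have "q s \<le> A / (exp (H * s) * g s) + (y1 * g s + exp (- (H * s)) * Q) / g s"
        unfolding q[OF s0] using gpos[OF s0] by (intro add_left_mono divide_right_mono) auto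
      also have "\<dots> = y1 + exp (- (H * s)) * ((A + Q) / g s)"
        using gpos[OF s0] by (simp add: exp_minus field_simps)
      also have "\<dots> \<le> y1 + exp (- (H * s)) * ((A + Q) / g 0)"
        using A Q gs gpos[of 0] by (intro add_left_mono mult_left_mono divide_left_mono mult_pos_pos) auto
      finally show ?thesis .
    qed
    have "((\<lambda>t. y1 + exp (- (H * ln t)) * ((A + Q) / g 0)) \<longlongrightarrow> y1) at_top"
      using H_pos by real_asymp
    then have "\<forall>\<^sub>F t in at_top. y1 + exp (- (H * ln t)) * ((A + Q) / g 0) < y2"
      using y1(2) by (intro order_tendstoD(2)) auto
    moreover have "\<forall>\<^sub>F t in at_top. exp (real M) \<le> t" "\<forall>\<^sub>F t in at_top. (1::real) \<le> t"
      by (rule eventually_ge_at_top)+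
    ultimately have "\<forall>\<^sub>F t in at_top. ereal (proc t \<omega> / (t powr H * g (ln t))) \<le> ereal y2"
    proof eventually_elim
      case (elim t)
      then have "real M \<le> ln t" by (simp add: ln_ge_iff)
      from qle[OF this] elim ratio[of t] show ?case by simp
    qed
    then have "?Ls \<le> ereal y2" by (rule Limsup_bounded)
    with y2(2) show False by simp
  qed
qed

theorem AE_Limsup_proc_const:
  "\<exists>C>0. AE \<omega> in \<Omega>. growth_limsup H g (\<lambda>t. proc t \<omega>) = ereal C"
proof -
  obtain C where C: "0 < C" "AE \<omega> in \<Omega>. L 0 \<omega> = ereal C" using L_const by blast
  have "AE \<omega> in \<Omega>. growth_limsup H g (\<lambda>t. proc t \<omega>) = ereal C"
    using AE_good C(2) by eventually_elim (simp add: Limsup_proc)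
  with C(1) show ?thesis by blast
qed

end

section \<open>Choice of the jump law and path space\<close>

text \<open>If no factor \<open>c > 1\<close> gave unbounded growth, \<open>OR\<close> would follow:
  factors up to \<open>1\<close> are covered by monotonicity, and the lower limit for
  \<open>c\<close> is the upper bound for \<open>1 / c\<close>.\<close>

lemma not_class_OR_obtain:
  assumes g: "g \<in> G1" and not_OR: "(\<lambda>x. gen_inv g x + ln x) \<notin> class_OR"
  obtains c where "1 < c" "\<And>K B. \<exists>x\<ge>B. K * (gen_inv g x + ln x) < gen_inv g (c * x)"
proof -
  have "\<exists>c>1. \<forall>K B. \<exists>x\<ge>B. K * (gen_inv g x + ln x) < gen_inv g (c * x)"
  proof (rule ccontr)
    assume "\<not> ?thesis"
    then have *: "\<exists>K B. \<forall>x\<ge>B. gen_inv g (c * x) \<le> K * (gen_inv g x + ln x)" if "1 < c" for c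
      using that by (meson not_le)
    define h where "h x = gen_inv g x + ln x" for x
    have hpos: "0 < h x" if "1 < x" for x
      using that gen_inv_nonneg[OF g, of x] by (auto simp: h_def intro: add_nonneg_pos)
    have bound: "\<exists>K>0. \<forall>\<^sub>F x in at_top. h (c * x) \<le> K * h x" if "0 < c" for c
    proof (cases "1 < c")
      case True
      then obtain K B where KB: "\<And>x. B \<le> x \<Longrightarrow> gen_inv g (c * x) \<le> K * h x"
        using *[OF True] unfolding h_def by blast
      have lnc: "0 < ln c" using True by simp
      \<comment> \<open>Beyond \<open>exp 1\<close> the logarithm is at least \<open>1\<close>, so
        \<open>ln c + ln x\<close> is at most \<open>(1 + ln c) * ln x\<close>.\<close>
      have "\<forall>\<^sub>F x in at_top. h (c * x) \<le> (\<bar>K\<bar> + 1 + ln c) * h x"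
        using eventually_ge_at_top[of B] eventually_ge_at_top[of "exp 1"]
      proof eventually_elim
        case (elim x)
        have x: "0 < x" "1 \<le> ln x" "1 < x"
        proof -
          show "0 < x" using elim(2) by (meson exp_gt_zero less_le_trans)
          then show "1 \<le> ln x" using elim(2) by (simp add: ln_ge_iff)
          then show "1 < x" using \<open>0 < x\<close> by (metis ln_gt_zero_iff less_le_trans zero_less_one)
        qed
        have "gen_inv g (c * x) \<le> \<bar>K\<bar> * h x"
          using KB[OF elim(1)] hpos[OF x(3)] by (meson abs_ge_self less_imp_le mult_right_mono order_trans)
        moreover have "ln (c * x) \<le> (1 + ln c) * h x"
        proof -
          have "ln (c * x) = ln c + ln x" using that x by (simp add: ln_mult_pos)
          also have "\<dots> \<le> (1 + ln c) * ln x"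
            using x lnc by (simp add: distrib_right)
          also have "\<dots> \<le> (1 + ln c) * h x"
            using lnc gen_inv_nonneg[OF g, of x] by (intro mult_left_mono) (auto simp: h_def)
          finally show ?thesis .
        qed
        ultimately show ?case unfolding h_def[of "c * x"] by (simp add: distrib_right)
      qed
      moreover have "0 < \<bar>K\<bar> + 1 + ln c" using lnc by simp
      ultimately show ?thesis by blast
    next
      case False
      have "\<forall>\<^sub>F x in at_top. h (c * x) \<le> 1 * h x"
        using eventually_gt_at_top[of 0]
      proof eventually_elim
        case (elim x)
        have "c * x \<le> x" using False elim by simp
        then show ?case
          unfolding h_def using that elim by (auto intro!: add_mono gen_inv_mono[OF g])
      qed
      then show ?thesis by (intro exI[of _ 1]) simp
    qed
    have "same_order (\<lambda>x. h (c * x)) h" if c: "0 < c" for c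
      unfolding same_order_def
    proof (intro conjI)
      obtain K where K: "0 < K" "\<forall>\<^sub>F x in at_top. h (c * x) \<le> K * h x"
        using bound[OF c] by blast
      from K(2) eventually_gt_at_top[of 1]
      have "\<forall>\<^sub>F x in at_top. ereal (h (c * x) / h x) \<le> ereal K"
        by eventually_elim (use hpos in \<open>auto simp: pos_divide_le_eq\<close>)
      then have "Limsup at_top (\<lambda>x. ereal (h (c * x) / h x)) \<le> ereal K"
        by (rule Limsup_bounded)
      then show "Limsup at_top (\<lambda>x. ereal (h (c * x) / h x)) < \<infinity>"
        using le_less_trans by fastforce
      obtain K' where K': "0 < K'" "\<forall>\<^sub>F x in at_top. h (1 / c * x) \<le> K' * h x"
        using bound[of "1 / c"] c by auto
      have "filterlim (\<lambda>x. c * x) at_top at_top"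
        using c by (intro filterlim_tendsto_pos_mult_at_top[OF tendsto_const _ filterlim_ident])
      from eventually_compose_filterlim[OF K'(2) this]
      have "\<forall>\<^sub>F x in at_top. h x \<le> K' * h (c * x)" using c by simp
      with eventually_gt_at_top[of 1]
      have "\<forall>\<^sub>F x in at_top. ereal (1 / K') \<le> ereal (h (c * x) / h x)"
      proof eventually_elim
        case (elim x)
        then show ?case using hpos[of x] K'(1) by (simp add: field_simps)
      qed
      then have "ereal (1 / K') \<le> Liminf at_top (\<lambda>x. ereal (h (c * x) / h x))"
        by (rule Liminf_bounded)
      moreover have "0 < ereal (1 / K')" using K'(1) by simp
      ultimately show "0 < Liminf at_top (\<lambda>x. ereal (h (c * x) / h x))"
        by (rule less_le_trans[rotated])
      show "Liminf at_top (\<lambda>x. ereal (h (c * x) / h x)) \<le> Limsup at_top (\<lambda>x. ereal (h (c * x) / h x))"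
        by (rule Liminf_le_Limsup) simp
    qed
    moreover have "h \<in> borel_measurable (restrict_space borel {0..})"
      unfolding h_def[abs_def]
      by (intro measurable_restrict_space1 borel_measurable_add borel_measurable_ln gen_inv_measurable[OF g]) simp
    moreover have "\<forall>\<^sub>F x in at_top. 0 < h x"
      using eventually_gt_at_top[of 1] by eventually_elim (rule hpos)
    ultimately have "h \<in> class_OR" by (simp add: class_OR_def)
    with not_OR show False by (simp add: h_def[abs_def])
  qed
  with that show ?thesis by blast
qed

text \<open>Where \<open>gen_inv g (c * x)\<close> outgrows \<open>gen_inv g x + ln x\<close> by a factor \<open>2\<^sup>j\<^sup>+\<^sup>1\<close> at \<open>x = a j\<close>,
  put mass of order \<open>2\<^sup>-\<^sup>j / (gen_inv g (a j) + ln (a j))\<close>.\<close>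

lemma mark_law_exists:
  assumes g: "g \<in> G1" and not_OR: "(\<lambda>x. gen_inv g x + ln x) \<notin> class_OR"
  obtains \<pi> :: "real measure" and c where "prob_space \<pi>" "sets \<pi> = sets borel" "0 < c"
    "(\<integral>\<^sup>+r. ennreal (ln (1 + \<bar>r\<bar>)) \<partial>\<pi>) < \<infinity>"
    "(\<integral>\<^sup>+r. ennreal (gen_inv g (max \<bar>r\<bar> b)) \<partial>\<pi>) < \<infinity>"
    "(\<Sum>n. emeasure \<pi> {r. g (real (Suc n)) < c * \<bar>r\<bar>}) = \<infinity>"
proof -
  obtain c where c: "1 < c" "\<And>K B. \<exists>x\<ge>B. K * (gen_inv g x + ln x) < gen_inv g (c * x)"
    using not_class_OR_obtain[OF g not_OR] by blast
  \<comment> \<open>Staying above \<open>b\<close> makes the truncation at \<open>b\<close>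
    invisible; staying above \<open>exp 1\<close> gives \<open>w j \<ge> 1\<close> and
    \<open>ln (1 + a j) \<le> 2 * ln (a j)\<close>.\<close>
  have "\<forall>j. \<exists>x. max b (exp 1) \<le> x \<and> 2 ^ Suc j * (gen_inv g x + ln x) < gen_inv g (c * x)"
    using c(2) by blast
  then obtain a where a: "\<And>j::nat. max b (exp 1) \<le> a j"
    "\<And>j. 2 ^ Suc j * (gen_inv g (a j) + ln (a j)) < gen_inv g (c * a j)"
    by metis
  have a_pos: "0 < a j" for j
    using a(1)[of j] exp_gt_zero[of "1::real"] by (simp only: max.bounded_iff) linarith
  have ln_a: "1 \<le> ln (a j)" for j
    using a(1)[of j] a_pos[of j] by (simp add: ln_ge_iff)
  define w where "w j = gen_inv g (a j) + ln (a j)" for j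
  have w1: "1 \<le> w j" for j
    using ln_a[of j] gen_inv_nonneg[OF g, of "a j"] by (simp add: w_def)
  \<comment> \<open>Then \<open>p j * w j\<close> is summable, while
    \<open>p j * gen_inv g (c * a j)\<close> is at least \<open>1\<close> for every
    \<open>j\<close>.\<close>
  define p where "p j = (1 / 2) ^ Suc j / w j" for j
  have p0: "0 < p j" for j using w1[of j] by (auto simp: p_def intro!: divide_pos_pos)
  have geo: "summable (\<lambda>j. (1 / 2 :: real) ^ Suc j)"
    by (simp add: summable_geometric summable_mult)
  have pw: "p j * w j = (1 / 2) ^ Suc j" for j using w1[of j] by (simp add: p_def)
  have p_le: "p j \<le> (1 / 2) ^ Suc j" for j
    using mult_left_mono[OF w1[of j], of "p j"] p0[of j] pw[of j] by simp
  have p_sum: "summable p"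
  proof (rule summable_comparison_test'[OF geo, of 0])
    show "norm (p j) \<le> (1 / 2) ^ Suc j" for j using p_le[of j] p0[of j] by simp
  qed
  define Z where "Z = (\<Sum>j. p j)"
  have Z: "0 < Z" unfolding Z_def by (rule suminf_pos[OF p_sum p0])
  define q where "q = embed_pmf (\<lambda>j. p j / Z)"
  have q: "pmf q j = p j / Z" for j
    unfolding q_def
  proof (rule pmf_embed_pmf)
    have "(\<integral>\<^sup>+j. ennreal (p j / Z) \<partial>count_space UNIV) = (\<Sum>j. ennreal (p j / Z))"
      by (rule nn_integral_count_space_nat)
    also have "\<dots> = ennreal (\<Sum>j. p j / Z)"
      using p0 Z p_sum by (intro suminf_ennreal2 summable_divide) (auto intro: less_imp_le)
    also have "(\<Sum>j. p j / Z) = 1"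
      using Z p_sum by (simp add: suminf_divide Z_def)
    finally show "(\<integral>\<^sup>+j. ennreal (p j / Z) \<partial>count_space UNIV) = 1" by simp
  qed (use p0 Z in \<open>auto intro: less_imp_le\<close>)
  \<comment> \<open>An image of a law on indices adds up the masses of atoms that happen to
    coincide.\<close>
  define \<pi> where "\<pi> = distr (measure_pmf q) borel a"
  have sets_\<pi>: "sets \<pi> = sets borel" by (simp add: \<pi>_def)
  have prob_\<pi>: "prob_space \<pi>"
    unfolding \<pi>_def by (intro prob_space.prob_space_distr prob_space_measure_pmf) simp
  have int_\<pi>: "(\<integral>\<^sup>+r. ennreal (f r) \<partial>\<pi>) = (\<Sum>j. ennreal (p j / Z * f (a j)))"
    if [measurable]: "f \<in> borel_measurable borel" and f0: "\<And>j. 0 \<le> f (a j)" for f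
  proof -
    have "(\<integral>\<^sup>+r. ennreal (f r) \<partial>\<pi>) = (\<integral>\<^sup>+j. ennreal (f (a j)) \<partial>measure_pmf q)"
      unfolding \<pi>_def by (subst nn_integral_distr) auto
    also have "\<dots> = (\<integral>\<^sup>+j. ennreal (p j / Z * f (a j)) \<partial>count_space UNIV)"
      unfolding nn_integral_measure_pmf q
    proof (rule nn_integral_cong)
      show "ennreal (p j / Z) * ennreal (f (a j)) = ennreal (p j / Z * f (a j))" for j
        using p0[of j] Z f0[of j] by (intro ennreal_mult[symmetric]) auto
    qed
    also have "\<dots> = (\<Sum>j. ennreal (p j / Z * f (a j)))"
      by (rule nn_integral_count_space_nat)
    finally show ?thesis .
  qed
  have fin: "(\<integral>\<^sup>+r. ennreal (f r) \<partial>\<pi>) < \<infinity>"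
    if [measurable]: "f \<in> borel_measurable borel" and f: "\<And>j. 0 \<le> f (a j)" "\<And>j. f (a j) \<le> 2 * w j" for f
  proof -
    have le: "p j / Z * f (a j) \<le> 2 / Z * (1 / 2) ^ Suc j" for j
    proof -
      have "p j / Z * f (a j) \<le> p j / Z * (2 * w j)"
        using p0[of j] Z f(2)[of j] by (intro mult_left_mono) auto
      also have "\<dots> = 2 / Z * (p j * w j)" by simp
      finally show ?thesis unfolding pw .
    qed
    have nn: "0 \<le> p j / Z * f (a j)" for j
      using p0[of j] Z f(1)[of j] by simp
    have "summable (\<lambda>j. p j / Z * f (a j))"
    proof (rule summable_comparison_test'[OF summable_mult[OF geo, of "2 / Z"], of 0])
      show "norm (p j / Z * f (a j)) \<le> 2 / Z * (1 / 2) ^ Suc j" for j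
        using le[of j] nn[of j] by (simp only: real_norm_def abs_of_nonneg)
    qed
    then show ?thesis
      using nn f(1) by (subst int_\<pi>) (auto simp: less_top[symmetric] ennreal_suminf_neq_top simp del: times_divide_eq_left)
  qed
  note [measurable] = gen_inv_measurable[OF g]
  show ?thesis
  proof (rule that[OF prob_\<pi> sets_\<pi>, of c])
    show "0 < c" using c(1) by simp
    show "(\<integral>\<^sup>+r. ennreal (ln (1 + \<bar>r\<bar>)) \<partial>\<pi>) < \<infinity>"
    proof (rule fin)
      fix j
      have a1: "1 \<le> a j" using a_pos[of j] ln_a[of j] by (metis ln_ge_zero_iff order_trans zero_le_one)
      show "0 \<le> ln (1 + \<bar>a j\<bar>)" by simp
      have a2: "2 \<le> a j"
        using a(1)[of j] exp_ge_add_one_self[of "1::real"] by (simp only: max.bounded_iff) linarith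
      have "1 + a j \<le> a j * 2" using a1 by simp
      also have "\<dots> \<le> a j * a j" using a2 by (intro mult_left_mono) auto
      finally have "ln (1 + a j) \<le> ln (a j * a j)"
        using a_pos[of j] by (intro ln_mono) auto
      also have "\<dots> = 2 * ln (a j)" using a_pos[of j] by (simp add: ln_mult_pos)
      also have "\<dots> \<le> 2 * w j" using gen_inv_nonneg[OF g, of "a j"] by (simp add: w_def)
      finally show "ln (1 + \<bar>a j\<bar>) \<le> 2 * w j" using a_pos[of j] by simp
    qed measurable
    show "(\<integral>\<^sup>+r. ennreal (gen_inv g (max \<bar>r\<bar> b)) \<partial>\<pi>) < \<infinity>"
    proof (rule fin)
      fix j
      show "0 \<le> gen_inv g (max \<bar>a j\<bar> b)" by (rule gen_inv_nonneg[OF g])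
      have "max \<bar>a j\<bar> b = a j" using a(1)[of j] a_pos[of j] by simp
      then show "gen_inv g (max \<bar>a j\<bar> b) \<le> 2 * w j"
        using ln_a[of j] gen_inv_nonneg[OF g, of "a j"] by (simp add: w_def)
    qed measurable
    interpret \<pi>: prob_space \<pi> by (rule prob_\<pi>)
    \<comment> \<open>Every index contributes at least \<open>1 / Z\<close> to the moment at the
      larger level, so that moment diverges.\<close>
    have "\<infinity> = (\<Sum>j::nat. ennreal (1 / Z))"
    proof (rule ccontr)
      assume "\<not> ?thesis"
      then have "summable (\<lambda>_::nat. 1 / Z)"
        using Z by (intro summable_suminf_not_top) auto
      then show False using Z by (simp add: summable_const_iff)
    qed
    also have "\<dots> \<le> (\<Sum>j. ennreal (p j / Z * gen_inv g (c * \<bar>a j\<bar>)))"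
    proof (intro suminf_le ennreal_leI)
      fix j
      have "p j * (2 ^ Suc j * w j) = 2 ^ Suc j * (p j * w j)" by simp
      also have "\<dots> = 1" unfolding pw by (simp add: power_one_over)
      finally have "1 = p j * (2 ^ Suc j * w j)" by simp
      also have "\<dots> \<le> p j * gen_inv g (c * \<bar>a j\<bar>)"
        using a(2)[of j] p0[of j] a_pos[of j] by (intro mult_left_mono) (auto simp: w_def)
      finally show "1 / Z \<le> p j / Z * gen_inv g (c * \<bar>a j\<bar>)"
        using Z by (simp add: field_simps)
    qed auto
    also have "\<dots> = (\<integral>\<^sup>+r. ennreal (gen_inv g (c * \<bar>r\<bar>)) \<partial>\<pi>)"
      by (rule int_\<pi>[symmetric]) (auto simp: gen_inv_nonneg[OF g])
    also have "\<dots> \<le> (\<Sum>n. emeasure \<pi> {r\<in>space \<pi>. 1 * g (real (Suc n)) < c * \<bar>r\<bar>}) + 1"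
      using \<pi>.nn_integral_gen_inv_le_suminf_tail[of "\<lambda>r. c * \<bar>r\<bar>" g 1] g
      by (simp add: measurable_cong_sets[OF sets_\<pi> refl])
    finally show "(\<Sum>n. emeasure \<pi> {r. g (real (Suc n)) < c * \<bar>r\<bar>}) = \<infinity>"
      by (auto simp: sets_eq_imp_space_eq[OF sets_\<pi>] top_unique)
  qed
qed

text \<open>Submultiplicativity replaces the sum of marks by a product, whose mean over a Poisson
  number of points is explicit. Finiteness of the moment thus passes from one mark to the block
  total.\<close>

lemma (in marked_poisson) suminf_total_tail_submult:
  assumes g: "g \<in> G1" and C: "0 < C"
    and sub: "\<And>r s. 0 \<le> r \<Longrightarrow> 0 \<le> s \<Longrightarrow>
      gen_inv g (max (r + s) b) \<le> C * gen_inv g (max r b) * gen_inv g (max s b)"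
    and fin: "(\<integral>\<^sup>+r. ennreal (gen_inv g (max \<bar>r\<bar> b)) \<partial>\<pi>) < \<infinity>"
  shows "(\<Sum>n. emeasure blk {b\<in>space blk. g (real n) < total b}) < \<infinity>"
proof -
  define k where "k r = gen_inv g (max r b)" for r
  note [measurable] = gen_inv_measurable[OF g]
  have [measurable]: "k \<in> borel_measurable borel" unfolding k_def[abs_def] by measurable
  have k0: "0 \<le> k r" for r unfolding k_def by (rule gen_inv_nonneg[OF g])
  have k_sum: "k (\<Sum>i<n. f i) \<le> k 0 * (\<Prod>i<n. C * k (f i))" if f: "\<And>i. 0 \<le> f i" for f :: "nat \<Rightarrow> real" and n
  proof (induction n)
    case (Suc n)
    have "k (\<Sum>i<Suc n. f i) \<le> C * k (\<Sum>i<n. f i) * k (f n)"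
      using sub[of "\<Sum>i<n. f i" "f n"] f by (simp add: k_def sum_nonneg)
    also have "\<dots> = (C * k (f n)) * k (\<Sum>i<n. f i)" by simp
    also have "\<dots> \<le> (C * k (f n)) * (k 0 * (\<Prod>i<n. C * k (f i)))"
      using Suc C k0 by (intro mult_left_mono) auto
    finally show ?case by (simp add: mult_ac)
  qed simp
  have "(\<integral>\<^sup>+y. ennreal (gen_inv g (total y / 1)) \<partial>blk) \<le> (\<integral>\<^sup>+y. ennreal (k 0) * (\<Prod>i<fst y. ennreal (C * k \<bar>snd (snd y i)\<bar>)) \<partial>blk)"
  proof (rule nn_integral_mono)
    fix y
    have "gen_inv g (total y) \<le> k (total y)"
      unfolding k_def by (intro gen_inv_mono[OF g]) simp
    also have "\<dots> \<le> k 0 * (\<Prod>i<fst y. C * k \<bar>snd (snd y i)\<bar>)"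
      unfolding total_def by (rule k_sum) simp
    finally have "ennreal (gen_inv g (total y)) \<le> ennreal (k 0 * (\<Prod>i<fst y. C * k \<bar>snd (snd y i)\<bar>))"
      by (rule ennreal_leI)
    also have "\<dots> = ennreal (k 0) * ennreal (\<Prod>i<fst y. C * k \<bar>snd (snd y i)\<bar>)"
      using k0 C by (intro ennreal_mult prod_nonneg) auto
    also have "ennreal (\<Prod>i<fst y. C * k \<bar>snd (snd y i)\<bar>) = (\<Prod>i<fst y. ennreal (C * k \<bar>snd (snd y i)\<bar>))"
      using k0 C by (intro prod_ennreal[symmetric]) auto
    finally show "ennreal (gen_inv g (total y / 1)) \<le> ennreal (k 0) * (\<Prod>i<fst y. ennreal (C * k \<bar>snd (snd y i)\<bar>))"
      by simp
  qed
  also have "\<dots> = ennreal (k 0) * (\<integral>\<^sup>+y. (\<Prod>i<fst y. ennreal (C * k \<bar>snd (snd y i)\<bar>)) \<partial>blk)"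
    by (rule nn_integral_cmult, rule measurable_compose_countable[OF _ count_measurable]) measurable
  also have "\<dots> < \<infinity>"
  proof -
    have "(\<integral>\<^sup>+x. ennreal (C * k \<bar>snd x\<bar>) \<partial>pnt) = (\<integral>\<^sup>+r. ennreal (C * k \<bar>r\<bar>) \<partial>\<pi>)"
      by (rule nn_integral_pnt_mark[where f = "\<lambda>r. ennreal (C * k \<bar>r\<bar>)"]) measurable
    also have "\<dots> = ennreal C * (\<integral>\<^sup>+r. ennreal (k \<bar>r\<bar>) \<partial>\<pi>)"
      using C k0 by (simp add: ennreal_mult nn_integral_cmult)
    also have "\<dots> < \<infinity>" using fin by (simp add: k_def ennreal_mult_less_top)
    finally have "(\<integral>\<^sup>+y. (\<Prod>i<fst y. ennreal (C * k \<bar>snd (snd y i)\<bar>)) \<partial>blk) < \<infinity>"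
      using nn_integral_blk_prod_finite[of "\<lambda>x. ennreal (C * k \<bar>snd x\<bar>)"] by simp
    then show ?thesis by (simp add: ennreal_mult_less_top)
  qed
  finally show ?thesis
    using blk.suminf_tail_le_nn_integral_gen_inv[of total g 1] g by simp
qed

text \<open>The \<open>\<sigma>\<close>-algebra is the largest one that makes the
  map from sample points to paths measurable for the completed measure; the product
  \<open>\<sigma>\<close>-algebra would be too small, since almost sure path properties need not be measurable there.\<close>

lemma path_space_version:
  fixes X :: "real \<Rightarrow> 'w \<Rightarrow> real ^ 'n"
  assumes X: "selfsimilar_additive M H X" and P: "AE \<omega> in M. P (\<lambda>t. X t \<omega>)"
  shows "\<exists>N :: (real \<Rightarrow> real ^ 'n) measure. selfsimilar_additive N H (\<lambda>t p. p t) \<and> (AE p in N. P p)"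
proof -
  interpret M: prob_space M using X by (simp add: selfsimilar_additive_def)
  have Xm: "X t \<in> M \<rightarrow>\<^sub>M borel" if "0 \<le> t" for t
    using X that by (simp add: selfsimilar_additive_def)
  define \<phi> where "\<phi> \<omega> = (\<lambda>t. X t \<omega>)" for \<omega>
  define S where "S = {A. \<phi> -` A \<inter> space M \<in> sets (completion M)}"
  define N where "N = distr (completion M) (sigma UNIV S) \<phi>"
  have space_N: "space N = UNIV" by (simp add: N_def)
  have S_sets: "A \<in> sets N" if "A \<in> S" for A
    using that by (simp add: N_def)
  have \<phi>: "\<phi> \<in> completion M \<rightarrow>\<^sub>M sigma UNIV S"
    by (rule measurable_measure_of) (auto simp: S_def)
  have "prob_space (completion M)"
    by (rule prob_spaceI) (simp add: M.emeasure_space_1)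
  then have N: "prob_space N"
    unfolding N_def by (rule prob_space.prob_space_distr) (rule \<phi>)
  \<comment> \<open>A property that holds almost surely is measurable for the completion, hence its
    set of paths lies in \<open>S\<close> whatever its form.\<close>
  have AE_N: "AE p in N. Q p" if Q: "AE \<omega> in M. Q (\<phi> \<omega>)" for Q
  proof -
    have AE: "AE \<omega> in completion M. Q (\<phi> \<omega>)" using Q by (rule AE_completion)
    have "Measurable.pred (completion M) (\<lambda>\<omega>. \<not> Q (\<phi> \<omega>))"
      by (rule sets_completion_AE) (use Q in simp)
    from sets.compl_sets[OF predE[OF this]]
    have "space (completion M) - {\<omega>\<in>space (completion M). \<not> Q (\<phi> \<omega>)} \<in> sets (completion M)" .
    also have "space (completion M) - {\<omega>\<in>space (completion M). \<not> Q (\<phi> \<omega>)} = {\<omega>\<in>space (completion M). Q (\<phi> \<omega>)}"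
      by auto
    finally have "{p. Q p} \<in> S" by (simp add: S_def vimage_def Int_def conj_commute)
    then show ?thesis
      unfolding N_def using AE S_sets[of "{p. Q p}"] by (subst AE_distr_iff[OF \<phi>]) (auto simp: N_def)
  qed
  \<comment> \<open>Functionals of the path keep their law, so finite-dimensional laws and
    independence are read off the original process.\<close>
  have tr: "\<Phi> \<in> N \<rightarrow>\<^sub>M K" "distr N K \<Phi> = distr M K (\<lambda>\<omega>. \<Phi> (\<phi> \<omega>))"
    if \<Phi>: "(\<lambda>\<omega>. \<Phi> (\<phi> \<omega>)) \<in> M \<rightarrow>\<^sub>M K" "\<And>p. \<Phi> p \<in> space K" for \<Phi> K
  proof -
    show m: "\<Phi> \<in> N \<rightarrow>\<^sub>M K"
    proof (rule measurableI)
      fix A assume A: "A \<in> sets K"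
      have "(\<lambda>\<omega>. \<Phi> (\<phi> \<omega>)) -` A \<inter> space M \<in> sets M" by (rule measurable_sets[OF \<Phi>(1) A])
      then have "\<Phi> -` A \<in> S" by (simp add: S_def vimage_def sets_completionI_sets)
      then show "\<Phi> -` A \<inter> space N \<in> sets N" by (simp add: space_N S_sets)
    qed (rule \<Phi>(2))
    have "distr N K \<Phi> = distr (completion M) K (\<Phi> \<circ> \<phi>)"
      unfolding N_def using m by (intro distr_distr \<phi>) (simp add: N_def)
    also have "\<dots> = distr M K (\<lambda>\<omega>. \<Phi> (\<phi> \<omega>))"
      unfolding comp_def by (rule distr_completion[OF \<Phi>(1)])
    finally show "distr N K \<Phi> = distr M K (\<lambda>\<omega>. \<Phi> (\<phi> \<omega>))" .
  qed
  have fdd_tr: "fdd N (\<lambda>t p. f (p (c * t))) J = fdd M (\<lambda>t \<omega>. f (X (c * t) \<omega>)) J"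
    if "J \<subseteq> {0..}" "0 < c" "f \<in> borel_measurable borel" for f :: "real ^ 'n \<Rightarrow> real ^ 'n" and c :: real and J
  proof -
    have "(\<lambda>\<omega>. \<lambda>t\<in>J. f (X (c * t) \<omega>)) \<in> M \<rightarrow>\<^sub>M Pi\<^sub>M J (\<lambda>_. borel)"
      using that by (intro measurable_restrict measurable_compose[OF Xm]) auto
    then show ?thesis
      unfolding fdd_def by (subst tr(2)) (auto simp: \<phi>_def space_PiM)
  qed
  have "selfsimilar_additive N H (\<lambda>t p. p t)"
    unfolding selfsimilar_additive_def
  proof (intro conjI allI impI)
    show "prob_space N" by (rule N)
    show "(\<lambda>p. p t) \<in> N \<rightarrow>\<^sub>M borel" if "0 \<le> t" for t
      using Xm[OF that] by (intro tr(1)) (auto simp: \<phi>_def)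
    show "selfsimilar N H (\<lambda>t p. p t)"
      unfolding selfsimilar_def eq_fdd_def
    proof (intro allI impI, elim conjE)
      fix c :: real and J :: "real set" assume c: "0 < c" and J: "finite J" "J \<subseteq> {0..}"
      have "fdd M (\<lambda>t. X (c * t)) J = fdd M (\<lambda>t \<omega>. (c powr H) *\<^sub>R X t \<omega>) J"
        using X c J by (auto simp: selfsimilar_additive_def selfsimilar_def eq_fdd_def)
      then show "fdd N (\<lambda>t p. p (c * t)) J = fdd N (\<lambda>t p. (c powr H) *\<^sub>R p t) J"
        using fdd_tr[OF J(2) c, of "\<lambda>v. v"] fdd_tr[OF J(2), of 1 "\<lambda>v. (c powr H) *\<^sub>R v"] by simp
    qed
    show "independent_increments N (\<lambda>t p. p t)"
      unfolding independent_increments_def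
    proof (intro allI impI, elim conjE)
      fix k :: nat and t :: "nat \<Rightarrow> real" assume t: "0 \<le> t 0" "strict_mono_on {..k} t"
      have t0: "0 \<le> t i" if "i \<le> k" for i
      proof (cases "i = 0")
        case False
        then have "t 0 < t i" using t(2) that by (simp add: strict_mono_on_def)
        with t(1) show ?thesis by simp
      qed (use t(1) in simp)
      interpret N: prob_space N by (rule N)
      show "N.indep_vars (\<lambda>_. borel) (\<lambda>i p. p (t (Suc i)) - p (t i)) {..<k}"
      \<comment> \<open>The description of independence by a product law asks for a nonempty index
        set.\<close>
      proof (cases "k = 0")
        case True
        then show ?thesis by (simp add: N.indep_vars_def2 N.indep_sets_def)
      next
        case False
        then have ne: "{..<k} \<noteq> {}" by auto
        have Mm: "(\<lambda>\<omega>. X (t (Suc i)) \<omega> - X (t i) \<omega>) \<in> M \<rightarrow>\<^sub>M borel" if "i < k" for i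
          using t0[of i] t0[of "Suc i"] that by (intro borel_measurable_diff Xm) auto
        have ind: "M.indep_vars (\<lambda>_. borel) (\<lambda>i \<omega>. X (t (Suc i)) \<omega> - X (t i) \<omega>) {..<k}"
          using X t by (auto simp: selfsimilar_additive_def independent_increments_def)
        have 1: "distr N borel (\<lambda>p. p (t (Suc i)) - p (t i)) = distr M borel (\<lambda>\<omega>. X (t (Suc i)) \<omega> - X (t i) \<omega>)"
          if "i < k" for i
          using Mm[OF that] by (subst tr(2)) (auto simp: \<phi>_def)
        have 2: "distr N (Pi\<^sub>M {..<k} (\<lambda>_. borel)) (\<lambda>p. \<lambda>i\<in>{..<k}. p (t (Suc i)) - p (t i))
          = distr M (Pi\<^sub>M {..<k} (\<lambda>_. borel)) (\<lambda>\<omega>. \<lambda>i\<in>{..<k}. X (t (Suc i)) \<omega> - X (t i) \<omega>)"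
          using Mm by (subst tr(2)) (auto simp: \<phi>_def space_PiM intro!: measurable_restrict)
        have "distr M (Pi\<^sub>M {..<k} (\<lambda>_. borel)) (\<lambda>\<omega>. \<lambda>i\<in>{..<k}. X (t (Suc i)) \<omega> - X (t i) \<omega>)
          = Pi\<^sub>M {..<k} (\<lambda>i. distr M borel (\<lambda>\<omega>. X (t (Suc i)) \<omega> - X (t i) \<omega>))"
          using M.indep_vars_iff_distr_eq_PiM'[OF ne, of "\<lambda>i \<omega>. X (t (Suc i)) \<omega> - X (t i) \<omega>" "\<lambda>_. borel"] Mm ind by auto
        also have "\<dots> = Pi\<^sub>M {..<k} (\<lambda>i. distr N borel (\<lambda>p. p (t (Suc i)) - p (t i)))"
          by (intro PiM_cong refl) (simp add: 1)
        finally have eq: "distr N (Pi\<^sub>M {..<k} (\<lambda>_. borel)) (\<lambda>p. \<lambda>i\<in>{..<k}. p (t (Suc i)) - p (t i)) = \<dots>"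
          unfolding 2 .
        have Nm: "(\<lambda>p. p (t (Suc i)) - p (t i)) \<in> N \<rightarrow>\<^sub>M borel" if "i < k" for i
          using Mm[OF that] by (intro tr(1)) (auto simp: \<phi>_def)
        show ?thesis
          using N.indep_vars_iff_distr_eq_PiM'[OF ne, of "\<lambda>i p. p (t (Suc i)) - p (t i)" "\<lambda>_. borel"] Nm eq by auto
      qed
    qed
    show "AE p in N. cadlag (\<lambda>t. p t)"
      using X by (intro AE_N) (simp add: selfsimilar_additive_def \<phi>_def)
  qed
  moreover have "AE p in N. P p"
    using P by (intro AE_N) (simp add: \<phi>_def)
  ultimately show ?thesis by blast
qed

text \<open>Along \<open>t powr H\<close> times a fixed vector the normalised norm is
  \<open>norm v / g (ln t)\<close>, which tends to \<open>0\<close> and not to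
  \<open>1\<close>.\<close>

lemma not_deterministic:
  fixes X :: "real \<Rightarrow> 'w \<Rightarrow> real ^ 'n"
  assumes "prob_space M" and g: "g \<in> G1"
    and lim: "AE \<omega> in M. growth_limsup H g (\<lambda>t. norm (X t \<omega>)) = 1"
  shows "\<not> deterministic M H X"
proof
  interpret prob_space M by fact
  assume "deterministic M H X"
  then obtain v where "AE \<omega> in M. \<forall>t\<ge>0. X t \<omega> = (t powr H) *\<^sub>R v"
    by (auto simp: deterministic_def)
  with lim have "AE \<omega> in M. False"
  proof eventually_elim
    case (elim \<omega>)
    have "filterlim (\<lambda>t. g (ln t)) at_top at_top"
      by (rule filterlim_compose[OF G1_at_top[OF g] ln_at_top])
    then have "((\<lambda>t. norm v / g (ln t)) \<longlongrightarrow> 0) at_top"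
      by (rule real_tendsto_divide_at_top[OF tendsto_const])
    moreover have "\<forall>\<^sub>F t in at_top. norm v / g (ln t) = norm (X t \<omega>) / (t powr H * g (ln t))"
      using eventually_gt_at_top[of 0] by eventually_elim (simp add: elim(2))
    ultimately have "((\<lambda>t. norm (X t \<omega>) / (t powr H * g (ln t))) \<longlongrightarrow> 0) at_top"
      by (rule Lim_transform_eventually)
    then have "((\<lambda>t. ereal (norm (X t \<omega>) / (t powr H * g (ln t)))) \<longlongrightarrow> ereal 0) at_top"
      by (intro tendsto_ereal)
    then have "growth_limsup H g (\<lambda>t. norm (X t \<omega>)) = ereal 0"
      by (intro lim_imp_Limsup) simp
    with elim(1) show False by simp
  qed
  then show False by (simp add: AE_False)
qed

lemma process_exists:
  assumes H: "0 < H" and g: "g \<in> G1" and not_OR: "(\<lambda>x. gen_inv g x + ln x) \<notin> class_OR"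
    and sub: "radial_submultiplicative TYPE('n) (gen_inv g)"
  shows "\<exists>(M :: (real \<Rightarrow> real ^ 'n) measure) (X :: real \<Rightarrow> (real \<Rightarrow> real ^ 'n) \<Rightarrow> real ^ 'n).
    selfsimilar_additive M H X \<and> \<not> deterministic M H X \<and>
    (AE \<omega> in M. growth_limsup H g (\<lambda>t. norm (X t \<omega>)) = 1)"
proof -
  \<comment> \<open>On the ray through a unit vector norms add, so radial submultiplicativity
    becomes a statement about nonnegative reals.\<close>
  define e :: "real ^ 'n" where "e = axis undefined 1"
  have e: "norm e = 1" by (simp add: e_def)
  obtain b C where C: "0 < C"
    and sub': "\<And>y z :: real ^ 'n. gen_inv g (max (norm (y + z)) b) \<le> C * gen_inv g (max (norm y) b) * gen_inv g (max (norm z) b)"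
    using sub unfolding radial_submultiplicative_def submultiplicative_def by blast
  obtain \<pi> c where \<pi>: "prob_space \<pi>" "sets \<pi> = sets borel" and c: "0 < c"
    and 1: "(\<integral>\<^sup>+r. ennreal (ln (1 + \<bar>r\<bar>)) \<partial>\<pi>) < \<infinity>"
    and 2: "(\<integral>\<^sup>+r. ennreal (gen_inv g (max \<bar>r\<bar> b)) \<partial>\<pi>) < \<infinity>"
    and 3: "(\<Sum>n. emeasure \<pi> {r. g (real (Suc n)) < c * \<bar>r\<bar>}) = \<infinity>"
    by (rule mark_law_exists[OF g not_OR, of b])
  interpret marked_poisson \<pi> by (rule marked_poisson.intro[OF \<pi>])
  have "(\<Sum>n. emeasure blk {b\<in>space blk. g (real n) < total b}) < \<infinity>"
  proof (rule suminf_total_tail_submult[OF g C _ 2])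
    fix r s :: real assume "0 \<le> r" "0 \<le> s"
    then show "gen_inv g (max (r + s) b) \<le> C * gen_inv g (max r b) * gen_inv g (max s b)"
      using sub'[of "r *\<^sub>R e" "s *\<^sub>R e"] e by (simp flip: scaleR_add_left)
  qed
  then interpret ss_growth \<pi> H g c
    using H 1 g c 3 by unfold_locales auto
  obtain K where K: "0 < K" and lim: "AE \<omega> in \<Omega>. growth_limsup H g (\<lambda>t. proc t \<omega>) = ereal K"
    using AE_Limsup_proc_const by blast
  \<comment> \<open>The upper limit is homogeneous in the direction vector, so dividing by
    \<open>K\<close> normalises it to \<open>1\<close> without affecting selfsimilarity or
    additivity.\<close>
  let ?X = "\<lambda>t \<omega>. proc t \<omega> *\<^sub>R ((1 / K) *\<^sub>R e)"
  have "AE \<omega> in \<Omega>. growth_limsup H g (\<lambda>t. norm (?X t \<omega>)) = 1"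
    using lim
  proof eventually_elim
    case (elim \<omega>)
    have "growth_limsup H g (\<lambda>t. norm (?X t \<omega>))
      = Limsup at_top (\<lambda>t. ereal (1 / K) * ereal (proc t \<omega> / (t powr H * g (ln t))))"
      using K e proc_nonneg by simp
    also have "\<dots> = ereal (1 / K) * ereal K"
      using K by (subst Limsup_ereal_mult_left) (auto simp: elim)
    also have "\<dots> = 1" using K by simp
    finally show ?case .
  qed
  from path_space_version[OF selfsimilar_additive_proc, of "\<lambda>p. growth_limsup H g (\<lambda>t. norm (p t)) = 1", OF this]
  obtain N :: "(real \<Rightarrow> real ^ 'n) measure" where N: "selfsimilar_additive N H (\<lambda>t p. p t)"
    and limN: "AE p in N. growth_limsup H g (\<lambda>t. norm (p t)) = 1"
    by blast
  moreover have "\<not> deterministic N H (\<lambda>t p. p t)"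
    using N by (intro not_deterministic[OF _ g limN]) (simp add: selfsimilar_additive_def)
  ultimately show ?thesis by blast
qed

theorem theorem2p18:
  fixes H :: real and g :: "real \<Rightarrow> real"
  assumes "0 < H" and "g \<in> G1"
  shows
    "((\<exists>(M :: 'w measure) (X :: real \<Rightarrow> 'w \<Rightarrow> real ^ 'n).
          selfsimilar_additive M H X \<and> \<not> deterministic M H X \<and>
          (AE \<omega> in M. Limsup at_top (\<lambda>t. ereal (norm (X t \<omega>) / (t powr H * g (ln t)))) = 1))
        \<longrightarrow> (\<lambda>x. gen_inv g x + ln x) \<notin> class_OR)
     \<and>
     (radial_submultiplicative TYPE('n) (gen_inv g) \<longrightarrow>
        (\<lambda>x. gen_inv g x + ln x) \<notin> class_OR \<longrightarrow>
        (\<exists>(M :: (real \<Rightarrow> real ^ 'n) measure) (X :: real \<Rightarrow> (real \<Rightarrow> real ^ 'n) \<Rightarrow> real ^ 'n).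
          selfsimilar_additive M H X \<and> \<not> deterministic M H X \<and>
          (AE \<omega> in M. Limsup at_top (\<lambda>t. ereal (norm (X t \<omega>) / (t powr H * g (ln t)))) = 1)))"
proof (intro conjI impI)
  assume "\<exists>(M :: 'w measure) (X :: real \<Rightarrow> 'w \<Rightarrow> real ^ 'n).
          selfsimilar_additive M H X \<and> \<not> deterministic M H X \<and>
          (AE \<omega> in M. Limsup at_top (\<lambda>t. ereal (norm (X t \<omega>) / (t powr H * g (ln t)))) = 1)"
  then obtain M :: "'w measure" and X :: "real \<Rightarrow> 'w \<Rightarrow> real ^ 'n" where "selfsimilar_additive M H X"
    and lim: "AE \<omega> in M. Limsup at_top (\<lambda>t. ereal (norm (X t \<omega>) / (t powr H * g (ln t)))) = 1"
    by blast
  then interpret ss_additive M H X using \<open>0 < H\<close> by unfold_locales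
  show "(\<lambda>x. gen_inv g x + ln x) \<notin> class_OR" by (rule not_class_OR[OF \<open>g \<in> G1\<close> lim])
next
  assume "radial_submultiplicative TYPE('n) (gen_inv g)" "(\<lambda>x. gen_inv g x + ln x) \<notin> class_OR"
  then show "\<exists>(M :: (real \<Rightarrow> real ^ 'n) measure) (X :: real \<Rightarrow> (real \<Rightarrow> real ^ 'n) \<Rightarrow> real ^ 'n).
          selfsimilar_additive M H X \<and> \<not> deterministic M H X \<and>
          (AE \<omega> in M. Limsup at_top (\<lambda>t. ereal (norm (X t \<omega>) / (t powr H * g (ln t)))) = 1)"
    using process_exists[OF assms] by blast
qed

end
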